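(* Let $X$ be the higher inductive type with constructors $\mathrm{pt} : X$, $a, b : \Omega X$, $r : a^5 = b^3$, and $s : b^3 = (ab)^2$. Then there is a $0$-connected map $X \to \mathrm{B}\mathrm{A}_5$, where $\mathrm{B}\mathrm{A}_5$ is the classifying type of the alternating group $\mathrm{A}_5$.
   Context: We work in homotopy type theory (HoTT) in the style of the HoTT Book: dependent type theory with univalent universes (hence function extensionality) and higher inductive types; no classical axioms are assumed. $\Omega X$ denotes the loop type $(\mathrm{pt} =_X \mathrm{pt})$; products and powers of loops are with respect to path concatenation. A map is $0$-connected if the set truncation of each of its fibers is contractible. The classifying type $\mathrm{B}G$ of a group $G$ is the ($0$-connected, pointed) $1$-type with a group isomorphism $G \cong (\mathrm{pt} =_{\mathrm{B}G} \mathrm{pt})$. *)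

theory Defs
  imports Main
begin

text \<open>
  Homotopy type theory is represented as an object language: raw terms, definitional equality and
  typing are formalised along the lines of the first presentation in the appendix of the HoTT Book
  (unannotated abstractions, primitive constants with closed types, untyped convertibility).
  A theorem of homotopy type theory is then the assertion that a closed type has a closed inhabitant.

  Only the type formers needed to state the theorem, and univalence and function extensionality,
  are present; no classical principle is.
\<close>

section \<open>Raw terms\<close>

datatype const =
    CSig | CPair | CSigInd
  | CId | CRefl | CIdInd
  | CFin nat | CEl nat nat | CFinInd nat
  | CFunext | CUnivalence
  | CTrunc | CTr | CTruncSet | CTruncInd
  | CX | CPt | CA | CB | CR | CS | CXInd | CXIndA | CXIndB | CXIndR | CXIndS

text \<open>Variables are de Bruijn indices; \<open>Lam t\<close> and the second argument of \<open>Pi\<close> bind one variable.\<close>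

datatype tm =
    Var nat
  | Lam tm
  | App tm tm
  | Pi tm tm
  | U nat
  | Const const

primrec lift :: "nat \<Rightarrow> tm \<Rightarrow> tm" where
  "lift k (Var n) = (if n < k then Var n else Var (Suc n))"
| "lift k (Lam t) = Lam (lift (Suc k) t)"
| "lift k (App t u) = App (lift k t) (lift k u)"
| "lift k (Pi A B) = Pi (lift k A) (lift (Suc k) B)"
| "lift k (U i) = U i"
| "lift k (Const c) = Const c"

text \<open>\<open>subst k s t\<close> replaces variable \<open>k\<close> of \<open>t\<close> by \<open>s\<close> and lowers the variables above \<open>k\<close>.\<close>

primrec subst :: "nat \<Rightarrow> tm \<Rightarrow> tm \<Rightarrow> tm" where
  "subst k s (Var n) = (if n < k then Var n else if n = k then s else Var (n - 1))"
| "subst k s (Lam t) = Lam (subst (Suc k) (lift 0 s) t)"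
| "subst k s (App t u) = App (subst k s t) (subst k s u)"
| "subst k s (Pi A B) = Pi (subst k s A) (subst (Suc k) (lift 0 s) B)"
| "subst k s (U i) = U i"
| "subst k s (Const c) = Const c"

definition apps :: "tm \<Rightarrow> tm list \<Rightarrow> tm" where
  "apps t us = foldl App t us"


section \<open>Definitional equality\<close>

inductive conv :: "tm \<Rightarrow> tm \<Rightarrow> bool" (infix "\<equiv>\<^sub>d" 50) where
  conv_refl: "t \<equiv>\<^sub>d t"
| conv_sym: "t \<equiv>\<^sub>d u \<Longrightarrow> u \<equiv>\<^sub>d t"
| conv_trans: "t \<equiv>\<^sub>d u \<Longrightarrow> u \<equiv>\<^sub>d v \<Longrightarrow> t \<equiv>\<^sub>d v"
| conv_Lam: "t \<equiv>\<^sub>d t' \<Longrightarrow> Lam t \<equiv>\<^sub>d Lam t'"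
| conv_App: "t \<equiv>\<^sub>d t' \<Longrightarrow> u \<equiv>\<^sub>d u' \<Longrightarrow> App t u \<equiv>\<^sub>d App t' u'"
| conv_Pi: "A \<equiv>\<^sub>d A' \<Longrightarrow> B \<equiv>\<^sub>d B' \<Longrightarrow> Pi A B \<equiv>\<^sub>d Pi A' B'"
| conv_beta: "App (Lam t) u \<equiv>\<^sub>d subst 0 u t"
| conv_eta: "Lam (App (lift 0 t) (Var 0)) \<equiv>\<^sub>d t"
| conv_SigInd:
    "apps (Const CSigInd) [A, B, C, g, apps (Const CPair) [A, B, a, b]] \<equiv>\<^sub>d apps g [a, b]"
| conv_IdInd:
    "apps (Const CIdInd) [A, C, c, a, a, apps (Const CRefl) [A, a]] \<equiv>\<^sub>d App c a"
| conv_FinInd: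
    "length cs = n \<Longrightarrow> k < n \<Longrightarrow>
     App (apps (App (Const (CFinInd n)) C) cs) (Const (CEl n k)) \<equiv>\<^sub>d cs ! k"
| conv_TruncInd:
    "apps (Const CTruncInd) [A, P, h, g, apps (Const CTr) [A, a]] \<equiv>\<^sub>d App g a"
| conv_XInd:
    "apps (Const CXInd) [P, p, a, b, r, s, Const CPt] \<equiv>\<^sub>d p"


section \<open>A surface syntax with named bound variables\<close>

text \<open>
  A surface term maps the number of binders in scope to a de Bruijn term.  A binder passes to its
  body the variable bound at level \<open>n\<close>, which at depth \<open>m > n\<close> is the index \<open>m - Suc n\<close>.
  In this way the binding facilities of the meta-logic serve as named variables, and the functions
  on surface terms defined below are macros, expanded when a term is evaluated at depth 0.
\<close>

type_synonym stm = "nat \<Rightarrow> tm"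

definition close_stm :: "stm \<Rightarrow> tm" where
  "close_stm t = t 0"

definition bound_var :: "nat \<Rightarrow> stm" where
  "bound_var n = (\<lambda>m. Var (m - Suc n))"

definition lam :: "(stm \<Rightarrow> stm) \<Rightarrow> stm" (binder "\<^bold>\<lambda>" 10) where
  "lam t = (\<lambda>n. Lam (t (bound_var n) (Suc n)))"

definition pi_ty :: "stm \<Rightarrow> (stm \<Rightarrow> stm) \<Rightarrow> stm" where
  "pi_ty A B = (\<lambda>n. Pi (A n) (B (bound_var n) (Suc n)))"

definition app :: "stm \<Rightarrow> stm \<Rightarrow> stm" (infixl "\<cdot>" 200) where
  "t \<cdot> u = (\<lambda>n. App (t n) (u n))"

definition universe :: "nat \<Rightarrow> stm" where
  "universe i = (\<lambda>n. U i)"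

definition cst :: "const \<Rightarrow> stm" where
  "cst c = (\<lambda>n. Const c)"

syntax
  "_hott_pi" :: "pttrn \<Rightarrow> stm \<Rightarrow> stm \<Rightarrow> stm" ("(3\<^bold>\<Pi>_:_./ _)" [0, 61, 60] 60)
translations
  "\<^bold>\<Pi>x:A. B" \<rightleftharpoons> "CONST pi_ty A (\<lambda>x. B)"

definition arrow :: "stm \<Rightarrow> stm \<Rightarrow> stm" (infixr "\<^bold>\<rightarrow>" 65) where
  "A \<^bold>\<rightarrow> B = (\<^bold>\<Pi>x:A. B)"

definition sigma_ty :: "stm \<Rightarrow> (stm \<Rightarrow> stm) \<Rightarrow> stm" where
  "sigma_ty A B = cst CSig \<cdot> A \<cdot> lam B"

syntax
  "_hott_sig" :: "pttrn \<Rightarrow> stm \<Rightarrow> stm \<Rightarrow> stm" ("(3\<^bold>\<Sigma>_:_./ _)" [0, 61, 60] 60)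
translations
  "\<^bold>\<Sigma>x:A. B" \<rightleftharpoons> "CONST sigma_ty A (\<lambda>x. B)"

definition times :: "stm \<Rightarrow> stm \<Rightarrow> stm" (infixr "\<^bold>\<times>" 70) where
  "A \<^bold>\<times> B = (\<^bold>\<Sigma>x:A. B)"

definition pair :: "stm \<Rightarrow> (stm \<Rightarrow> stm) \<Rightarrow> stm \<Rightarrow> stm \<Rightarrow> stm" where
  "pair A B a b = cst CPair \<cdot> A \<cdot> lam B \<cdot> a \<cdot> b"

definition pr1 :: "stm \<Rightarrow> (stm \<Rightarrow> stm) \<Rightarrow> stm \<Rightarrow> stm" where
  "pr1 A B z = cst CSigInd \<cdot> A \<cdot> lam B \<cdot> (\<^bold>\<lambda>z. A) \<cdot> (\<^bold>\<lambda>x y. x) \<cdot> z"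

definition idt :: "stm \<Rightarrow> stm \<Rightarrow> stm \<Rightarrow> stm" ("(_ \<^bold>=\<^bsub>_\<^esub>/ _)" [80, 0, 80] 75) where
  "x \<^bold>=\<^bsub>A\<^esub> y = cst CId \<cdot> A \<cdot> x \<cdot> y"

definition rfl :: "stm \<Rightarrow> stm \<Rightarrow> stm" where
  "rfl A x = cst CRefl \<cdot> A \<cdot> x"

text \<open>Path induction, with motive \<open>C\<close> and value \<open>c\<close> at reflexivity, applied to \<open>p : x = y\<close>.\<close>

definition path_ind ::
    "stm \<Rightarrow> (stm \<Rightarrow> stm \<Rightarrow> stm \<Rightarrow> stm) \<Rightarrow> (stm \<Rightarrow> stm) \<Rightarrow> stm \<Rightarrow> stm \<Rightarrow> stm \<Rightarrow> stm" where
  "path_ind A C c x y p = cst CIdInd \<cdot> A \<cdot> (\<^bold>\<lambda>x y p. C x y p) \<cdot> lam c \<cdot> x \<cdot> y \<cdot> p"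


section \<open>Truncation levels and equivalences\<close>

definition is_contr :: "stm \<Rightarrow> stm" where
  "is_contr A = (\<^bold>\<Sigma>x:A. \<^bold>\<Pi>y:A. x \<^bold>=\<^bsub>A\<^esub> y)"

definition is_prop :: "stm \<Rightarrow> stm" where
  "is_prop A = (\<^bold>\<Pi>x:A. \<^bold>\<Pi>y:A. x \<^bold>=\<^bsub>A\<^esub> y)"

definition is_set :: "stm \<Rightarrow> stm" where
  "is_set A = (\<^bold>\<Pi>x:A. \<^bold>\<Pi>y:A. is_prop (x \<^bold>=\<^bsub>A\<^esub> y))"

definition is_1type :: "stm \<Rightarrow> stm" where
  "is_1type A = (\<^bold>\<Pi>x:A. \<^bold>\<Pi>y:A. is_set (x \<^bold>=\<^bsub>A\<^esub> y))"

definition fib :: "stm \<Rightarrow> stm \<Rightarrow> stm \<Rightarrow> stm \<Rightarrow> stm" where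
  "fib A B f y = (\<^bold>\<Sigma>x:A. f \<cdot> x \<^bold>=\<^bsub>B\<^esub> y)"

definition is_equiv :: "stm \<Rightarrow> stm \<Rightarrow> stm \<Rightarrow> stm" where
  "is_equiv A B f = (\<^bold>\<Pi>y:B. is_contr (fib A B f y))"

definition equiv :: "stm \<Rightarrow> stm \<Rightarrow> stm" where
  "equiv A B = (\<^bold>\<Sigma>f:A \<^bold>\<rightarrow> B. is_equiv A B f)"

definition equiv_fun :: "stm \<Rightarrow> stm \<Rightarrow> stm \<Rightarrow> stm" where
  "equiv_fun A B e = pr1 (A \<^bold>\<rightarrow> B) (\<lambda>f. is_equiv A B f) e"

definition id_is_equiv :: "stm \<Rightarrow> stm" where
  "id_is_equiv A =
    (let F = \<lambda>y. fib A A (\<^bold>\<lambda>x. x) y;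
         c = \<lambda>y. pair A (\<lambda>x. (\<^bold>\<lambda>x. x) \<cdot> x \<^bold>=\<^bsub>A\<^esub> y) y (rfl A y)
     in \<^bold>\<lambda>y. pair (F y) (\<lambda>z. \<^bold>\<Pi>w:F y. z \<^bold>=\<^bsub>F y\<^esub> w) (c y)
          (\<^bold>\<lambda>w. cst CSigInd \<cdot> A \<cdot> (\<^bold>\<lambda>x. (\<^bold>\<lambda>x. x) \<cdot> x \<^bold>=\<^bsub>A\<^esub> y) \<cdot> (\<^bold>\<lambda>w. c y \<^bold>=\<^bsub>F y\<^esub> w)
            \<cdot> (\<^bold>\<lambda>x q. path_ind A
                  (\<lambda>x y q. c y \<^bold>=\<^bsub>F y\<^esub> pair A (\<lambda>x. (\<^bold>\<lambda>x. x) \<cdot> x \<^bold>=\<^bsub>A\<^esub> y) x q)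
                  (\<lambda>x. rfl (F x) (c x)) x y q)
            \<cdot> w))"

definition id_to_equiv :: "nat \<Rightarrow> stm \<Rightarrow> stm \<Rightarrow> stm \<Rightarrow> stm" where
  "id_to_equiv i A B p =
     path_ind (universe i) (\<lambda>A B p. equiv A B)
       (\<lambda>A. pair (A \<^bold>\<rightarrow> A) (\<lambda>f. is_equiv A A f) (\<^bold>\<lambda>x. x) (id_is_equiv A)) A B p"

definition happly :: "stm \<Rightarrow> (stm \<Rightarrow> stm) \<Rightarrow> stm \<Rightarrow> stm \<Rightarrow> stm \<Rightarrow> stm" where
  "happly A B f g p =
     path_ind (\<^bold>\<Pi>x:A. B x) (\<lambda>f g p. \<^bold>\<Pi>x:A. f \<cdot> x \<^bold>=\<^bsub>B x\<^esub> g \<cdot> x)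
       (\<lambda>f. \<^bold>\<lambda>x. rfl (B x) (f \<cdot> x)) f g p"

definition trunc :: "stm \<Rightarrow> stm" where
  "trunc A = cst CTrunc \<cdot> A"


section \<open>Paths and dependent paths\<close>

text \<open>\<open>conc A x y z p q\<close> is the concatenation of \<open>p : x = y\<close> and \<open>q : y = z\<close>.\<close>

definition conc :: "stm \<Rightarrow> stm \<Rightarrow> stm \<Rightarrow> stm \<Rightarrow> stm \<Rightarrow> stm \<Rightarrow> stm" where
  "conc A x y z p q =
     path_ind A (\<lambda>y z q. (x \<^bold>=\<^bsub>A\<^esub> y) \<^bold>\<rightarrow> (x \<^bold>=\<^bsub>A\<^esub> z)) (\<lambda>y. \<^bold>\<lambda>p. p) y z q \<cdot> p"

primrec loop_pow :: "stm \<Rightarrow> stm \<Rightarrow> stm \<Rightarrow> nat \<Rightarrow> stm" where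
  "loop_pow A x p 0 = rfl A x"
| "loop_pow A x p (Suc n) = conc A x x x (loop_pow A x p n) p"

definition transp :: "stm \<Rightarrow> (stm \<Rightarrow> stm) \<Rightarrow> stm \<Rightarrow> stm \<Rightarrow> stm \<Rightarrow> stm" where
  "transp A P x y p = path_ind A (\<lambda>x y p. P x \<^bold>\<rightarrow> P y) (\<lambda>x. \<^bold>\<lambda>u. u) x y p"

text \<open>Paths from \<open>u : P x\<close> to \<open>v : P y\<close> lying over \<open>p : x = y\<close>.\<close>

definition dpath :: "stm \<Rightarrow> (stm \<Rightarrow> stm) \<Rightarrow> stm \<Rightarrow> stm \<Rightarrow> stm \<Rightarrow> stm \<Rightarrow> stm \<Rightarrow> stm" where
  "dpath A P x y p u v = (transp A P x y p \<cdot> u \<^bold>=\<^bsub>P y\<^esub> v)"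

text \<open>The concatenation of \<open>d\<close> over \<open>p\<close> and \<open>e\<close> over \<open>q\<close>, which lies over \<open>conc A x y z p q\<close>.\<close>

definition dconc ::
    "stm \<Rightarrow> (stm \<Rightarrow> stm) \<Rightarrow> stm \<Rightarrow> stm \<Rightarrow> stm \<Rightarrow> stm \<Rightarrow> stm \<Rightarrow> stm \<Rightarrow> stm \<Rightarrow> stm \<Rightarrow> stm \<Rightarrow> stm \<Rightarrow> stm"
  where
  "dconc A P x y z p q u v w d e =
     path_ind A
       (\<lambda>y z q. \<^bold>\<Pi>p:(x \<^bold>=\<^bsub>A\<^esub> y). \<^bold>\<Pi>v:P y. \<^bold>\<Pi>w:P z.
          dpath A P x y p u v \<^bold>\<rightarrow> dpath A P y z q v w \<^bold>\<rightarrow> dpath A P x z (conc A x y z p q) u w)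
       (\<lambda>y. \<^bold>\<lambda>p v w d e. conc (P y) (transp A P x y p \<cdot> u) v w d e)
       y z q \<cdot> p \<cdot> v \<cdot> w \<cdot> d \<cdot> e"

primrec dloop_pow ::
    "stm \<Rightarrow> (stm \<Rightarrow> stm) \<Rightarrow> stm \<Rightarrow> stm \<Rightarrow> stm \<Rightarrow> stm \<Rightarrow> nat \<Rightarrow> stm" where
  "dloop_pow A P x p u d 0 = rfl (P x) u"
| "dloop_pow A P x p u d (Suc n) =
     dconc A P x x x (loop_pow A x p n) p u u u (dloop_pow A P x p u d n) d"

text \<open>
  Two-dimensional dependent paths: for loops \<open>q\<close>, \<open>q'\<close> at \<open>x\<close> and \<open>t : q = q'\<close>, the paths over \<open>t\<close>
  from \<open>d\<close> (over \<open>q\<close>) to \<open>d'\<close> (over \<open>q'\<close>), where \<open>d\<close> and \<open>d'\<close> start and end at \<open>u : P x\<close>.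
\<close>

definition dpath2 ::
    "stm \<Rightarrow> (stm \<Rightarrow> stm) \<Rightarrow> stm \<Rightarrow> stm \<Rightarrow> stm \<Rightarrow> stm \<Rightarrow> stm \<Rightarrow> stm \<Rightarrow> stm \<Rightarrow> stm" where
  "dpath2 A P x u q q' t d d' =
     dpath (x \<^bold>=\<^bsub>A\<^esub> x) (\<lambda>q. dpath A P x x q u u) q q' t d d'"

text \<open>The action of a dependent function \<open>f\<close> on paths, and its compatibility with concatenation.\<close>

definition apd :: "stm \<Rightarrow> (stm \<Rightarrow> stm) \<Rightarrow> stm \<Rightarrow> stm \<Rightarrow> stm \<Rightarrow> stm \<Rightarrow> stm" where
  "apd A P f x y p =
     path_ind A (\<lambda>x y p. dpath A P x y p (f \<cdot> x) (f \<cdot> y)) (\<lambda>x. rfl (P x) (f \<cdot> x)) x y p"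

definition apd_conc ::
    "stm \<Rightarrow> (stm \<Rightarrow> stm) \<Rightarrow> stm \<Rightarrow> stm \<Rightarrow> stm \<Rightarrow> stm \<Rightarrow> stm \<Rightarrow> stm \<Rightarrow> stm" where
  "apd_conc A P f x y z p q =
     path_ind A
       (\<lambda>y z q. \<^bold>\<Pi>p:(x \<^bold>=\<^bsub>A\<^esub> y).
          apd A P f x z (conc A x y z p q)
            \<^bold>=\<^bsub>dpath A P x z (conc A x y z p q) (f \<cdot> x) (f \<cdot> z)\<^esub>
          dconc A P x y z p q (f \<cdot> x) (f \<cdot> y) (f \<cdot> z) (apd A P f x y p) (apd A P f y z q))
       (\<lambda>y. \<^bold>\<lambda>p. rfl (dpath A P x y p (f \<cdot> x) (f \<cdot> y)) (apd A P f x y p))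
       y z q \<cdot> p"

primrec apd_pow :: "stm \<Rightarrow> (stm \<Rightarrow> stm) \<Rightarrow> stm \<Rightarrow> stm \<Rightarrow> stm \<Rightarrow> nat \<Rightarrow> stm" where
  "apd_pow A P f x p 0 = rfl (dpath A P x x (rfl A x) (f \<cdot> x) (f \<cdot> x)) (rfl (P x) (f \<cdot> x))"
| "apd_pow A P f x p (Suc n) =
     (let q = loop_pow A x p n
      in transp (dpath A P x x q (f \<cdot> x) (f \<cdot> x))
           (\<lambda>d. apd A P f x x (conc A x x x q p)
                  \<^bold>=\<^bsub>dpath A P x x (conc A x x x q p) (f \<cdot> x) (f \<cdot> x)\<^esub>
                dconc A P x x x q p (f \<cdot> x) (f \<cdot> x) (f \<cdot> x) d (apd A P f x x p))
           (apd A P f x x q) (dloop_pow A P x p (f \<cdot> x) (apd A P f x x p) n) (apd_pow A P f x p n)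
         \<cdot> apd_conc A P f x x x q p)"

text \<open>
  The action of \<open>f\<close> on \<open>t : q = q'\<close>, with its endpoints \<open>apd f q\<close> and \<open>apd f q'\<close> replaced by
  \<open>d\<close> and \<open>d'\<close> along the paths \<open>k : apd f q = d\<close> and \<open>k' : apd f q' = d'\<close>.
\<close>

definition apd2 ::
    "stm \<Rightarrow> (stm \<Rightarrow> stm) \<Rightarrow> stm \<Rightarrow> stm \<Rightarrow> stm \<Rightarrow> stm \<Rightarrow> stm \<Rightarrow> stm \<Rightarrow> stm \<Rightarrow> stm \<Rightarrow> stm \<Rightarrow> stm" where
  "apd2 A P f x q q' t d d' k k' =
     (let u = f \<cdot> x; D = \<lambda>q. dpath A P x x q u u
      in transp (D q') (\<lambda>e'. dpath2 A P x u q q' t d e') (apd A P f x x q') d' k'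
           \<cdot> (transp (D q) (\<lambda>e. dpath2 A P x u q q' t e (apd A P f x x q')) (apd A P f x x q) d k
               \<cdot> apd (x \<^bold>=\<^bsub>A\<^esub> x) D (\<^bold>\<lambda>q. apd A P f x x q) q q' t))"


section \<open>The higher inductive type X\<close>

definition X :: stm where "X = cst CX"

definition ptX :: stm where "ptX = cst CPt"

definition loopsX :: stm where "loopsX = (ptX \<^bold>=\<^bsub>X\<^esub> ptX)"

definition aX :: stm where "aX = cst CA"

definition bX :: stm where "bX = cst CB"

definition abX :: stm where "abX = conc X ptX ptX ptX aX bX"

definition powX :: "stm \<Rightarrow> nat \<Rightarrow> stm" where "powX p n = loop_pow X ptX p n"

text \<open>
  The types of the induction data over \<open>a\<close>, \<open>b\<close>, \<open>r\<close> and \<open>s\<close>, for a family \<open>P\<close> over \<open>X\<close> and \<open>p : P pt\<close>.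
\<close>

definition dloopX :: "(stm \<Rightarrow> stm) \<Rightarrow> stm \<Rightarrow> stm \<Rightarrow> stm" where
  "dloopX P p l = dpath X P ptX ptX l p p"

definition dpowX :: "(stm \<Rightarrow> stm) \<Rightarrow> stm \<Rightarrow> stm \<Rightarrow> stm \<Rightarrow> nat \<Rightarrow> stm" where
  "dpowX P p l d n = dloop_pow X P ptX l p d n"

definition dabX :: "(stm \<Rightarrow> stm) \<Rightarrow> stm \<Rightarrow> stm \<Rightarrow> stm \<Rightarrow> stm" where
  "dabX P p a' b' = dconc X P ptX ptX ptX aX bX p p p a' b'"

definition dataR :: "(stm \<Rightarrow> stm) \<Rightarrow> stm \<Rightarrow> stm \<Rightarrow> stm \<Rightarrow> stm" where
  "dataR P p a' b' =
     dpath2 X P ptX p (powX aX 5) (powX bX 3) (cst CR) (dpowX P p aX a' 5) (dpowX P p bX b' 3)"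

definition dataS :: "(stm \<Rightarrow> stm) \<Rightarrow> stm \<Rightarrow> stm \<Rightarrow> stm \<Rightarrow> stm" where
  "dataS P p a' b' =
     dpath2 X P ptX p (powX bX 3) (powX abX 2) (cst CS)
       (dpowX P p bX b' 3) (dpowX P p abX (dabX P p a' b') 2)"

text \<open>The action of \<open>f\<close> on the path constructors.\<close>

definition apdX :: "(stm \<Rightarrow> stm) \<Rightarrow> stm \<Rightarrow> stm \<Rightarrow> stm" where
  "apdX P f l = apd X P f ptX ptX l"

definition apdR :: "(stm \<Rightarrow> stm) \<Rightarrow> stm \<Rightarrow> stm" where
  "apdR P f =
     apd2 X P f ptX (powX aX 5) (powX bX 3) (cst CR)
       (dpowX P (f \<cdot> ptX) aX (apdX P f aX) 5) (dpowX P (f \<cdot> ptX) bX (apdX P f bX) 3)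
       (apd_pow X P f ptX aX 5) (apd_pow X P f ptX bX 3)"

definition apdS :: "(stm \<Rightarrow> stm) \<Rightarrow> stm \<Rightarrow> stm" where
  "apdS P f =
     (let p = f \<cdot> ptX; d = dabX P p (apdX P f aX) (apdX P f bX)
      in apd2 X P f ptX (powX bX 3) (powX abX 2) (cst CS)
           (dpowX P p bX (apdX P f bX) 3) (dpowX P p abX d 2)
           (apd_pow X P f ptX bX 3)
           (transp (dloopX P p abX)
              (\<lambda>d. apdX P f (powX abX 2) \<^bold>=\<^bsub>dloopX P p (powX abX 2)\<^esub> dpowX P p abX d 2)
              (apdX P f abX) d (apd_conc X P f ptX ptX ptX aX bX)
            \<cdot> apd_pow X P f ptX abX 2))"

text \<open>
  \<open>ind_data i T\<close> quantifies over a family \<open>P\<close> in universe \<open>i\<close> and all data of an induction into \<open>P\<close>;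
  \<open>T\<close> receives the family, the data, and the application of a given constant to all of them.
\<close>

definition ind_data ::
    "nat \<Rightarrow> ((stm \<Rightarrow> stm) \<Rightarrow> stm \<Rightarrow> stm \<Rightarrow> stm \<Rightarrow> stm \<Rightarrow> stm \<Rightarrow> (const \<Rightarrow> stm) \<Rightarrow> stm) \<Rightarrow> stm" where
  "ind_data i T =
     (\<^bold>\<Pi>Q:X \<^bold>\<rightarrow> universe i. (let P = \<lambda>x. Q \<cdot> x in
      \<^bold>\<Pi>p:P ptX. \<^bold>\<Pi>a':dloopX P p aX. \<^bold>\<Pi>b':dloopX P p bX. \<^bold>\<Pi>r':dataR P p a' b'. \<^bold>\<Pi>s':dataS P p a' b'.
      T P p a' b' r' s' (\<lambda>c. cst c \<cdot> Q \<cdot> p \<cdot> a' \<cdot> b' \<cdot> r' \<cdot> s')))"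

text \<open>
  The propositional computation rules on \<open>r\<close> and \<open>s\<close> hold over those on \<open>a\<close> and \<open>b\<close>: the action \<open>t\<close>
  of \<open>f\<close> on \<open>r\<close> or \<open>s\<close> is transported along \<open>ea : apd f a = a'\<close> and \<open>eb : apd f b = b'\<close>.
\<close>

definition over_ab ::
    "((stm \<Rightarrow> stm) \<Rightarrow> stm \<Rightarrow> stm \<Rightarrow> stm \<Rightarrow> stm) \<Rightarrow>
     (stm \<Rightarrow> stm) \<Rightarrow> stm \<Rightarrow> stm \<Rightarrow> stm \<Rightarrow> stm \<Rightarrow> stm \<Rightarrow> stm \<Rightarrow> stm \<Rightarrow> stm" where
  "over_ab D P p a' b' f ea eb t =
     transp (dloopX P p bX) (\<lambda>d. D P p a' d) (apdX P f bX) b' eb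
       \<cdot> (transp (dloopX P p aX) (\<lambda>d. D P p d (apdX P f bX)) (apdX P f aX) a' ea \<cdot> t)"


section \<open>The types of the primitive constants\<close>

text \<open>
  \<open>const_type c i j\<close> is the type of \<open>c\<close> at universe levels \<open>i\<close> and \<open>j\<close>.  Levels are not recorded in
  the constants (typical ambiguity); a constant has each of the types obtained from a choice of levels.
  \<open>CFin n\<close> is the inductive type with \<open>n\<close> nullary constructors \<open>CEl n k\<close>, where \<open>k < n\<close>.
\<close>

fun const_type :: "const \<Rightarrow> nat \<Rightarrow> nat \<Rightarrow> stm" where
  "const_type CSig i j = (\<^bold>\<Pi>A:universe i. (A \<^bold>\<rightarrow> universe i) \<^bold>\<rightarrow> universe i)"
| "const_type CPair i j =
     (\<^bold>\<Pi>A:universe i. \<^bold>\<Pi>B:A \<^bold>\<rightarrow> universe i. \<^bold>\<Pi>a:A. B \<cdot> a \<^bold>\<rightarrow> cst CSig \<cdot> A \<cdot> B)"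
| "const_type CSigInd i j =
     (\<^bold>\<Pi>A:universe i. \<^bold>\<Pi>B:A \<^bold>\<rightarrow> universe i. \<^bold>\<Pi>C:(cst CSig \<cdot> A \<cdot> B \<^bold>\<rightarrow> universe j).
        (\<^bold>\<Pi>a:A. \<^bold>\<Pi>b:B \<cdot> a. C \<cdot> (cst CPair \<cdot> A \<cdot> B \<cdot> a \<cdot> b)) \<^bold>\<rightarrow> (\<^bold>\<Pi>z:cst CSig \<cdot> A \<cdot> B. C \<cdot> z))"
| "const_type CId i j = (\<^bold>\<Pi>A:universe i. A \<^bold>\<rightarrow> A \<^bold>\<rightarrow> universe i)"
| "const_type CRefl i j = (\<^bold>\<Pi>A:universe i. \<^bold>\<Pi>x:A. x \<^bold>=\<^bsub>A\<^esub> x)"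
| "const_type CIdInd i j =
     (\<^bold>\<Pi>A:universe i. \<^bold>\<Pi>C:(\<^bold>\<Pi>x:A. \<^bold>\<Pi>y:A. x \<^bold>=\<^bsub>A\<^esub> y \<^bold>\<rightarrow> universe j).
        (\<^bold>\<Pi>x:A. C \<cdot> x \<cdot> x \<cdot> rfl A x) \<^bold>\<rightarrow> (\<^bold>\<Pi>x:A. \<^bold>\<Pi>y:A. \<^bold>\<Pi>p:x \<^bold>=\<^bsub>A\<^esub> y. C \<cdot> x \<cdot> y \<cdot> p))"
| "const_type (CFin n) i j = universe 0"
| "const_type (CEl n k) i j = cst (CFin n)"
| "const_type (CFinInd n) i j =
     (\<^bold>\<Pi>C:cst (CFin n) \<^bold>\<rightarrow> universe j.
        foldr (\<lambda>k T. C \<cdot> cst (CEl n k) \<^bold>\<rightarrow> T) [0..<n] (\<^bold>\<Pi>x:cst (CFin n). C \<cdot> x))"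
| "const_type CFunext i j =
     (\<^bold>\<Pi>A:universe i. \<^bold>\<Pi>B:A \<^bold>\<rightarrow> universe i. \<^bold>\<Pi>f:(\<^bold>\<Pi>x:A. B \<cdot> x). \<^bold>\<Pi>g:(\<^bold>\<Pi>x:A. B \<cdot> x).
        is_equiv (f \<^bold>=\<^bsub>\<^bold>\<Pi>x:A. B \<cdot> x\<^esub> g) (\<^bold>\<Pi>x:A. f \<cdot> x \<^bold>=\<^bsub>B \<cdot> x\<^esub> g \<cdot> x)
          (\<^bold>\<lambda>p. happly A (\<lambda>x. B \<cdot> x) f g p))"
| "const_type CUnivalence i j =
     (\<^bold>\<Pi>A:universe i. \<^bold>\<Pi>B:universe i.
        is_equiv (A \<^bold>=\<^bsub>universe i\<^esub> B) (equiv A B) (\<^bold>\<lambda>p. id_to_equiv i A B p))"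
| "const_type CTrunc i j = universe i \<^bold>\<rightarrow> universe i"
| "const_type CTr i j = (\<^bold>\<Pi>A:universe i. A \<^bold>\<rightarrow> trunc A)"
| "const_type CTruncSet i j = (\<^bold>\<Pi>A:universe i. is_set (trunc A))"
| "const_type CTruncInd i j =
     (\<^bold>\<Pi>A:universe i. \<^bold>\<Pi>P:trunc A \<^bold>\<rightarrow> universe j. (\<^bold>\<Pi>z:trunc A. is_set (P \<cdot> z)) \<^bold>\<rightarrow>
        (\<^bold>\<Pi>a:A. P \<cdot> (cst CTr \<cdot> A \<cdot> a)) \<^bold>\<rightarrow> (\<^bold>\<Pi>z:trunc A. P \<cdot> z))"
| "const_type CX i j = universe 0"
| "const_type CPt i j = X"
| "const_type CA i j = loopsX"
| "const_type CB i j = loopsX"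
| "const_type CR i j = (powX aX 5 \<^bold>=\<^bsub>loopsX\<^esub> powX bX 3)"
| "const_type CS i j = (powX bX 3 \<^bold>=\<^bsub>loopsX\<^esub> powX abX 2)"
| "const_type CXInd i j = ind_data i (\<lambda>P p a' b' r' s' I. \<^bold>\<Pi>x:X. P x)"
| "const_type CXIndA i j =
     ind_data i (\<lambda>P p a' b' r' s' I. apdX P (I CXInd) aX \<^bold>=\<^bsub>dloopX P p aX\<^esub> a')"
| "const_type CXIndB i j =
     ind_data i (\<lambda>P p a' b' r' s' I. apdX P (I CXInd) bX \<^bold>=\<^bsub>dloopX P p bX\<^esub> b')"
| "const_type CXIndR i j =
     ind_data i (\<lambda>P p a' b' r' s' I.
       over_ab dataR P p a' b' (I CXInd) (I CXIndA) (I CXIndB) (apdR P (I CXInd))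
         \<^bold>=\<^bsub>dataR P p a' b'\<^esub> r')"
| "const_type CXIndS i j =
     ind_data i (\<lambda>P p a' b' r' s' I.
       over_ab dataS P p a' b' (I CXInd) (I CXIndA) (I CXIndB) (apdS P (I CXInd))
         \<^bold>=\<^bsub>dataS P p a' b'\<^esub> s')"

fun const_ok :: "const \<Rightarrow> bool" where
  "const_ok (CEl n k) = (k < n)"
| "const_ok c = True"


section \<open>Contexts and typing\<close>

text \<open>The head of a context is the type of \<open>Var 0\<close>.\<close>

inductive wf_ctx :: "tm list \<Rightarrow> bool"
  and typing :: "tm list \<Rightarrow> tm \<Rightarrow> tm \<Rightarrow> bool" ("(_ \<turnstile>/ _ \<Colon>/ _)" [51, 51, 51] 50)
where
  wf_Nil: "wf_ctx []"
| wf_Cons: "\<Gamma> \<turnstile> A \<Colon> U i \<Longrightarrow> wf_ctx (A # \<Gamma>)"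
| ty_Var: "wf_ctx \<Gamma> \<Longrightarrow> n < length \<Gamma> \<Longrightarrow> \<Gamma> \<turnstile> Var n \<Colon> (lift 0 ^^ Suc n) (\<Gamma> ! n)"
| ty_Const: "wf_ctx \<Gamma> \<Longrightarrow> const_ok c \<Longrightarrow> \<Gamma> \<turnstile> Const c \<Colon> close_stm (const_type c i j)"
| ty_U: "wf_ctx \<Gamma> \<Longrightarrow> \<Gamma> \<turnstile> U i \<Colon> U (Suc i)"
| ty_cumul: "\<Gamma> \<turnstile> A \<Colon> U i \<Longrightarrow> \<Gamma> \<turnstile> A \<Colon> U (Suc i)"
| ty_Pi: "\<Gamma> \<turnstile> A \<Colon> U i \<Longrightarrow> A # \<Gamma> \<turnstile> B \<Colon> U i \<Longrightarrow> \<Gamma> \<turnstile> Pi A B \<Colon> U i"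
| ty_Lam: "A # \<Gamma> \<turnstile> t \<Colon> B \<Longrightarrow> \<Gamma> \<turnstile> Lam t \<Colon> Pi A B"
| ty_App: "\<Gamma> \<turnstile> t \<Colon> Pi A B \<Longrightarrow> \<Gamma> \<turnstile> u \<Colon> A \<Longrightarrow> \<Gamma> \<turnstile> App t u \<Colon> subst 0 u B"
| ty_conv: "\<Gamma> \<turnstile> t \<Colon> A \<Longrightarrow> A \<equiv>\<^sub>d B \<Longrightarrow> \<Gamma> \<turnstile> B \<Colon> U i \<Longrightarrow> \<Gamma> \<turnstile> t \<Colon> B"


section \<open>The alternating group and classifying types\<close>

definition fin :: "nat \<Rightarrow> stm" where
  "fin n = cst (CFin n)"

definition el :: "nat \<Rightarrow> nat \<Rightarrow> stm" where
  "el n k = cst (CEl n k)"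

definition fin_rec :: "nat \<Rightarrow> stm \<Rightarrow> stm list \<Rightarrow> stm \<Rightarrow> stm" where
  "fin_rec n C cs x = foldl app (cst (CFinInd n) \<cdot> (\<^bold>\<lambda>z. C)) cs \<cdot> x"

text \<open>Truth values are \<open>el 2 0\<close> (false) and \<open>el 2 1\<close> (true).\<close>

definition xor2 :: stm where
  "xor2 = (\<^bold>\<lambda>x y. fin_rec 2 (fin 2) [y, fin_rec 2 (fin 2) [el 2 1, el 2 0] y] x)"

definition less5 :: stm where
  "less5 =
     (\<^bold>\<lambda>x y. fin_rec 5 (fin 2)
        (map (\<lambda>k. fin_rec 5 (fin 2) (map (\<lambda>l. if k < l then el 2 1 else el 2 0) [0..<5]) y) [0..<5]) x)"

text \<open>The parity of the number of inversions, i.e. of pairs \<open>k < l\<close> such that \<open>g l < g k\<close>.\<close>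

definition inversion_parity :: stm where
  "inversion_parity =
     (\<^bold>\<lambda>g. foldr (\<lambda>(k, l) t. xor2 \<cdot> (less5 \<cdot> (g \<cdot> el 5 l) \<cdot> (g \<cdot> el 5 k)) \<cdot> t)
        [(k, l). k \<leftarrow> [0..<5], l \<leftarrow> [Suc k..<5]] (el 2 0))"

definition Sym5 :: stm where
  "Sym5 = equiv (fin 5) (fin 5)"

definition is_even :: "stm \<Rightarrow> stm" where
  "is_even e = (inversion_parity \<cdot> equiv_fun (fin 5) (fin 5) e \<^bold>=\<^bsub>fin 2\<^esub> el 2 0)"

definition A5 :: stm where
  "A5 = (\<^bold>\<Sigma>e:Sym5. is_even e)"

definition perm :: "stm \<Rightarrow> stm" where
  "perm g = equiv_fun (fin 5) (fin 5) (pr1 Sym5 is_even g)"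

text \<open>
  A group isomorphism between the loops of \<open>B\<close> at \<open>pt\<close> and \<open>A5\<close>.  Multiplication in the subgroup
  \<open>A5\<close> of \<open>Sym5\<close> is composition of the underlying permutations, and elements of \<open>A5\<close> are equal when
  their underlying functions are, so multiplicativity is expressed by an identification of functions.
\<close>

definition loops_iso_A5 :: "stm \<Rightarrow> stm \<Rightarrow> stm" where
  "loops_iso_A5 B pt =
     (\<^bold>\<Sigma>h:(pt \<^bold>=\<^bsub>B\<^esub> pt) \<^bold>\<rightarrow> A5.
        is_equiv (pt \<^bold>=\<^bsub>B\<^esub> pt) A5 h \<^bold>\<times>
        (\<^bold>\<Pi>p:pt \<^bold>=\<^bsub>B\<^esub> pt. \<^bold>\<Pi>q:pt \<^bold>=\<^bsub>B\<^esub> pt.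
           perm (h \<cdot> conc B pt pt pt p q)
             \<^bold>=\<^bsub>fin 5 \<^bold>\<rightarrow> fin 5\<^esub> (\<^bold>\<lambda>x. perm (h \<cdot> p) \<cdot> (perm (h \<cdot> q) \<cdot> x))))"

definition is_0connected :: "stm \<Rightarrow> stm" where
  "is_0connected A = is_contr (trunc A)"

definition is_0connected_map :: "stm \<Rightarrow> stm \<Rightarrow> stm \<Rightarrow> stm" where
  "is_0connected_map A B f = (\<^bold>\<Pi>y:B. is_0connected (fib A B f y))"

definition is_classifying_A5 :: "stm \<Rightarrow> stm \<Rightarrow> stm" where
  "is_classifying_A5 B pt = is_0connected B \<^bold>\<times> is_1type B \<^bold>\<times> loops_iso_A5 B pt"

end

theory Submission
  imports Defs
begin

text \<open>
  Choose permutations \<open>a\<close> (a 5-cycle) and \<open>b\<close> (a 3-cycle) generating the alternating group with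
  \<open>a\<^sup>5 = b\<^sup>3 = (ab)\<^sup>2 = 1\<close>, and loops of the classifying type that correspond to them.  The relations hold
  for the loops, because a loop is determined by its permutation, so recursion on \<open>X\<close> gives a map \<open>f\<close>.
  As the classifying type is connected and being contractible is a proposition, it suffices to treat
  the fibre of \<open>f\<close> over the base point.  By induction on \<open>X\<close> into propositions, the set truncation of
  this fibre is contractible once all \<open>(pt, q)\<close>, for loops \<open>q\<close>, are identified in it; the action of
  \<open>f\<close> on the path constructors identifies \<open>(pt, a q)\<close> and \<open>(pt, b q)\<close> with \<open>(pt, q)\<close>, and \<open>a\<close> and \<open>b\<close>
  generate.

  The object-level proof is written as terms over a signature of named definitions and checked by a
  bidirectional type checker, which is proved sound for the typing relation and is executed by the
  simplifier.  Everything happens at universe level 0; typing is stable under a uniform shift of all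
  universe levels.
\<close>

section \<open>Metatheory\<close>

text \<open>The fundamental group of \<open>X\<close> is the binary icosahedral group; the common
  value of its three words is sent to the identity. Connectedness of the map amounts to the images
  of \<open>a\<close> and \<open>b\<close> generating. This is proved with a stabilizer chain
  instead of counting elements: the points 0, 1, 2 are made fixed one after the other, and evenness
  settles what remains. As the isomorphism \<open>h\<close> comes with multiplicativity only, the
  power computations keep a factor \<open>perm (h refl)\<close> on both sides of each relation, and
  the induction over loops starts at a loop whose permutation is the identity. Univalence enters at
  one place: it makes the type of propositions a set, so that families of propositions extend to the
  set truncation and connectedness becomes usable. That type lives one universe up, which is why
  names carry a shift. Explicit typing derivations for all these terms would be enormous, hence the
  reflection. Only acceptance has to be meaningful, so the checker runs on fuel and claims no
  completeness.\<close>

lemma lift_lift: "i < Suc k \<Longrightarrow> lift (Suc k) (lift i t) = lift i (lift k t)"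
  by (induct t arbitrary: i k) auto

lemma lift_subst: "j < Suc i \<Longrightarrow> lift i (subst j s t) = subst j (lift i s) (lift (Suc i) t)"
  by (induct t arbitrary: i j s) (simp_all add: diff_Suc lift_lift split: nat.split)

lemma lift_subst_lt: "i < Suc j \<Longrightarrow> lift i (subst j s t) = subst (Suc j) (lift i s) (lift i t)"
  by (induct t arbitrary: i j s) (auto simp: lift_lift)

lemma subst_lift [simp]: "subst k s (lift k t) = t"
  by (induct t arbitrary: k s) simp_all

lemma subst_subst:
  "i < Suc j \<Longrightarrow> subst i (subst j v u) (subst (Suc j) (lift i v) t) = subst j v (subst i u t)"
  by (induct t arbitrary: i j u v)
    (simp_all add: diff_Suc lift_lift [symmetric] lift_subst_lt split: nat.split)

section \<open>Closed terms and universe shifts\<close>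

primrec bounded :: "nat \<Rightarrow> tm \<Rightarrow> bool" where
  "bounded n (Var i) = (i < n)"
| "bounded n (Lam t) = bounded (Suc n) t"
| "bounded n (App t u) = (bounded n t \<and> bounded n u)"
| "bounded n (Pi A B) = (bounded n A \<and> bounded (Suc n) B)"
| "bounded n (U i) = True"
| "bounded n (Const c) = True"

lemma lift_bounded: "bounded n t \<Longrightarrow> n \<le> k \<Longrightarrow> lift k t = t"
  by (induct t arbitrary: n k) auto

lemma subst_bounded: "bounded n t \<Longrightarrow> n \<le> k \<Longrightarrow> subst k s t = t"
  by (induct t arbitrary: n k s) auto

text \<open>All universes move by the same amount. Constants stay put because they record no level;
  \<open>ty_Const\<close> offers their types at every level.\<close>

primrec shift :: "nat \<Rightarrow> tm \<Rightarrow> tm" where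
  "shift s (Var n) = Var n"
| "shift s (Lam t) = Lam (shift s t)"
| "shift s (App t u) = App (shift s t) (shift s u)"
| "shift s (Pi A B) = Pi (shift s A) (shift s B)"
| "shift s (U i) = U (i + s)"
| "shift s (Const c) = Const c"

lemma shift_lift: "shift s (lift k t) = lift k (shift s t)"
  by (induct t arbitrary: k) auto

lemma shift_lifts: "shift s ((lift k ^^ n) t) = (lift k ^^ n) (shift s t)"
  by (induct n) (simp_all add: shift_lift)

lemma shift_subst: "shift s (subst k u t) = subst k (shift s u) (shift s t)"
  by (induct t arbitrary: k u) (auto simp: shift_lift)

lemma shift_shift: "shift r (shift s t) = shift (s + r) t"
  by (induct t) auto

lemma shift_0 [simp]: "shift 0 t = t"
  by (induct t) auto

lemma bounded_shift [simp]: "bounded n (shift s t) = bounded n t"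
  by (induct t arbitrary: n) auto

lemma apps_simps [simp]: "apps t [] = t" "apps t (u # us) = apps (App t u) us"
  by (simp_all add: apps_def)

lemma apps_append: "apps t (us @ vs) = apps (apps t us) vs"
  by (simp add: apps_def)

lemma lift_apps: "lift k (apps t us) = apps (lift k t) (map (lift k) us)"
  by (induct us arbitrary: t) auto

lemma subst_apps: "subst k s (apps t us) = apps (subst k s t) (map (subst k s) us)"
  by (induct us arbitrary: t) auto

lemma shift_apps: "shift s (apps t us) = apps (shift s t) (map (shift s) us)"
  by (induct us arbitrary: t) auto

section \<open>Stability of definitional equality under lifting, substitution and universe
  shift\<close>

lemma conv_lift: "t \<equiv>\<^sub>d u \<Longrightarrow> lift k t \<equiv>\<^sub>d lift k u"
proof (induct arbitrary: k rule: conv.induct)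
  case (conv_beta t u)
  show ?case using conv.conv_beta [of "lift (Suc k) t" "lift k u"] by (simp add: lift_subst)
next
  case (conv_eta t)
  show ?case using conv.conv_eta [of "lift k t"] by (simp add: lift_lift)
next
  case (conv_FinInd cs n i C)
  then show ?case using conv.conv_FinInd [of "map (lift k) cs" n i "lift k C"] by (simp add: lift_apps)
next
  case (conv_SigInd A B C g a b)
  show ?case using conv.conv_SigInd [of "lift k A" "lift k B" "lift k C" "lift k g" "lift k a" "lift k b"] by simp
next
  case (conv_IdInd A C c a)
  show ?case using conv.conv_IdInd [of "lift k A" "lift k C" "lift k c" "lift k a"] by simp
next
  case (conv_TruncInd A P h g a)
  show ?case using conv.conv_TruncInd [of "lift k A" "lift k P" "lift k h" "lift k g" "lift k a"] by simp
next
  case (conv_XInd P p a b r s)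
  show ?case using conv.conv_XInd [of "lift k P" "lift k p" "lift k a" "lift k b" "lift k r" "lift k s"] by simp
qed (auto intro: conv_refl conv_sym conv_Lam conv_App conv_Pi, blast intro: conv_trans)

lemma conv_subst: "t \<equiv>\<^sub>d u \<Longrightarrow> subst k v t \<equiv>\<^sub>d subst k v u"
proof (induct arbitrary: k v rule: conv.induct)
  case (conv_beta t u)
  show ?case using conv.conv_beta [of "subst (Suc k) (lift 0 v) t" "subst k v u"]
    by (simp add: subst_subst)
next
  case (conv_eta t)
  show ?case using conv.conv_eta [of "subst k v t"] by (simp add: lift_subst_lt)
next
  case (conv_FinInd cs n i C)
  then show ?case using conv.conv_FinInd [of "map (subst k v) cs" n i "subst k v C"] by (simp add: subst_apps)
next
  case (conv_SigInd A B C g a b)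
  show ?case using conv.conv_SigInd [of "subst k v A" "subst k v B" "subst k v C" "subst k v g" "subst k v a" "subst k v b"] by simp
next
  case (conv_IdInd A C c a)
  show ?case using conv.conv_IdInd [of "subst k v A" "subst k v C" "subst k v c" "subst k v a"] by simp
next
  case (conv_TruncInd A P h g a)
  show ?case using conv.conv_TruncInd [of "subst k v A" "subst k v P" "subst k v h" "subst k v g" "subst k v a"] by simp
next
  case (conv_XInd P p a b r s)
  show ?case using conv.conv_XInd [of "subst k v P" "subst k v p" "subst k v a" "subst k v b" "subst k v r" "subst k v s"] by simp
qed (auto intro: conv_refl conv_sym conv_Lam conv_App conv_Pi, blast intro: conv_trans)

lemma conv_shift: "t \<equiv>\<^sub>d u \<Longrightarrow> shift s t \<equiv>\<^sub>d shift s u"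
proof (induct rule: conv.induct)
  case (conv_beta t u)
  show ?case using conv.conv_beta [of "shift s t" "shift s u"] by (simp add: shift_subst)
next
  case (conv_eta t)
  show ?case using conv.conv_eta [of "shift s t"] by (simp add: shift_lift)
next
  case (conv_FinInd cs n i C)
  then show ?case using conv.conv_FinInd [of "map (shift s) cs" n i "shift s C"] by (simp add: shift_apps)
next
  case (conv_SigInd A B C g a b)
  show ?case using conv.conv_SigInd [of "shift s A" "shift s B" "shift s C" "shift s g" "shift s a" "shift s b"] by simp
next
  case (conv_IdInd A C c a)
  show ?case using conv.conv_IdInd [of "shift s A" "shift s C" "shift s c" "shift s a"] by simp
next
  case (conv_TruncInd A P h g a)
  show ?case using conv.conv_TruncInd [of "shift s A" "shift s P" "shift s h" "shift s g" "shift s a"] by simp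
next
  case (conv_XInd P p a b r s')
  show ?case using conv.conv_XInd [of "shift s P" "shift s p" "shift s a" "shift s b" "shift s r" "shift s s'"] by simp
qed (auto intro: conv_refl conv_sym conv_Lam conv_App conv_Pi, blast intro: conv_trans)

text \<open>The quantifier over \<open>s\<close> builds in closure under shifts;
  \<open>bounded 0\<close> ensures that weakening and substitution leave the type of a constant
  unchanged.\<close>

definition const_typed :: "const \<Rightarrow> tm \<Rightarrow> bool" where
  "const_typed c T \<longleftrightarrow> bounded 0 T \<and> (\<forall>\<Gamma> s. wf_ctx \<Gamma> \<longrightarrow> \<Gamma> \<turnstile> Const c \<Colon> shift s T)"

lemma const_typed_shift: "const_typed c T \<Longrightarrow> const_typed c (shift s T)"
  by (auto simp: const_typed_def shift_shift)

definition const_checked :: "const \<Rightarrow> bool" where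
  "const_checked c \<longleftrightarrow> const_typed c (close_stm (const_type c 0 0))"

text \<open>By typical ambiguity, shifting the instance at levels 0, 0 by \<open>s\<close> gives the
  instance at \<open>s\<close>, \<open>s\<close>, which \<open>ty_Const\<close> provides
  directly.\<close>

lemma const_checkedI:
  assumes "const_ok c" "bounded 0 (close_stm (const_type c 0 0))"
    and "\<And>s. shift s (close_stm (const_type c 0 0)) = close_stm (const_type c s s)"
  shows "const_checked c"
  unfolding const_checked_def const_typed_def using assms ty_Const by auto

text \<open>The finite types and \<open>X\<close> are assigned \<open>universe 0\<close> at all
  levels, so the shifted type \<open>U s\<close> is not an instance of \<open>ty_Const\<close>;
  cumulativity supplies it.\<close>

lemma const_checkedI_U:
  assumes "const_ok c" and c: "close_stm (const_type c 0 0) = U 0"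
  shows "const_checked c"
  unfolding const_checked_def const_typed_def
proof (intro conjI allI impI)
  fix \<Gamma> s assume "wf_ctx \<Gamma>"
  then have "\<Gamma> \<turnstile> Const c \<Colon> U 0" using ty_Const [of \<Gamma> c 0 0] assms by simp
  then have "\<Gamma> \<turnstile> Const c \<Colon> U s" by (induct s) (auto intro: ty_cumul)
  then show "\<Gamma> \<turnstile> Const c \<Colon> shift s (close_stm (const_type c 0 0))" using c by simp
qed (simp add: c)

text \<open>
  A variant of typing without well-formedness premises, but with the domain as a premise of the rule
  for abstractions, so that weakening and substitution go through by plain induction.  A constant is
  admitted at a type only if it has all universe shifts of that type.
\<close>

inductive hastype :: "tm list \<Rightarrow> tm \<Rightarrow> tm \<Rightarrow> bool" where
  ht_Var: "n < length \<Gamma> \<Longrightarrow> hastype \<Gamma> (Var n) ((lift 0 ^^ Suc n) (\<Gamma> ! n))"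
| ht_Const: "const_typed c T \<Longrightarrow> hastype \<Gamma> (Const c) T"
| ht_U: "hastype \<Gamma> (U i) (U (Suc i))"
| ht_cumul: "hastype \<Gamma> A (U i) \<Longrightarrow> hastype \<Gamma> A (U (Suc i))"
| ht_Pi: "hastype \<Gamma> A (U i) \<Longrightarrow> hastype (A # \<Gamma>) B (U i) \<Longrightarrow> hastype \<Gamma> (Pi A B) (U i)"
| ht_Lam: "hastype \<Gamma> A (U i) \<Longrightarrow> hastype (A # \<Gamma>) t B \<Longrightarrow> hastype \<Gamma> (Lam t) (Pi A B)"
| ht_App: "hastype \<Gamma> t (Pi A B) \<Longrightarrow> hastype \<Gamma> u A \<Longrightarrow> hastype \<Gamma> (App t u) (subst 0 u B)"
| ht_conv: "hastype \<Gamma> t A \<Longrightarrow> A \<equiv>\<^sub>d B \<Longrightarrow> hastype \<Gamma> B (U i) \<Longrightarrow> hastype \<Gamma> t B"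

text \<open>Under a binder, the typing of the domain in \<open>ht_Pi\<close> and
  \<open>ht_Lam\<close> re-establishes \<open>wf_ctx\<close> for the extended context.\<close>

lemma hastype_typing: "hastype \<Gamma> t A \<Longrightarrow> wf_ctx \<Gamma> \<Longrightarrow> \<Gamma> \<turnstile> t \<Colon> A"
proof (induct rule: hastype.induct)
  case (ht_Const c T \<Gamma>)
  then have "\<Gamma> \<turnstile> Const c \<Colon> shift 0 T" unfolding const_typed_def by blast
  then show ?case by simp
next
  case (ht_Var n \<Gamma>)
  then show ?case by (intro ty_Var)
qed (auto intro: wf_ctx_typing.intros)

lemma hastype_bounded: "hastype \<Gamma> t A \<Longrightarrow> bounded (length \<Gamma>) t"
  by (induct rule: hastype.induct) auto

lemma hastype_shift: "hastype \<Gamma> t A \<Longrightarrow> hastype (map (shift s) \<Gamma>) (shift s t) (shift s A)"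
proof (induct rule: hastype.induct)
  case (ht_Var n \<Gamma>)
  then show ?case using hastype.ht_Var [of n "map (shift s) \<Gamma>"] by (simp add: shift_lift shift_lifts)
next
  case (ht_conv \<Gamma> t A B i)
  then show ?case using hastype.ht_conv conv_shift by fastforce
qed (auto simp: shift_subst intro: hastype.intros const_typed_shift)

section \<open>Weakening and substitution in the middle of a context\<close>

primrec lifts :: "tm list \<Rightarrow> tm list" where
  "lifts [] = []"
| "lifts (A # \<Delta>) = lift (length \<Delta>) A # lifts \<Delta>"

text \<open>A context \<open>\<Delta>\<close> on top of the affected variable: the entry above
  \<open>\<Delta>\<close> sees that variable at index \<open>length \<Delta>\<close>, and the
  substituted term must first be weakened past \<open>\<Delta>\<close>.\<close>

primrec substs :: "tm \<Rightarrow> tm list \<Rightarrow> tm list" where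
  "substs s [] = []"
| "substs s (A # \<Delta>) = subst (length \<Delta>) ((lift 0 ^^ length \<Delta>) s) A # substs s \<Delta>"

lemma length_lifts [simp]: "length (lifts \<Delta>) = length \<Delta>"
  by (induct \<Delta>) auto

lemma length_substs [simp]: "length (substs s \<Delta>) = length \<Delta>"
  by (induct \<Delta>) auto

lemma nth_lifts:
  "n < length \<Delta> \<Longrightarrow>
   (lift 0 ^^ Suc n) (lifts \<Delta> ! n) = lift (length \<Delta>) ((lift 0 ^^ Suc n) (\<Delta> ! n))"
proof (induct \<Delta> arbitrary: n)
  case (Cons A \<Delta>)
  show ?case
  proof (cases n)
    case 0 then show ?thesis by (simp add: lift_lift)
  next
    case (Suc m)
    then show ?thesis using Cons by (simp add: lift_lift)
  qed
qed simp

lemma nth_substs: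
  "n < length \<Delta> \<Longrightarrow>
   (lift 0 ^^ Suc n) (substs s \<Delta> ! n) =
   subst (length \<Delta>) ((lift 0 ^^ length \<Delta>) s) ((lift 0 ^^ Suc n) (\<Delta> ! n))"
proof (induct \<Delta> arbitrary: n)
  case (Cons A \<Delta>)
  show ?case
  proof (cases n)
    case 0 then show ?thesis by (simp add: lift_subst_lt)
  next
    case (Suc m)
    then show ?thesis using Cons by (simp add: lift_subst_lt)
  qed
qed simp

text \<open>A term lifted \<open>n\<close> times does not mention the first \<open>n\<close>
  variables, so it is irrelevant where among them the next one is inserted.\<close>

lemma funpow_lift_middle: "k \<le> n \<Longrightarrow> lift k ((lift 0 ^^ n) t) = (lift 0 ^^ Suc n) t"
proof (induct n arbitrary: k)
  case (Suc n)
  show ?case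
  proof (cases k)
    case (Suc m)
    then have "lift m ((lift 0 ^^ n) t) = (lift 0 ^^ Suc n) t" using Suc.hyps [of m] Suc.prems by simp
    then show ?thesis using Suc by (simp add: lift_lift)
  qed simp
qed simp

text \<open>Insertion below an arbitrary \<open>\<Delta>\<close> is the form that survives the
  induction: each binder adds its domain to \<open>\<Delta>\<close>.\<close>

lemma hastype_lift:
  "hastype \<Gamma>' t A \<Longrightarrow> \<Gamma>' = \<Delta> @ \<Gamma> \<Longrightarrow>
   hastype (lifts \<Delta> @ C # \<Gamma>) (lift (length \<Delta>) t) (lift (length \<Delta>) A)"
proof (induct arbitrary: \<Delta> rule: hastype.induct)
  case (ht_Var n \<Gamma>')
  show ?case
  proof (cases "n < length \<Delta>")
    case True
    then show ?thesis
      using hastype.ht_Var [of n "lifts \<Delta> @ C # \<Gamma>"] ht_Var nth_lifts [OF True]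
      by (simp add: nth_append)
  next
    case False
    then have "hastype (lifts \<Delta> @ C # \<Gamma>) (Var (Suc n)) ((lift 0 ^^ Suc (Suc n)) (\<Gamma> ! (n - length \<Delta>)))"
      using hastype.ht_Var [of "Suc n" "lifts \<Delta> @ C # \<Gamma>"] ht_Var by (simp add: nth_append Suc_diff_le)
    then show ?thesis
      using False ht_Var funpow_lift_middle [of "length \<Delta>" "Suc n"] by (simp add: nth_append)
  qed
next
  case (ht_Const c T \<Gamma>')
  then show ?case by (auto simp: const_typed_def lift_bounded intro!: hastype.ht_Const)
next
  case (ht_Pi \<Gamma>' A i B)
  then show ?case using ht_Pi(4) [of "A # \<Delta>"] by (auto intro: hastype.ht_Pi)
next
  case (ht_Lam \<Gamma>' A i t B)
  then show ?case using ht_Lam(4) [of "A # \<Delta>"] by (auto intro: hastype.ht_Lam)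
next
  case (ht_App \<Gamma>' t A B u)
  then show ?case by (auto simp: lift_subst intro: hastype.ht_App)
next
  case (ht_conv \<Gamma>' t A B i)
  then show ?case using hastype.ht_conv conv_lift by fastforce
qed (auto intro: hastype.intros)

lemma hastype_weaken: "hastype \<Gamma> t A \<Longrightarrow> hastype (C # \<Gamma>) (lift 0 t) (lift 0 A)"
  using hastype_lift [of \<Gamma> t A "[]"] by simp

lemma hastype_weakens: "hastype \<Gamma> t A \<Longrightarrow> hastype (\<Delta> @ \<Gamma>) ((lift 0 ^^ length \<Delta>) t) ((lift 0 ^^ length \<Delta>) A)"
  by (induct \<Delta>) (simp_all add: hastype_weaken)

lemma lifts_bounded: "bounded 0 t \<Longrightarrow> (lift 0 ^^ n) t = t"
  by (induct n) (simp_all add: lift_bounded)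

text \<open>The second premise yields, through \<open>hastype_bounded\<close>, that \<open>A\<close>
  is closed, so that weakening fixes both the term and its type.\<close>

lemma hastype_closed:
  assumes "hastype [] t A" and "hastype [] A B" shows "hastype \<Gamma> t A"
  using hastype_weakens [OF assms(1), of \<Gamma>] hastype_bounded [OF assms(1)] hastype_bounded [OF assms(2)]
  by (simp add: lifts_bounded)

lemma hastype_subst:
  assumes s: "hastype \<Gamma> s C"
  shows "hastype \<Gamma>' t A \<Longrightarrow> \<Gamma>' = \<Delta> @ C # \<Gamma> \<Longrightarrow>
   hastype (substs s \<Delta> @ \<Gamma>) (subst (length \<Delta>) ((lift 0 ^^ length \<Delta>) s) t)
     (subst (length \<Delta>) ((lift 0 ^^ length \<Delta>) s) A)"
proof (induct arbitrary: \<Delta> rule: hastype.induct)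
  case (ht_Var n \<Gamma>')
  consider "n < length \<Delta>" | "n = length \<Delta>" | "length \<Delta> < n" by linarith
  then show ?case
  proof cases
    case 1
    then show ?thesis
      using hastype.ht_Var [of n "substs s \<Delta> @ \<Gamma>"] ht_Var nth_substs [OF 1]
      by (simp add: nth_append)
  next
    case 2
    \<comment> \<open>This is the replaced variable itself: its type was lifted past itself once
      more than needed for \<open>\<Delta>\<close>, and substitution undoes exactly that
      lift.\<close>
    have "subst (length \<Delta>) v ((lift 0 ^^ Suc (length \<Delta>)) C) = (lift 0 ^^ length \<Delta>) C" for v
      using subst_lift [of "length \<Delta>" v "(lift 0 ^^ length \<Delta>) C"]
        funpow_lift_middle [of "length \<Delta>" "length \<Delta>" C] by simp
    then show ?thesis
      using 2 ht_Var hastype_weakens [OF s, of "substs s \<Delta>"] by (simp add: nth_append)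
  next
    case 3
    then obtain m where m: "n = Suc m" "length \<Delta> \<le> m" by (cases n) auto
    have "subst (length \<Delta>) v ((lift 0 ^^ Suc (Suc m)) T) = (lift 0 ^^ Suc m) T" for v T
      using subst_lift [of "length \<Delta>" v "(lift 0 ^^ Suc m) T"]
        funpow_lift_middle [of "length \<Delta>" "Suc m" T] m by (simp del: subst_lift)
    then show ?thesis
      using 3 m ht_Var hastype.ht_Var [of m "substs s \<Delta> @ \<Gamma>"] by (simp add: nth_append Suc_diff_le)
  qed
next
  case (ht_Const c T \<Gamma>')
  then show ?case by (auto simp: const_typed_def subst_bounded intro!: hastype.ht_Const)
next
  case (ht_Pi \<Gamma>' A i B)
  then show ?case using ht_Pi(4) [of "A # \<Delta>"] by (auto intro: hastype.ht_Pi)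
next
  case (ht_Lam \<Gamma>' A i t B)
  then show ?case using ht_Lam(4) [of "A # \<Delta>"] by (auto intro: hastype.ht_Lam)
next
  case (ht_App \<Gamma>' t A B u)
  then show ?case
    using hastype.ht_App [of _ _ "subst (length \<Delta>) ((lift 0 ^^ length \<Delta>) s) A"]
      subst_subst [of 0 "length \<Delta>" "(lift 0 ^^ length \<Delta>) s" u B] by fastforce
next
  case (ht_conv \<Gamma>' t A B i)
  then show ?case using hastype.ht_conv conv_subst by fastforce
qed (auto intro: hastype.intros)

lemma hastype_subst0: "hastype (C # \<Gamma>) t A \<Longrightarrow> hastype \<Gamma> s C \<Longrightarrow> hastype \<Gamma> (subst 0 s t) (subst 0 s A)"
  using hastype_subst [of \<Gamma> s C "C # \<Gamma>" t A "[]"] by simp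

section \<open>Types, and inversion for function types\<close>

definition is_type :: "tm list \<Rightarrow> tm \<Rightarrow> bool" where
  "is_type \<Gamma> A \<longleftrightarrow> (\<exists>i. hastype \<Gamma> A (U i))"

text \<open>The induction keeps the subject fixed in \<open>ht_cumul\<close> and
  \<open>ht_conv\<close>, where only its type changes. Inverting at the type would instead call for
  injectivity of \<open>Pi\<close> up to conversion.\<close>

lemma hastype_PiD: "hastype \<Gamma> T S \<Longrightarrow> T = Pi A B \<Longrightarrow> is_type \<Gamma> A \<and> is_type (A # \<Gamma>) B"
  by (induct rule: hastype.induct) (auto simp: is_type_def)

lemma is_type_PiD: "is_type \<Gamma> (Pi A B) \<Longrightarrow> is_type \<Gamma> A \<and> is_type (A # \<Gamma>) B"
  using hastype_PiD unfolding is_type_def by blast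

lemma hastype_cumul: "hastype \<Gamma> A (U i) \<Longrightarrow> i \<le> j \<Longrightarrow> hastype \<Gamma> A (U j)"
proof (induct j)
  case (Suc j)
  then show ?case by (cases "i = Suc j") (auto intro: ht_cumul)
qed simp

section \<open>Terms with global definitions and their algorithmic typing\<close>

text \<open>\<open>Glob d s\<close> is the definition named \<open>d\<close> with all its universe levels raised by \<open>s\<close>.\<close>

datatype 'n gtm =
    GVar nat
  | GLam "'n gtm"
  | GApp "'n gtm" "'n gtm"
  | GPi "'n gtm" "'n gtm"
  | GUniv nat
  | GConst const
  | Glob 'n nat

text \<open>An \<open>n\<close>-fold lift of a variable in one pass, by recursion on unary numbers,
  so that the simplifier computes it without deciding inequalities.\<close>

fun raise :: "nat \<Rightarrow> nat \<Rightarrow> nat \<Rightarrow> nat" where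
  "raise 0 n m = n + m"
| "raise (Suc k) n 0 = 0"
| "raise (Suc k) n (Suc m) = Suc (raise k n m)"

primrec glift :: "nat \<Rightarrow> nat \<Rightarrow> 'n gtm \<Rightarrow> 'n gtm" where
  "glift k n (GVar m) = GVar (raise k n m)"
| "glift k n (GLam t) = GLam (glift (Suc k) n t)"
| "glift k n (GApp t u) = GApp (glift k n t) (glift k n u)"
| "glift k n (GPi t u) = GPi (glift k n t) (glift (Suc k) n u)"
| "glift k n (GUniv i) = GUniv i"
| "glift k n (GConst c) = GConst c"
| "glift k n (Glob d s) = Glob d s"

text \<open>\<open>None\<close> marks the variable that is to be replaced; any other result is the
  index it gets afterwards.\<close>

fun strike :: "nat \<Rightarrow> nat \<Rightarrow> nat option" where
  "strike 0 0 = None"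
| "strike 0 (Suc m) = Some m"
| "strike (Suc k) 0 = Some 0"
| "strike (Suc k) (Suc m) = (case strike k m of None \<Rightarrow> None | Some i \<Rightarrow> Some (Suc i))"

fun lift_by :: "nat \<Rightarrow> 'n gtm \<Rightarrow> 'n gtm" where
  "lift_by 0 t = t"
| "lift_by (Suc n) t = glift 0 (Suc n) t"

primrec gsubst :: "nat \<Rightarrow> 'n gtm \<Rightarrow> 'n gtm \<Rightarrow> 'n gtm" where
  "gsubst k s (GVar m) = (case strike k m of None \<Rightarrow> lift_by k s | Some i \<Rightarrow> GVar i)"
| "gsubst k s (GLam t) = GLam (gsubst (Suc k) s t)"
| "gsubst k s (GApp t u) = GApp (gsubst k s t) (gsubst k s u)"
| "gsubst k s (GPi t u) = GPi (gsubst k s t) (gsubst (Suc k) s u)"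
| "gsubst k s (GUniv i) = GUniv i"
| "gsubst k s (GConst c) = GConst c"
| "gsubst k s (Glob d r) = Glob d r"

primrec gshift :: "nat \<Rightarrow> 'n gtm \<Rightarrow> 'n gtm" where
  "gshift s (GVar m) = GVar m"
| "gshift s (GLam t) = GLam (gshift s t)"
| "gshift s (GApp t u) = GApp (gshift s t) (gshift s u)"
| "gshift s (GPi t u) = GPi (gshift s t) (gshift s u)"
| "gshift s (GUniv i) = GUniv (s + i)"
| "gshift s (GConst c) = GConst c"
| "gshift s (Glob d r) = Glob d (s + r)"

fun shift_by :: "nat \<Rightarrow> 'n gtm \<Rightarrow> 'n gtm" where
  "shift_by 0 t = t"
| "shift_by (Suc s) t = gshift (Suc s) t"

fun lookup :: "'a list \<Rightarrow> nat \<Rightarrow> 'a option" where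
  "lookup [] n = None"
| "lookup (x # xs) 0 = Some x"
| "lookup (x # xs) (Suc n) = lookup xs n"

fun unwind :: "'n gtm \<Rightarrow> 'n gtm list \<Rightarrow> 'n gtm" where
  "unwind t [] = t"
| "unwind t (u # us) = unwind (GApp t u) us"

text \<open>\<open>infer\<close> fails on an abstraction in head position, so a function type
  produced by reduction has to be freed of beta redexes before it can be checked again. Names are
  left folded.\<close>

fun beta :: "nat \<Rightarrow> 'n gtm \<Rightarrow> 'n gtm" where
  "beta 0 t = t"
| "beta (Suc f) (GLam t) = GLam (beta f t)"
| "beta (Suc f) (GPi t u) = GPi (beta f t) (beta f u)"
| "beta (Suc f) (GApp t u) = (case beta f t of GLam b \<Rightarrow> beta f (gsubst 0 u b) | t' \<Rightarrow> GApp t' (beta f u))"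
| "beta (Suc f) (GVar n) = GVar n"
| "beta (Suc f) (GUniv i) = GUniv i"
| "beta (Suc f) (GConst c) = GConst c"
| "beta (Suc f) (Glob d s) = Glob d s"

text \<open>For an eliminator of an \<open>n\<close>-element type: the \<open>n\<close> branches,
  the scrutinee, and the arguments that follow it.\<close>

fun split_at :: "nat \<Rightarrow> 'a list \<Rightarrow> ('a list \<times> 'a \<times> 'a list) option" where
  "split_at n [] = None"
| "split_at 0 (x # xs) = Some ([], x, xs)"
| "split_at (Suc n) (x # xs) = (case split_at n xs of None \<Rightarrow> None | Some (ys, y, zs) \<Rightarrow> Some (x # ys, y, zs))"

locale signature =
  fixes ty :: "'n \<Rightarrow> 'n gtm" and body :: "'n \<Rightarrow> 'n gtm" and transparent :: "'n \<Rightarrow> bool"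
begin

text \<open>
  The computation rules repeat some of their variables.  As conversion is untyped, they may be applied
  only after the repeated parameters have been compared, by \<open>C\<close>; \<open>W\<close> computes weak head normal forms.
\<close>

fun iota_sig where
  "iota_sig W C (B # D # E # g # z # vs) =
     (case W z [] of GApp (GApp (GApp (GApp (GConst c) B') D') a) b \<Rightarrow>
        if c = CPair then if C B' B then if C D' D then Some (g, a # b # vs)
        else None else None else None | _ \<Rightarrow> None)"
| "iota_sig W C _ = None"

fun iota_id where
  "iota_id W C (B # D # c # x # y # p # vs) =
     (case W p [] of GApp (GApp (GConst d) B') a \<Rightarrow>
        if d = CRefl then if C B' B then if C a x then if C a y
        then Some (c, a # vs) else None else None else None else None | _ \<Rightarrow> None)"
| "iota_id W C _ = None"

fun iota_trunc where
  "iota_trunc W C (B # D # h # g # z # vs) =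
     (case W z [] of GApp (GApp (GConst c) B') a \<Rightarrow>
        if c = CTr then if C B' B then Some (g, a # vs) else None else None | _ \<Rightarrow> None)"
| "iota_trunc W C _ = None"

fun iota_X where
  "iota_X W (D # p # a # b # r # s # x # vs) =
     (case W x [] of GConst c \<Rightarrow> if c = CPt then Some (p, vs) else None | _ \<Rightarrow> None)"
| "iota_X W _ = None"

fun iota_fin where
  "iota_fin W n [] = None"
| "iota_fin W n (D # vs) =
     (case split_at n vs of None \<Rightarrow> None | Some (cs, x, ws) \<Rightarrow>
       (case W x [] of GConst c \<Rightarrow> (case c of CEl m k \<Rightarrow>
          if m = n then (case lookup cs k of None \<Rightarrow> None | Some t \<Rightarrow> Some (t, ws)) else None
          | _ \<Rightarrow> None) | _ \<Rightarrow> None))"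

fun iota where
  "iota W C c us =
    (if c = CIdInd then iota_id W C us else if c = CSigInd then iota_sig W C us
     else if c = CTruncInd then iota_trunc W C us else if c = CXInd then iota_X W us
     else (case c of CFinInd n \<Rightarrow> iota_fin W n us | _ \<Rightarrow> None))"

text \<open>
  Terms are compared without unfolding first; \<open>eta_check\<close> then compares weak head normal forms.
\<close>

fun whnf :: "nat \<Rightarrow> 'n gtm \<Rightarrow> 'n gtm list \<Rightarrow> 'n gtm"
  and conv_check :: "nat \<Rightarrow> 'n gtm \<Rightarrow> 'n gtm \<Rightarrow> bool"
  and struct_check :: "nat \<Rightarrow> 'n gtm \<Rightarrow> 'n gtm \<Rightarrow> bool"
  and eta_check :: "nat \<Rightarrow> 'n gtm \<Rightarrow> 'n gtm \<Rightarrow> bool"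
where
  "whnf 0 t us = unwind t us"
| "whnf (Suc f) t us = (case t of
     GApp t u \<Rightarrow> whnf f t (u # us)
   | GLam b \<Rightarrow> (case us of [] \<Rightarrow> t | u # vs \<Rightarrow> whnf f (gsubst 0 u b) vs)
   | Glob d s \<Rightarrow> if transparent d then whnf f (shift_by s (body d)) us else unwind t us
   | GConst c \<Rightarrow> (case iota (whnf f) (conv_check f) c us of None \<Rightarrow> unwind t us | Some (t, vs) \<Rightarrow> whnf f t vs)
   | _ \<Rightarrow> unwind t us)"
| "conv_check 0 t u = False"
| "conv_check (Suc f) t u =
    (if struct_check f t u then True else eta_check f (whnf f t []) (whnf f u []))"
| "eta_check 0 t u = False"
| "eta_check (Suc f) t u = (case t of
     GLam t' \<Rightarrow> (case u of GLam u' \<Rightarrow> conv_check f t' u' | _ \<Rightarrow> conv_check f t' (GApp (glift 0 1 u) (GVar 0)))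
   | _ \<Rightarrow> (case u of GLam u' \<Rightarrow> conv_check f (GApp (glift 0 1 t) (GVar 0)) u' | _ \<Rightarrow> struct_check f t u))"
| "struct_check 0 t u = False"
\<comment> \<open>A primitive constant may occur bare, in quoted raw terms, or as a name whose body
  it is; a transparent name is therefore unfolded here when it meets a constant or an abstraction.
  Every other unfolding is left to \<open>whnf\<close>.\<close>
| "struct_check (Suc f) t u = (case t of
     GVar m \<Rightarrow> (case u of GVar n \<Rightarrow> m = n | _ \<Rightarrow> False)
   | GUniv i \<Rightarrow> (case u of GUniv j \<Rightarrow> i = j | _ \<Rightarrow> False)
   | GConst c \<Rightarrow> (case u of GConst d \<Rightarrow> c = d | Glob d s \<Rightarrow> if transparent d then struct_check f t (shift_by s (body d)) else False | _ \<Rightarrow> False)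
   | GLam t' \<Rightarrow> (case u of GLam u' \<Rightarrow> conv_check f t' u' | Glob d s \<Rightarrow> if transparent d then struct_check f t (shift_by s (body d)) else False | _ \<Rightarrow> False)
   | GApp t1 t2 \<Rightarrow> (case u of GApp u1 u2 \<Rightarrow> if struct_check f t1 u1 then conv_check f t2 u2 else False | _ \<Rightarrow> False)
   | GPi t1 t2 \<Rightarrow> (case u of GPi u1 u2 \<Rightarrow> if conv_check f t1 u1 then conv_check f t2 u2 else False | _ \<Rightarrow> False)
   | Glob d s \<Rightarrow> (case u of Glob d' s' \<Rightarrow> if d = d' then s = s' else False
       | GConst c \<Rightarrow> if transparent d then struct_check f (shift_by s (body d)) u else False
       | GLam u' \<Rightarrow> if transparent d then struct_check f (shift_by s (body d)) u else False
       | _ \<Rightarrow> False))"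

fun universe_of :: "nat \<Rightarrow> 'n gtm \<Rightarrow> nat option" where
  "universe_of f T = (case T of GUniv i \<Rightarrow> Some i | _ \<Rightarrow> (case whnf f T [] of GUniv i \<Rightarrow> Some i | _ \<Rightarrow> None))"

fun subtype_check :: "nat \<Rightarrow> 'n gtm \<Rightarrow> 'n gtm \<Rightarrow> bool" where
  "subtype_check f T T' = (case T of
     GUniv i \<Rightarrow> (case whnf f T' [] of GUniv j \<Rightarrow> i \<le> j | _ \<Rightarrow> False)
   | _ \<Rightarrow> conv_check f T T')"

text \<open>
  No subject reduction is available for the untyped conversion, so a function type that appears only
  after reduction is checked again.
\<close>

fun infer :: "nat \<Rightarrow> 'n gtm list \<Rightarrow> 'n gtm \<Rightarrow> 'n gtm option"
  and check :: "nat \<Rightarrow> 'n gtm list \<Rightarrow> 'n gtm \<Rightarrow> 'n gtm \<Rightarrow> bool"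
  and expose :: "nat \<Rightarrow> 'n gtm list \<Rightarrow> 'n gtm \<Rightarrow> ('n gtm \<times> 'n gtm) option"
where
  "infer 0 \<Gamma> t = None"
| "infer (Suc f) \<Gamma> (GVar n) = (case lookup \<Gamma> n of None \<Rightarrow> None | Some T \<Rightarrow> Some (glift 0 (Suc n) T))"
| "infer (Suc f) \<Gamma> (GApp t u) = (case infer f \<Gamma> t of None \<Rightarrow> None | Some T \<Rightarrow>
     (case expose f \<Gamma> T of None \<Rightarrow> None | Some (B, C) \<Rightarrow>
       if check f \<Gamma> u B then Some (gsubst 0 u C) else None))"
| "infer (Suc f) \<Gamma> (GPi t u) = (case infer f \<Gamma> t of None \<Rightarrow> None | Some T \<Rightarrow>
     (case universe_of f T of None \<Rightarrow> None | Some i \<Rightarrow>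
       (case infer f (t # \<Gamma>) u of None \<Rightarrow> None | Some T' \<Rightarrow>
         (case universe_of f T' of None \<Rightarrow> None | Some j \<Rightarrow> Some (GUniv (if i \<le> j then j else i))))))"
| "infer (Suc f) \<Gamma> (GUniv i) = Some (GUniv (Suc i))"
\<comment> \<open>The recorded type is believed without looking at the body; that the body has this
  type is part of the relation \<open>erases\<close>, on which soundness rests.\<close>
| "infer (Suc f) \<Gamma> (Glob d s) = Some (shift_by s (ty d))"
| "infer (Suc f) \<Gamma> (GLam t) = None"
| "infer (Suc f) \<Gamma> (GConst c) = None"
| "check 0 \<Gamma> t T = False"
| "check (Suc f) \<Gamma> t T = (case t of
     GLam b \<Rightarrow> (case expose f \<Gamma> T of None \<Rightarrow> False | Some (B, C) \<Rightarrow> check f (B # \<Gamma>) b C)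
   | _ \<Rightarrow> (case infer f \<Gamma> t of None \<Rightarrow> False | Some T' \<Rightarrow> subtype_check f T' T))"
| "expose 0 \<Gamma> T = None"
| "expose (Suc f) \<Gamma> T = (case T of
     GPi B C \<Rightarrow> Some (B, C)
   | _ \<Rightarrow> (case beta f (whnf f T []) of GPi B C \<Rightarrow>
       (case infer f \<Gamma> (GPi B C) of Some (GUniv i) \<Rightarrow> Some (B, C) | _ \<Rightarrow> None) | _ \<Rightarrow> None))"

definition is_type_check :: "nat \<Rightarrow> 'n gtm \<Rightarrow> bool" where
  "is_type_check f T = (case infer f [] T of Some (GUniv i) \<Rightarrow> True | _ \<Rightarrow> False)"

text \<open>\<open>t \<leadsto> u\<close> also asserts that all names in \<open>t\<close> denote well-typed closed terms.\<close>

inductive erases :: "'n gtm \<Rightarrow> tm \<Rightarrow> bool" (infix "\<leadsto>" 50) where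
  er_V: "GVar n \<leadsto> Var n"
| er_L: "t \<leadsto> u \<Longrightarrow> GLam t \<leadsto> Lam u"
| er_A: "t \<leadsto> u \<Longrightarrow> t' \<leadsto> u' \<Longrightarrow> GApp t t' \<leadsto> App u u'"
| er_P: "t \<leadsto> u \<Longrightarrow> t' \<leadsto> u' \<Longrightarrow> GPi t t' \<leadsto> Pi u u'"
| er_U: "GUniv i \<leadsto> U i"
| er_K: "GConst c \<leadsto> Const c"
| er_G: "body d \<leadsto> u \<Longrightarrow> ty d \<leadsto> T \<Longrightarrow> hastype [] u T \<Longrightarrow> is_type [] T \<Longrightarrow> Glob d s \<leadsto> shift s u"

inductive_cases er_VE: "GVar n \<leadsto> u"
inductive_cases er_LE: "GLam t \<leadsto> u"
inductive_cases er_AE: "GApp t t' \<leadsto> u"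
inductive_cases er_PE: "GPi t t' \<leadsto> u"
inductive_cases er_UE: "GUniv i \<leadsto> u"
inductive_cases er_KE: "GConst c \<leadsto> u"
inductive_cases er_GE: "Glob d s \<leadsto> u"
lemmas erases_elims [elim!] = er_VE er_LE er_AE er_PE er_UE er_KE

text \<open>Lets syntactically equal terms be accepted as convertible: whatever they erase to is the
  same raw term.\<close>

lemma erases_det: "t \<leadsto> u \<Longrightarrow> t \<leadsto> u' \<Longrightarrow> u = u'"
proof (induct arbitrary: u' rule: erases.induct)
  case (er_G d u T s)
  obtain v where v: "u' = shift s v" "body d \<leadsto> v" using er_G.prems by (rule er_GE)
  show ?case using er_G.hyps(2) [OF v(2)] v(1) by simp
qed blast+

section \<open>Erasure commutes with shifts, lifting and substitution\<close>

lemma raise_eq: "raise k n m = (if m < k then m else m + n)"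
  by (induct k n m rule: raise.induct) auto

lemma strike_eq: "strike k m = (if m < k then Some m else if m = k then None else Some (m - 1))"
  by (induct k m rule: strike.induct) auto

lemma shift_by_eq: "shift_by s t = gshift s t"
proof (cases s)
  case 0
  have "gshift 0 t = t" by (induct t) auto
  then show ?thesis using 0 by simp
qed simp

lemma is_type_shift: "is_type [] T \<Longrightarrow> is_type [] (shift s T)"
  unfolding is_type_def using hastype_shift [of "[]" T _ s] by force

lemma erases_shift: "t \<leadsto> u \<Longrightarrow> gshift s t \<leadsto> shift s u"
proof (induct rule: erases.induct)
  case (er_G d u T r)
  then have "Glob d (s + r) \<leadsto> shift (s + r) u" by (intro erases.er_G)
  then show ?case by (simp add: shift_shift add.commute)
qed (auto intro: erases.intros simp: add.commute [of s] intro!: erases.er_U)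

lemma lifts_Lam: "(lift k ^^ n) (Lam t) = Lam ((lift (Suc k) ^^ n) t)"
  by (induct n) auto
lemma lifts_App: "(lift k ^^ n) (App t u) = App ((lift k ^^ n) t) ((lift k ^^ n) u)"
  by (induct n) auto
lemma lifts_Pi: "(lift k ^^ n) (Pi t u) = Pi ((lift k ^^ n) t) ((lift (Suc k) ^^ n) u)"
  by (induct n) auto
lemma lifts_Var: "(lift k ^^ n) (Var m) = Var (if m < k then m else m + n)"
  by (induct n) auto
lemma lifts_U: "(lift k ^^ n) (U i) = U i" and lifts_Const: "(lift k ^^ n) (Const c) = Const c"
  by (induct n) auto

text \<open>\<open>glift\<close> may skip names because \<open>hastype_bounded\<close> makes their
  denotations closed.\<close>

lemma erases_lift: "t \<leadsto> u \<Longrightarrow> glift k n t \<leadsto> (lift k ^^ n) u"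
proof (induct arbitrary: k rule: erases.induct)
  case (er_G d u T s)
  then have "Glob d s \<leadsto> shift s u" by (intro erases.er_G)
  moreover have "bounded 0 (shift s u)" using hastype_bounded [OF er_G(5)] by simp
  then have "(lift k ^^ n) (shift s u) = shift s u" by (induct n) (auto simp: lift_bounded)
  ultimately show ?case by simp
qed (auto simp: lifts_Lam lifts_App lifts_Pi lifts_Var lifts_U lifts_Const raise_eq intro: erases.intros)

lemma erases_lift1: "t \<leadsto> u \<Longrightarrow> glift 0 (Suc 0) t \<leadsto> lift 0 u"
  using erases_lift [of t u 0 "Suc 0"] by simp

lemma erases_lift_by: "t \<leadsto> u \<Longrightarrow> lift_by n t \<leadsto> (lift 0 ^^ n) u"
  using erases_lift [of t u 0 n] by (cases n) auto

lemma erases_subst: "t \<leadsto> u \<Longrightarrow> s \<leadsto> v \<Longrightarrow> gsubst k s t \<leadsto> subst k ((lift 0 ^^ k) v) u"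
proof (induct arbitrary: k rule: erases.induct)
  case (er_V n)
  then show ?case by (auto simp: strike_eq intro: erases.er_V erases_lift_by)
next
  case (er_L t u)
  then show ?case using er_L(2) [of "Suc k"] by (auto intro: erases.er_L)
next
  case (er_P t u t' u')
  then show ?case using er_P(4) [of "Suc k"] by (auto intro: erases.er_P)
next
  case (er_G d u T r)
  then have "Glob d r \<leadsto> shift r u" by (intro erases.er_G)
  moreover have "bounded 0 (shift r u)" using hastype_bounded [OF er_G(5)] by simp
  ultimately show ?case by (simp add: subst_bounded)
qed (auto intro: erases.intros)

lemma erases_subst0: "t \<leadsto> u \<Longrightarrow> s \<leadsto> v \<Longrightarrow> gsubst 0 s t \<leadsto> subst 0 v u"
  using erases_subst [of t u s v 0] by simp

lemma erases_GD: "Glob d s \<leadsto> u \<Longrightarrow> shift_by s (body d) \<leadsto> u"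
  by (erule er_GE) (simp add: shift_by_eq erases_shift)

lemma erases_unwind: "t \<leadsto> u \<Longrightarrow> list_all2 (\<leadsto>) ts us \<Longrightarrow> unwind t ts \<leadsto> apps u us"
  by (induct ts arbitrary: t u us) (auto simp: list_all2_Cons1 er_A)

lemma erases_beta: "t \<leadsto> u \<Longrightarrow> \<exists>v. beta f t \<leadsto> v \<and> u \<equiv>\<^sub>d v"
proof (induct f arbitrary: t u)
  case 0
  then show ?case by (auto intro: conv_refl)
next
  case (Suc f)
  show ?case
  proof (cases t)
    case (GApp t1 t2)
    then obtain u1 u2 where u: "u = App u1 u2" "t1 \<leadsto> u1" "t2 \<leadsto> u2" using Suc.prems by auto
    obtain v1 where v1: "beta f t1 \<leadsto> v1" "u1 \<equiv>\<^sub>d v1" using Suc.hyps [OF u(2)] by blast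
    obtain v2 where v2: "beta f t2 \<leadsto> v2" "u2 \<equiv>\<^sub>d v2" using Suc.hyps [OF u(3)] by blast
    have other: "\<exists>v. GApp (beta f t1) (beta f t2) \<leadsto> v \<and> u \<equiv>\<^sub>d v"
      using u v1 v2 by (auto intro!: er_A conv_App)
    show ?thesis
    proof (cases "beta f t1")
      case (GLam b)
      then obtain b' where b': "v1 = Lam b'" "b \<leadsto> b'" using v1 by auto
      obtain w where w: "beta f (gsubst 0 t2 b) \<leadsto> w" "subst 0 u2 b' \<equiv>\<^sub>d w"
        using Suc.hyps [OF erases_subst0 [OF b'(2) u(3)]] by blast
      have "u \<equiv>\<^sub>d w"
        using u v1 b' w by (blast intro: conv_trans conv_App conv_refl conv_beta)
      then show ?thesis using GLam GApp w by auto
    qed (use other GApp in auto)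
  qed (use Suc in \<open>auto intro: conv_refl erases.intros\<close>,
      (metis Suc.hyps conv_Lam er_L), (metis Suc.hyps conv_Pi er_P))
qed

section \<open>Soundness of reduction and of the conversion check\<close>

lemma split_at_SomeD:
  "split_at n xs = Some (ys, y, zs) \<Longrightarrow> xs = ys @ y # zs \<and> length ys = n"
  by (induct n xs arbitrary: ys y zs rule: split_at.induct) (auto split: option.splits)

lemma lookup_SomeD: "lookup xs n = Some x \<Longrightarrow> n < length xs \<and> xs ! n = x"
  by (induct xs n rule: lookup.induct) auto

text \<open>Phrased for an arbitrary function, so that the computation rules can be justified before
  the mutual recursion that calls them is unfolded.\<close>

definition whnf_sound where
  "whnf_sound W \<longleftrightarrow> (\<forall>t u ts us. t \<leadsto> u \<longrightarrow> list_all2 (\<leadsto>) ts us \<longrightarrow> (\<exists>v. W t ts \<leadsto> v \<and> apps u us \<equiv>\<^sub>d v))"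

definition conv_sound where
  "conv_sound C \<longleftrightarrow> (\<forall>t t' u u'. C t t' \<longrightarrow> t \<leadsto> u \<longrightarrow> t' \<leadsto> u' \<longrightarrow> u \<equiv>\<^sub>d u')"

definition iota_sound where
  "iota_sound c r us \<longleftrightarrow>
     (\<forall>t vs. r = Some (t, vs) \<longrightarrow> (\<exists>v ws. t \<leadsto> v \<and> list_all2 (\<leadsto>) vs ws \<and> apps (Const c) us \<equiv>\<^sub>d apps v ws))"

lemma whnf_soundD: "whnf_sound W \<Longrightarrow> t \<leadsto> u \<Longrightarrow> \<exists>v. W t [] \<leadsto> v \<and> u \<equiv>\<^sub>d v"
  unfolding whnf_sound_def by force

lemma conv_soundD: "conv_sound C \<Longrightarrow> C t t' \<Longrightarrow> t \<leadsto> u \<Longrightarrow> t' \<leadsto> u' \<Longrightarrow> u \<equiv>\<^sub>d u'"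
  unfolding conv_sound_def by blast

lemma conv_apps_head: "t \<equiv>\<^sub>d t' \<Longrightarrow> apps t us \<equiv>\<^sub>d apps t' us"
  by (induct us arbitrary: t t') (auto intro: conv_App conv_refl)

lemma iota_sig_sound:
  assumes W: "whnf_sound W" and C: "conv_sound C" and ts: "list_all2 (\<leadsto>) ts us"
  shows "iota_sound CSigInd (iota_sig W C ts) us"
  unfolding iota_sound_def
proof (intro allI impI)
  fix t vs assume r: "iota_sig W C ts = Some (t, vs)"
  then obtain B D E z where "ts = B # D # E # t # z # tl (tl vs)" and vs: "\<exists>a b. vs = a # b # tl (tl vs)"
    by (cases "(W, C, ts)" rule: iota_sig.cases) (auto split: gtm.splits if_splits)
  then obtain a b ws where vs: "vs = a # b # ws" and ts': "ts = B # D # E # t # z # ws" by auto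
  then obtain B' D' where z: "W z [] = GApp (GApp (GApp (GApp (GConst CPair) B') D') a) b" "C B' B" "C D' D"
    using r by (auto split: gtm.splits if_splits)
  obtain B1 D1 E1 t1 z1 us' where us: "us = B1 # D1 # E1 # t1 # z1 # us'"
    "B \<leadsto> B1" "D \<leadsto> D1" "t \<leadsto> t1" "z \<leadsto> z1" "list_all2 (\<leadsto>) ws us'"
    using ts unfolding ts' by (auto simp: list_all2_Cons1)
  obtain v where v: "W z [] \<leadsto> v" "z1 \<equiv>\<^sub>d v" using whnf_soundD [OF W us(5)] by blast
  then obtain B2 D2 a2 b2 where e: "v = apps (Const CPair) [B2, D2, a2, b2]" "B' \<leadsto> B2" "D' \<leadsto> D2" "a \<leadsto> a2" "b \<leadsto> b2"
    using z by auto
  have "B2 \<equiv>\<^sub>d B1" "D2 \<equiv>\<^sub>d D1" using conv_soundD [OF C] z us e by blast+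
  \<comment> \<open>The pair found by reduction carries parameters of its own; conversion exchanges
    them for those of the eliminator, as \<open>conv_SigInd\<close> demands.\<close>
  then have "z1 \<equiv>\<^sub>d apps (Const CPair) [B1, D1, a2, b2]"
    using v(2) unfolding e(1) by (auto intro!: conv_App conv_refl elim!: conv_trans)
  then have "apps (Const CSigInd) [B1, D1, E1, t1, z1] \<equiv>\<^sub>d apps t1 [a2, b2]"
    using conv_SigInd [of B1 D1 E1 t1 a2 b2] by (auto intro: conv_trans conv_App conv_refl)
  then have "apps (Const CSigInd) us \<equiv>\<^sub>d apps t1 (a2 # b2 # us')"
    unfolding us(1) using conv_apps_head by fastforce
  then show "\<exists>v ws. t \<leadsto> v \<and> list_all2 (\<leadsto>) vs ws \<and> apps (Const CSigInd) us \<equiv>\<^sub>d apps v ws"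
    using us e unfolding vs by (intro exI [of _ t1] exI [of _ "a2 # b2 # us'"]) auto
qed

lemma iota_id_sound:
  assumes W: "whnf_sound W" and C: "conv_sound C" and ts: "list_all2 (\<leadsto>) ts us"
  shows "iota_sound CIdInd (iota_id W C ts) us"
  unfolding iota_sound_def
proof (intro allI impI)
  fix t vs assume r: "iota_id W C ts = Some (t, vs)"
  then obtain B D x y p where "ts = B # D # t # x # y # p # tl vs" and vs: "\<exists>a. vs = a # tl vs"
    by (cases "(W, C, ts)" rule: iota_id.cases) (auto split: gtm.splits if_splits)
  then obtain a ws where vs: "vs = a # ws" and ts': "ts = B # D # t # x # y # p # ws" by auto
  then obtain B' where z: "W p [] = GApp (GApp (GConst CRefl) B') a" "C B' B" "C a x" "C a y"
    using r by (auto split: gtm.splits if_splits)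
  obtain B1 D1 t1 x1 y1 p1 us' where us: "us = B1 # D1 # t1 # x1 # y1 # p1 # us'"
    "B \<leadsto> B1" "t \<leadsto> t1" "x \<leadsto> x1" "y \<leadsto> y1" "p \<leadsto> p1" "list_all2 (\<leadsto>) ws us'"
    using ts unfolding ts' by (auto simp: list_all2_Cons1)
  obtain v where v: "W p [] \<leadsto> v" "p1 \<equiv>\<^sub>d v" using whnf_soundD [OF W us(6)] by blast
  then obtain B2 a2 where e: "v = apps (Const CRefl) [B2, a2]" "B' \<leadsto> B2" "a \<leadsto> a2"
    using z by auto
  \<comment> \<open>\<open>conv_IdInd\<close> has one point in three places, so the point of the
    reflexivity term is compared with both endpoints.\<close>
  have c: "B2 \<equiv>\<^sub>d B1" "a2 \<equiv>\<^sub>d x1" "a2 \<equiv>\<^sub>d y1" using conv_soundD [OF C] z us e by blast+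
  then have "p1 \<equiv>\<^sub>d apps (Const CRefl) [B1, a2]"
    using v(2) unfolding e(1) by (auto intro!: conv_App conv_refl elim!: conv_trans)
  then have "apps (Const CIdInd) [B1, D1, t1, x1, y1, p1] \<equiv>\<^sub>d apps (Const CIdInd) [B1, D1, t1, a2, a2, apps (Const CRefl) [B1, a2]]"
    using c by (auto intro!: conv_App conv_refl intro: conv_sym)
  then have "apps (Const CIdInd) [B1, D1, t1, x1, y1, p1] \<equiv>\<^sub>d App t1 a2"
    using conv_IdInd conv_trans by blast
  then have "apps (Const CIdInd) us \<equiv>\<^sub>d apps t1 (a2 # us')"
    unfolding us(1) using conv_apps_head by fastforce
  then show "\<exists>v ws. t \<leadsto> v \<and> list_all2 (\<leadsto>) vs ws \<and> apps (Const CIdInd) us \<equiv>\<^sub>d apps v ws"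
    using us e unfolding vs by (intro exI [of _ t1] exI [of _ "a2 # us'"]) auto
qed

lemma iota_trunc_sound:
  assumes W: "whnf_sound W" and C: "conv_sound C" and ts: "list_all2 (\<leadsto>) ts us"
  shows "iota_sound CTruncInd (iota_trunc W C ts) us"
  unfolding iota_sound_def
proof (intro allI impI)
  fix t vs assume r: "iota_trunc W C ts = Some (t, vs)"
  then obtain B D h z where "ts = B # D # h # t # z # tl vs" and vs: "\<exists>a. vs = a # tl vs"
    by (cases "(W, C, ts)" rule: iota_trunc.cases) (auto split: gtm.splits if_splits)
  then obtain a ws where vs: "vs = a # ws" and ts': "ts = B # D # h # t # z # ws" by auto
  then obtain B' where z: "W z [] = GApp (GApp (GConst CTr) B') a" "C B' B"
    using r by (auto split: gtm.splits if_splits)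
  obtain B1 D1 h1 t1 z1 us' where us: "us = B1 # D1 # h1 # t1 # z1 # us'"
    "B \<leadsto> B1" "t \<leadsto> t1" "z \<leadsto> z1" "list_all2 (\<leadsto>) ws us'"
    using ts unfolding ts' by (auto simp: list_all2_Cons1)
  obtain v where v: "W z [] \<leadsto> v" "z1 \<equiv>\<^sub>d v" using whnf_soundD [OF W us(4)] by blast
  then obtain B2 a2 where e: "v = apps (Const CTr) [B2, a2]" "B' \<leadsto> B2" "a \<leadsto> a2"
    using z by auto
  have "B2 \<equiv>\<^sub>d B1" using conv_soundD [OF C] z us e by blast
  then have "z1 \<equiv>\<^sub>d apps (Const CTr) [B1, a2]"
    using v(2) unfolding e(1) by (auto intro!: conv_App conv_refl elim!: conv_trans)
  then have "apps (Const CTruncInd) [B1, D1, h1, t1, z1] \<equiv>\<^sub>d App t1 a2"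
    using conv_TruncInd [of B1 D1 h1 t1 a2] by (auto intro: conv_trans conv_App conv_refl)
  then have "apps (Const CTruncInd) us \<equiv>\<^sub>d apps t1 (a2 # us')"
    unfolding us(1) using conv_apps_head by fastforce
  then show "\<exists>v ws. t \<leadsto> v \<and> list_all2 (\<leadsto>) vs ws \<and> apps (Const CTruncInd) us \<equiv>\<^sub>d apps v ws"
    using us e unfolding vs by (intro exI [of _ t1] exI [of _ "a2 # us'"]) auto
qed

lemma iota_X_sound:
  assumes W: "whnf_sound W" and ts: "list_all2 (\<leadsto>) ts us"
  shows "iota_sound CXInd (iota_X W ts) us"
  unfolding iota_sound_def
proof (intro allI impI)
  fix t vs assume r: "iota_X W ts = Some (t, vs)"
  then obtain D a b r' s x where ts': "ts = D # t # a # b # r' # s # x # vs" and z: "W x [] = GConst CPt"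
    by (cases "(W, ts)" rule: iota_X.cases) (auto split: gtm.splits if_splits)
  obtain D1 t1 a1 b1 r1 s1 x1 us' where us: "us = D1 # t1 # a1 # b1 # r1 # s1 # x1 # us'"
    "t \<leadsto> t1" "x \<leadsto> x1" "list_all2 (\<leadsto>) vs us'"
    using ts unfolding ts' by (auto simp: list_all2_Cons1)
  have "x1 \<equiv>\<^sub>d Const CPt" using whnf_soundD [OF W us(3)] z by auto
  then have "apps (Const CXInd) [D1, t1, a1, b1, r1, s1, x1] \<equiv>\<^sub>d t1"
    using conv_XInd [of D1 t1 a1 b1 r1 s1] by (auto intro: conv_trans conv_App conv_refl)
  then have "apps (Const CXInd) us \<equiv>\<^sub>d apps t1 us'"
    unfolding us(1) using conv_apps_head by fastforce
  then show "\<exists>v ws. t \<leadsto> v \<and> list_all2 (\<leadsto>) vs ws \<and> apps (Const CXInd) us \<equiv>\<^sub>d apps v ws"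
    using us by blast
qed

lemma iota_fin_sound:
  assumes W: "whnf_sound W" and ts: "list_all2 (\<leadsto>) ts us"
  shows "iota_sound (CFinInd n) (iota_fin W n ts) us"
  unfolding iota_sound_def
proof (intro allI impI)
  fix t vs assume r: "iota_fin W n ts = Some (t, vs)"
  then obtain D ws where ts1: "ts = D # ws" by (cases ts) auto
  then obtain cs x where s: "split_at n ws = Some (cs, x, vs)"
    using r by (auto split: option.splits gtm.splits const.splits if_splits)
  then obtain k where z: "W x [] = GConst (CEl n k)" and k: "lookup cs k = Some t"
    using r ts1 by (auto split: option.splits gtm.splits const.splits if_splits)
  have ts': "ts = D # cs @ x # vs" and n: "length cs = n" using split_at_SomeD [OF s] ts1 by auto
  obtain D1 cs1 x1 us' where us: "us = D1 # cs1 @ x1 # us'" "list_all2 (\<leadsto>) cs cs1" "x \<leadsto> x1" "list_all2 (\<leadsto>) vs us'"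
    using ts unfolding ts' by (auto simp: list_all2_Cons1 list_all2_append1)
  have k': "k < n" "cs ! k = t" "length cs1 = n" using lookup_SomeD [OF k] n us(2) by (auto simp: list_all2_lengthD)
  then have t: "t \<leadsto> cs1 ! k" using us(2) n by (auto simp: list_all2_conv_all_nth)
  have "x1 \<equiv>\<^sub>d Const (CEl n k)" using whnf_soundD [OF W us(3)] z by auto
  then have "App (apps (App (Const (CFinInd n)) D1) cs1) x1 \<equiv>\<^sub>d cs1 ! k"
    using conv_FinInd [of cs1 n k D1] k' by (blast intro: conv_trans conv_App conv_refl)
  then have "apps (Const (CFinInd n)) us \<equiv>\<^sub>d apps (cs1 ! k) us'"
    unfolding us(1) using conv_apps_head by (fastforce simp: apps_append)
  then show "\<exists>v ws. t \<leadsto> v \<and> list_all2 (\<leadsto>) vs ws \<and> apps (Const (CFinInd n)) us \<equiv>\<^sub>d apps v ws"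
    using us t by blast
qed

lemma iota_sound:
  assumes "whnf_sound W" "conv_sound C" "list_all2 (\<leadsto>) ts us"
  shows "iota_sound c (iota W C c ts) us"
  using iota_sig_sound [OF assms] iota_id_sound [OF assms] iota_trunc_sound [OF assms]
    iota_X_sound [OF assms(1,3)] iota_fin_sound [OF assms(1,3)]
  by (auto split: const.splits) (auto simp: iota_sound_def)

lemma whnf_step:
  assumes W: "whnf_sound (whnf f)" and C: "conv_sound (conv_check f)"
  shows "whnf_sound (whnf (Suc f))"
  unfolding whnf_sound_def
proof (intro allI impI)
  fix t u ts us assume t: "t \<leadsto> u" and ts: "list_all2 (\<leadsto>) ts us"
  have W': "t \<leadsto> u \<Longrightarrow> list_all2 (\<leadsto>) ts us \<Longrightarrow> \<exists>v. whnf f t ts \<leadsto> v \<and> apps u us \<equiv>\<^sub>d v" for t u ts us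
    using W unfolding whnf_sound_def by blast
  have stuck: "\<exists>v. unwind t ts \<leadsto> v \<and> apps u us \<equiv>\<^sub>d v"
    using erases_unwind [OF t ts] conv_refl by blast
  show "\<exists>v. whnf (Suc f) t ts \<leadsto> v \<and> apps u us \<equiv>\<^sub>d v"
  proof (cases t)
    case (GApp t1 t2)
    then obtain u1 u2 where "u = App u1 u2" "t1 \<leadsto> u1" "t2 \<leadsto> u2" using t by auto
    then show ?thesis using W' [of t1 u1 "t2 # ts" "u2 # us"] ts GApp by simp
  next
    case (GLam b)
    then obtain b' where b: "u = Lam b'" "b \<leadsto> b'" using t by auto
    show ?thesis
    proof (cases ts)
      case Nil then show ?thesis using stuck GLam by simp
    next
      case (Cons s ss)
      then obtain s' us' where us: "us = s' # us'" "s \<leadsto> s'" "list_all2 (\<leadsto>) ss us'"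
        using ts by (auto simp: list_all2_Cons1)
      obtain v where v: "whnf f (gsubst 0 s b) ss \<leadsto> v" "apps (subst 0 s' b') us' \<equiv>\<^sub>d v"
        using W' [OF erases_subst0 [OF b(2) us(2)] us(3)] by blast
      have "apps u us \<equiv>\<^sub>d apps (subst 0 s' b') us'"
        unfolding b(1) us(1) by (simp add: conv_apps_head conv_beta)
      then show ?thesis using v GLam Cons conv_trans by auto
    qed
  next
    case (Glob d s)
    then show ?thesis using stuck W' [OF erases_GD ts] t by auto
  next
    case (GConst c)
    then have u: "u = Const c" using t by auto
    show ?thesis
    proof (cases "iota (whnf f) (conv_check f) c ts")
      case None then show ?thesis using stuck GConst by simp
    next
      case (Some r)
      obtain t' vs where r: "r = (t', vs)" by fastforce
      obtain v ws where v: "t' \<leadsto> v" "list_all2 (\<leadsto>) vs ws" "apps (Const c) us \<equiv>\<^sub>d apps v ws"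
        using iota_sound [OF W C ts, of c] Some r unfolding iota_sound_def by auto
      show ?thesis using W' [OF v(1,2)] v(3) Some r GConst u conv_trans by auto
    qed
  qed (use stuck in auto)
qed

lemma struct_unfold:
  assumes "conv_sound (struct_check f)" "Glob d s \<leadsto> u"
  shows "t' \<leadsto> u' \<Longrightarrow> struct_check f (shift_by s (body d)) t' \<Longrightarrow> u \<equiv>\<^sub>d u'"
    and "t' \<leadsto> u' \<Longrightarrow> struct_check f t' (shift_by s (body d)) \<Longrightarrow> u' \<equiv>\<^sub>d u"
  using erases_GD [OF assms(2)] conv_soundD [OF assms(1)] by blast+

text \<open>Every mutual call spends one unit of fuel, so one induction serves all four functions.
  Exhausted fuel is harmless: the checks answer \<open>False\<close>, and \<open>whnf\<close>
  returns the term as it stands.\<close>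

lemma kernel_sound:
  "whnf_sound (whnf f) \<and> conv_sound (conv_check f) \<and> conv_sound (struct_check f) \<and> conv_sound (eta_check f)"
proof (induct f)
  case 0
  have "whnf_sound (whnf 0)"
    unfolding whnf_sound_def using erases_unwind conv_refl by simp blast
  moreover have "conv_sound (conv_check 0)" "conv_sound (struct_check 0)" "conv_sound (eta_check 0)"
    by (simp_all add: conv_sound_def)
  ultimately show ?case by blast
next
  case (Suc f)
  then have W: "whnf_sound (whnf f)" and C: "conv_sound (conv_check f)"
    and S: "conv_sound (struct_check f)" and E: "conv_sound (eta_check f)" by auto
  note CD = conv_soundD [OF C]
  have 1: "conv_sound (conv_check (Suc f))"
    unfolding conv_sound_def
  proof (intro allI impI)
    fix t t' u u' assume c: "conv_check (Suc f) t t'" and t: "t \<leadsto> u" "t' \<leadsto> u'"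
    obtain v v' where v: "whnf f t [] \<leadsto> v" "u \<equiv>\<^sub>d v" "whnf f t' [] \<leadsto> v'" "u' \<equiv>\<^sub>d v'"
      using whnf_soundD [OF W t(1)] whnf_soundD [OF W t(2)] by blast
    show "u \<equiv>\<^sub>d u'"
      using c conv_soundD [OF S _ t] conv_soundD [OF E _ v(1,3)] v(2,4)
      by (auto split: if_splits intro: conv_trans conv_sym)
  qed
  have 2: "conv_sound (struct_check (Suc f))"
    unfolding conv_sound_def
  proof (intro allI impI)
    fix t t' u u' assume c: "struct_check (Suc f) t t'" and t: "t \<leadsto> u" "t' \<leadsto> u'"
    have unf: "t = Glob d s \<Longrightarrow> struct_check f (shift_by s (body d)) t' \<Longrightarrow> u \<equiv>\<^sub>d u'" for d s
      using struct_unfold(1) [OF S _ t(2)] t(1) by blast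
    have unf': "t' = Glob d s \<Longrightarrow> struct_check f t (shift_by s (body d)) \<Longrightarrow> u \<equiv>\<^sub>d u'" for d s
      using struct_unfold(2) [OF S _ t(1)] t(2) by blast
    show "u \<equiv>\<^sub>d u'"
    proof (cases t)
      case (GApp t1 t2)
      then obtain s1 s2 where s: "t' = GApp s1 s2" "struct_check f t1 s1" "conv_check f t2 s2"
        using c by (cases t') (simp_all split: if_splits)
      from t obtain v1 v2 v1' v2' where v: "u = App v1 v2" "t1 \<leadsto> v1" "t2 \<leadsto> v2" "u' = App v1' v2'" "s1 \<leadsto> v1'" "s2 \<leadsto> v2'"
        unfolding GApp s(1) by blast
      show ?thesis unfolding v(1,4) by (intro conv_App conv_soundD [OF S s(2)] CD [OF s(3)] v)
    next
      case (GPi t1 t2)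
      then obtain s1 s2 where s: "t' = GPi s1 s2" "conv_check f t1 s1" "conv_check f t2 s2"
        using c by (cases t') (simp_all split: if_splits)
      from t obtain v1 v2 v1' v2' where v: "u = Pi v1 v2" "t1 \<leadsto> v1" "t2 \<leadsto> v2" "u' = Pi v1' v2'" "s1 \<leadsto> v1'" "s2 \<leadsto> v2'"
        unfolding GPi s(1) by blast
      show ?thesis unfolding v(1,4) by (intro conv_Pi CD [OF s(2)] CD [OF s(3)] v)
    next
      case (GLam b)
      show ?thesis
      proof (cases t')
        case (GLam b')
        then have s: "conv_check f b b'" using c \<open>t = GLam b\<close> by simp
        from t obtain v v' where v: "u = Lam v" "b \<leadsto> v" "u' = Lam v'" "b' \<leadsto> v'"
          unfolding \<open>t = GLam b\<close> GLam by blast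
        show ?thesis unfolding v(1,3) by (intro conv_Lam CD [OF s] v)
      next
        case (Glob d s)
        show ?thesis by (rule unf' [OF Glob]) (use c \<open>t = GLam b\<close> Glob in \<open>simp split: if_splits\<close>)
      qed (use c \<open>t = GLam b\<close> in simp_all)
    next
      case (GConst k)
      show ?thesis
      proof (cases t')
        case (GConst k')
        then have "t = t'" using c \<open>t = GConst k\<close> by simp
        then show ?thesis using erases_det t conv_refl by blast
      next
        case (Glob d s)
        show ?thesis by (rule unf' [OF Glob]) (use c \<open>t = GConst k\<close> Glob in \<open>simp split: if_splits\<close>)
      qed (use c \<open>t = GConst k\<close> in simp_all)
    next
      case (Glob d s)
      have x: "struct_check f (shift_by s (body d)) t' \<Longrightarrow> u \<equiv>\<^sub>d u'" by (rule unf [OF Glob])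
      show ?thesis
      proof (cases t')
        case (Glob d' s')
        then have "t = t'" using c \<open>t = Glob d s\<close> by (simp split: if_splits)
        then show ?thesis using erases_det t conv_refl by blast
      next
        case (GLam b)
        show ?thesis by (rule x) (use c \<open>t = Glob d s\<close> GLam in \<open>simp split: if_splits\<close>)
      next
        case (GConst k)
        show ?thesis by (rule x) (use c \<open>t = Glob d s\<close> GConst in \<open>simp split: if_splits\<close>)
      qed (use c \<open>t = Glob d s\<close> in simp_all)
    next
      case (GVar n)
      then have "t = t'" using c by (cases t') simp_all
      then show ?thesis using erases_det t conv_refl by blast
    next
      case (GUniv n)
      then have "t = t'" using c by (cases t') simp_all
      then show ?thesis using erases_det t conv_refl by blast
    qed
  qed
  have 3: "conv_sound (eta_check (Suc f))"
    unfolding conv_sound_def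
  proof (intro allI impI)
    fix t t' u u' assume c: "eta_check (Suc f) t t'" and t: "t \<leadsto> u" "t' \<leadsto> u'"
    \<comment> \<open>One side is an abstraction and the other is not: the latter is eta-expanded,
      and \<open>conv_eta\<close> contracts the expansion again.\<close>
    have el: "u \<equiv>\<^sub>d u'" if cc: "conv_check f b (GApp (glift 0 1 t') (GVar 0))" and tb: "t = GLam b" for b
    proof -
      obtain v where v: "u = Lam v" "b \<leadsto> v" using t(1) unfolding tb by (rule er_LE)
      have "GApp (glift 0 1 t') (GVar 0) \<leadsto> App (lift 0 u') (Var 0)"
        using erases_lift1 [OF t(2)] by (auto intro: er_A er_V)
      then have "v \<equiv>\<^sub>d App (lift 0 u') (Var 0)" by (rule CD [OF cc v(2)])
      then show ?thesis unfolding v(1) by (blast intro: conv_trans conv_Lam conv_eta)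
    qed
    have er: "u \<equiv>\<^sub>d u'" if cc: "conv_check f (GApp (glift 0 1 t) (GVar 0)) b" and tb: "t' = GLam b" for b
    proof -
      obtain v where v: "u' = Lam v" "b \<leadsto> v" using t(2) unfolding tb by (rule er_LE)
      have "GApp (glift 0 1 t) (GVar 0) \<leadsto> App (lift 0 u) (Var 0)"
        using erases_lift1 [OF t(1)] by (auto intro: er_A er_V)
      then have "App (lift 0 u) (Var 0) \<equiv>\<^sub>d v" by (rule CD [OF cc _ v(2)])
      then show ?thesis unfolding v(1) by (blast intro: conv_trans conv_sym conv_Lam conv_eta)
    qed
    have ll: "u \<equiv>\<^sub>d u'" if "conv_check f b b'" "t = GLam b" "t' = GLam b'" for b b'
      using t that by (auto intro!: conv_Lam CD [OF that(1)])
    have ss: "struct_check f t t' \<Longrightarrow> u \<equiv>\<^sub>d u'" using conv_soundD [OF S] t by blast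
    show "u \<equiv>\<^sub>d u'"
      using c el er ll ss by (cases t; cases t'; simp)
  qed
  show ?case using whnf_step [OF W C] 1 2 3 by blast
qed

section \<open>Soundness of the bidirectional type checker\<close>

lemmas whnf_erases = whnf_soundD [OF kernel_sound [THEN conjunct1]]
lemmas conv_check_sound = conv_soundD [OF kernel_sound [THEN conjunct2, THEN conjunct1]]

text \<open>\<open>hastype\<close> puts no condition on its context; this invariant guarantees that
  the type read off for a variable is a type.\<close>

inductive well_formed :: "tm list \<Rightarrow> bool" where
  "well_formed []"
| "is_type \<Gamma> B \<Longrightarrow> well_formed \<Gamma> \<Longrightarrow> well_formed (B # \<Gamma>)"

lemma well_formed_nth: "well_formed \<Gamma> \<Longrightarrow> n < length \<Gamma> \<Longrightarrow> is_type \<Gamma> ((lift 0 ^^ Suc n) (\<Gamma> ! n))"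
proof (induct arbitrary: n rule: well_formed.induct)
  case (2 \<Gamma> B)
  have w: "is_type (B # \<Gamma>) (lift 0 T)" if "is_type \<Gamma> T" for T
    using that hastype_weaken unfolding is_type_def by fastforce
  show ?case
  proof (cases n)
    case 0 then show ?thesis using w [OF 2(1)] by simp
  next
    case (Suc m) then show ?thesis using w [OF 2(3) [of m]] 2 by simp
  qed
qed simp

lemma is_type_conv_U: "hastype \<Gamma> t T \<Longrightarrow> T \<equiv>\<^sub>d U i \<Longrightarrow> hastype \<Gamma> t (U i)"
  by (blast intro: ht_conv ht_U)

lemma universe_of_sound: "universe_of f T = Some i \<Longrightarrow> T \<leadsto> S \<Longrightarrow> S \<equiv>\<^sub>d U i"
proof (cases "\<exists>i. T = GUniv i")
  case True
  then show "universe_of f T = Some i \<Longrightarrow> T \<leadsto> S \<Longrightarrow> S \<equiv>\<^sub>d U i" by (auto intro: conv_refl)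
next
  case False
  assume u: "universe_of f T = Some i" and T: "T \<leadsto> S"
  then have "whnf f T [] = GUniv i" using False by (auto split: gtm.splits)
  then show "S \<equiv>\<^sub>d U i" using whnf_erases [OF T, of f] by auto
qed

lemma subtype_check_sound:
  assumes s: "subtype_check f T T'" and e: "T \<leadsto> S" "T' \<leadsto> S'" and t: "hastype \<Gamma> t S" and w: "is_type \<Gamma> S'"
  shows "hastype \<Gamma> t S'"
proof (cases "\<exists>i. T = GUniv i")
  case True
  then obtain i j where T: "T = GUniv i" "whnf f T' [] = GUniv j" "i \<le> j"
    using s by (auto split: gtm.splits)
  then have "hastype \<Gamma> t (U j)" using t e hastype_cumul by auto
  moreover have "S' \<equiv>\<^sub>d U j" using whnf_erases [OF e(2), of f] T by auto
  ultimately show ?thesis using w unfolding is_type_def by (blast intro: ht_conv conv_sym)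
next
  case False
  then have "conv_check f T T'" using s by (cases T) auto
  then show ?thesis using conv_check_sound e t w unfolding is_type_def by (blast intro: ht_conv)
qed

text \<open>\<open>ht_conv\<close> needs its target to be a type. Hence \<open>infer\<close> and
  \<open>expose\<close> also certify that what they return is one, and \<open>check\<close>
  presupposes it of the type it is given.\<close>

lemma typing_sound:
  "(\<forall>\<Gamma> \<Delta> t u T. infer f \<Gamma> t = Some T \<longrightarrow> list_all2 (\<leadsto>) \<Gamma> \<Delta> \<longrightarrow> well_formed \<Delta> \<longrightarrow> t \<leadsto> u \<longrightarrow>
      (\<exists>S. T \<leadsto> S \<and> hastype \<Delta> u S \<and> is_type \<Delta> S)) \<and>
   (\<forall>\<Gamma> \<Delta> t u T S. check f \<Gamma> t T \<longrightarrow> list_all2 (\<leadsto>) \<Gamma> \<Delta> \<longrightarrow> well_formed \<Delta> \<longrightarrow> t \<leadsto> u \<longrightarrow> T \<leadsto> S \<longrightarrow> is_type \<Delta> S \<longrightarrow>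
      hastype \<Delta> u S) \<and>
   (\<forall>\<Gamma> \<Delta> T S B C. expose f \<Gamma> T = Some (B, C) \<longrightarrow> list_all2 (\<leadsto>) \<Gamma> \<Delta> \<longrightarrow> well_formed \<Delta> \<longrightarrow> T \<leadsto> S \<longrightarrow> is_type \<Delta> S \<longrightarrow>
      (\<exists>B' C'. B \<leadsto> B' \<and> C \<leadsto> C' \<and> is_type \<Delta> (Pi B' C') \<and> S \<equiv>\<^sub>d Pi B' C'))"
  (is "?I f \<and> ?C f \<and> ?E f")
proof (induct f)
  case (Suc f)
  then have I: "infer f \<Gamma> t = Some T \<Longrightarrow> list_all2 (\<leadsto>) \<Gamma> \<Delta> \<Longrightarrow> well_formed \<Delta> \<Longrightarrow> t \<leadsto> u \<Longrightarrow>
      \<exists>S. T \<leadsto> S \<and> hastype \<Delta> u S \<and> is_type \<Delta> S"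
    and C: "check f \<Gamma> t T \<Longrightarrow> list_all2 (\<leadsto>) \<Gamma> \<Delta> \<Longrightarrow> well_formed \<Delta> \<Longrightarrow> t \<leadsto> u \<Longrightarrow> T \<leadsto> S \<Longrightarrow> is_type \<Delta> S \<Longrightarrow>
      hastype \<Delta> u S"
    and E: "expose f \<Gamma> T = Some (B, D) \<Longrightarrow> list_all2 (\<leadsto>) \<Gamma> \<Delta> \<Longrightarrow> well_formed \<Delta> \<Longrightarrow> T \<leadsto> S \<Longrightarrow> is_type \<Delta> S \<Longrightarrow>
      \<exists>B' D'. B \<leadsto> B' \<and> D \<leadsto> D' \<and> is_type \<Delta> (Pi B' D') \<and> S \<equiv>\<^sub>d Pi B' D'"
    for \<Gamma> \<Delta> t u T S B D by blast+
  have "?I (Suc f)"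
  proof (intro allI impI)
    fix \<Gamma> \<Delta> t u T
    assume i: "infer (Suc f) \<Gamma> t = Some T" and \<Gamma>: "list_all2 (\<leadsto>) \<Gamma> \<Delta>" "well_formed \<Delta>" and t: "t \<leadsto> u"
    show "\<exists>S. T \<leadsto> S \<and> hastype \<Delta> u S \<and> is_type \<Delta> S"
    proof (cases t)
      case (GVar n)
      then obtain T0 where T0: "lookup \<Gamma> n = Some T0" "T = glift 0 (Suc n) T0"
        using i by (auto split: option.splits)
      have n: "n < length \<Delta>" "T0 \<leadsto> \<Delta> ! n"
        using lookup_SomeD [OF T0(1)] \<Gamma>(1) by (auto simp: list_all2_conv_all_nth)
      have "T \<leadsto> (lift 0 ^^ Suc n) (\<Delta> ! n)" unfolding T0(2) by (rule erases_lift [OF n(2)])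
      moreover have "u = Var n" using t GVar by auto
      ultimately show ?thesis using ht_Var [OF n(1)] well_formed_nth [OF \<Gamma>(2) n(1)] by blast
    next
      case (GApp t1 t2)
      then obtain u1 u2 where u: "u = App u1 u2" "t1 \<leadsto> u1" "t2 \<leadsto> u2" using t by auto
      obtain T1 B D where T1: "infer f \<Gamma> t1 = Some T1" "expose f \<Gamma> T1 = Some (B, D)"
        "check f \<Gamma> t2 B" "T = gsubst 0 t2 D"
        using i GApp by (auto split: option.splits if_splits)
      obtain S1 where S1: "T1 \<leadsto> S1" "hastype \<Delta> u1 S1" "is_type \<Delta> S1" using I [OF T1(1) \<Gamma> u(2)] by blast
      obtain B' D' where B: "B \<leadsto> B'" "D \<leadsto> D'" "is_type \<Delta> (Pi B' D')" "S1 \<equiv>\<^sub>d Pi B' D'"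
        using E [OF T1(2) \<Gamma> S1(1,3)] by blast
      \<comment> \<open>Conversion to the exposed function type is legitimate because
        \<open>expose\<close> has vouched for it.\<close>
      have 1: "hastype \<Delta> u1 (Pi B' D')" using S1 B unfolding is_type_def by (blast intro: ht_conv)
      have 2: "hastype \<Delta> u2 B'" using C [OF T1(3) \<Gamma> u(3) B(1)] is_type_PiD [OF B(3)] by blast
      have "is_type \<Delta> (subst 0 u2 D')"
        using is_type_PiD [OF B(3)] hastype_subst0 [OF _ 2] unfolding is_type_def by fastforce
      moreover have "T \<leadsto> subst 0 u2 D'" unfolding T1(4) by (rule erases_subst0 [OF B(2) u(3)])
      ultimately show ?thesis using ht_App [OF 1 2] u(1) by blast
    next
      case (GPi t1 t2)
      then obtain u1 u2 where u: "u = Pi u1 u2" "t1 \<leadsto> u1" "t2 \<leadsto> u2" using t by auto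
      obtain T1 T2 k j where T1: "infer f \<Gamma> t1 = Some T1" "universe_of f T1 = Some k"
        "infer f (t1 # \<Gamma>) t2 = Some T2" "universe_of f T2 = Some j" "T = GUniv (if k \<le> j then j else k)"
        using i GPi by (auto split: option.splits simp del: universe_of.simps)
      let ?m = "if k \<le> j then j else k"
      obtain S1 where S1: "T1 \<leadsto> S1" "hastype \<Delta> u1 S1" using I [OF T1(1) \<Gamma> u(2)] by blast
      have h1: "hastype \<Delta> u1 (U k)" using is_type_conv_U [OF S1(2)] universe_of_sound [OF T1(2) S1(1)] .
      have \<Gamma>': "list_all2 (\<leadsto>) (t1 # \<Gamma>) (u1 # \<Delta>)" "well_formed (u1 # \<Delta>)"
        using \<Gamma> u well_formed.intros(2) [of \<Delta> u1] h1 is_type_def by auto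
      obtain S2 where S2: "T2 \<leadsto> S2" "hastype (u1 # \<Delta>) u2 S2" using I [OF T1(3) \<Gamma>' u(3)] by blast
      have h2: "hastype (u1 # \<Delta>) u2 (U j)" using is_type_conv_U [OF S2(2)] universe_of_sound [OF T1(4) S2(1)] .
      have "hastype \<Delta> u (U ?m)"
        unfolding u(1) by (intro ht_Pi hastype_cumul [OF h1] hastype_cumul [OF h2]) auto
      moreover have "is_type \<Delta> (U ?m)" unfolding is_type_def using ht_U by blast
      ultimately show ?thesis unfolding T1(5) using er_U by blast
    next
      case (GUniv k)
      then have "u = U k" "T = GUniv (Suc k)" using i t by auto
      then show ?thesis unfolding is_type_def using er_U ht_U by blast
    next
      case (Glob d s)
      then obtain v S where v: "u = shift s v" "ty d \<leadsto> S" "hastype [] v S" "is_type [] S"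
        using t by (auto elim: er_GE)
      have T: "T \<leadsto> shift s S" using i Glob v(2) erases_shift by (auto simp: shift_by_eq)
      have h: "hastype [] (shift s v) (shift s S)" using hastype_shift [OF v(3), of s] by simp
      obtain k where k: "hastype [] (shift s S) (U k)" using is_type_shift [OF v(4)] unfolding is_type_def by blast
      \<comment> \<open>Names were typed in the empty context; term and type are closed, so they
        transfer unchanged to \<open>\<Delta>\<close>.\<close>
      have "hastype \<Delta> (shift s v) (shift s S)" by (rule hastype_closed [OF h k])
      moreover have "hastype \<Delta> (shift s S) (U k)" by (rule hastype_closed [OF k ht_U])
      ultimately show ?thesis using T v(1) unfolding is_type_def by blast
    qed (use i in auto)
  qed
  moreover have "?C (Suc f)"
  proof (intro allI impI)
    fix \<Gamma> \<Delta> t u T S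
    assume c: "check (Suc f) \<Gamma> t T" and \<Gamma>: "list_all2 (\<leadsto>) \<Gamma> \<Delta>" "well_formed \<Delta>"
      and t: "t \<leadsto> u" and T: "T \<leadsto> S" "is_type \<Delta> S"
    show "hastype \<Delta> u S"
    proof (cases "\<exists>b. t = GLam b")
      case True
      then obtain b where b: "t = GLam b" by blast
      then obtain v where v: "u = Lam v" "b \<leadsto> v" using t by auto
      obtain B D where B: "expose f \<Gamma> T = Some (B, D)" "check f (B # \<Gamma>) b D"
        using c b by (auto split: option.splits)
      obtain B' D' where B': "B \<leadsto> B'" "D \<leadsto> D'" "is_type \<Delta> (Pi B' D')" "S \<equiv>\<^sub>d Pi B' D'"
        using E [OF B(1) \<Gamma> T] by blast
      note w = is_type_PiD [OF B'(3)]
      have "hastype (B' # \<Delta>) v D'"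
        using C [OF B(2) _ _ v(2) B'(2), of "B' # \<Delta>"] \<Gamma> w B'(1) by (auto intro: well_formed.intros)
      then have "hastype \<Delta> u (Pi B' D')" using w v(1) unfolding is_type_def by (blast intro: ht_Lam)
      then show ?thesis using B'(4) T(2) unfolding is_type_def by (blast intro: ht_conv conv_sym)
    next
      case False
      then obtain T' where T': "infer f \<Gamma> t = Some T'" "subtype_check f T' T"
        using c by (auto split: gtm.splits option.splits simp del: subtype_check.simps)
      show ?thesis using I [OF T'(1) \<Gamma> t] subtype_check_sound [OF T'(2) _ T(1) _ T(2)] by blast
    qed
  qed
  moreover have "?E (Suc f)"
  proof (intro allI impI)
    fix \<Gamma> \<Delta> T S B D
    assume e: "expose (Suc f) \<Gamma> T = Some (B, D)" and \<Gamma>: "list_all2 (\<leadsto>) \<Gamma> \<Delta>" "well_formed \<Delta>"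
      and T: "T \<leadsto> S" "is_type \<Delta> S"
    show "\<exists>B' C'. B \<leadsto> B' \<and> D \<leadsto> C' \<and> is_type \<Delta> (Pi B' C') \<and> S \<equiv>\<^sub>d Pi B' C'"
    proof (cases "\<exists>B C. T = GPi B C")
      case True
      then have "T = GPi B D" using e by auto
      then obtain B' D' where "S = Pi B' D'" "B \<leadsto> B'" "D \<leadsto> D'" using T(1) by blast
      then show ?thesis using T(2) conv_refl by blast
    next
      case False
      then obtain i where w: "beta f (whnf f T []) = GPi B D" "infer f \<Gamma> (GPi B D) = Some (GUniv i)"
        using e by (auto split: gtm.splits option.splits)
      obtain S1 where S1: "whnf f T [] \<leadsto> S1" "S \<equiv>\<^sub>d S1" using whnf_erases [OF T(1)] by blast
      obtain S2 where S2: "GPi B D \<leadsto> S2" "S1 \<equiv>\<^sub>d S2" using erases_beta [OF S1(1), of f] unfolding w(1) by (elim exE conjE) (rule that)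
      then obtain B' D' where B': "S2 = Pi B' D'" "B \<leadsto> B'" "D \<leadsto> D'" by (blast elim: er_PE)
      \<comment> \<open>This replaces subject reduction: the reduced type is a type because it was
        inferred anew.\<close>
      have "is_type \<Delta> S2" using I [OF w(2) \<Gamma> S2(1)] unfolding is_type_def by auto
      then show ?thesis using B' S1 S2 conv_trans by blast
    qed
  qed
  ultimately show ?case by blast
qed simp

section \<open>From the checker to valid signatures\<close>

lemma is_type_check_sound: "is_type_check f T \<Longrightarrow> T \<leadsto> S \<Longrightarrow> is_type [] S"
  unfolding is_type_check_def is_type_def
  using typing_sound [of f] well_formed.intros(1)
  by (fastforce split: option.splits gtm.splits)

lemma check_sound: "check f [] t T \<Longrightarrow> t \<leadsto> u \<Longrightarrow> T \<leadsto> S \<Longrightarrow> is_type [] S \<Longrightarrow> hastype [] u S"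
  using typing_sound [of f] well_formed.intros(1) by blast

text \<open>Having an erasure packs together that the definition is well typed and that,
  recursively, so is every definition it mentions.\<close>

definition valid :: "'n \<Rightarrow> bool" where
  "valid d \<longleftrightarrow> (\<exists>u. Glob d 0 \<leadsto> u)"

text \<open>Nested \<open>if\<close> rather than conjunction: under weak congruence rules the
  simplifier settles the condition first and evaluates only the branch taken.\<close>

primrec names_valid :: "'n gtm \<Rightarrow> bool" where
  "names_valid (GVar n) = True"
| "names_valid (GLam t) = names_valid t"
| "names_valid (GApp t u) = (if names_valid t then names_valid u else False)"
| "names_valid (GPi t u) = (if names_valid t then names_valid u else False)"
| "names_valid (GUniv i) = True"
| "names_valid (GConst c) = True"
| "names_valid (Glob d s) = valid d"

lemma names_valid_erases: "names_valid t \<Longrightarrow> \<exists>u. t \<leadsto> u"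
proof (induct t)
  case (Glob d s)
  then obtain u where "Glob d 0 \<leadsto> u" by (auto simp: valid_def)
  then show ?case by (rule er_GE) (blast intro: er_G)
qed (auto intro: erases.intros split: if_splits)

primrec quote :: "tm \<Rightarrow> 'n gtm" where
  "quote (Var n) = GVar n"
| "quote (Lam t) = GLam (quote t)"
| "quote (App t u) = GApp (quote t) (quote u)"
| "quote (Pi t u) = GPi (quote t) (quote u)"
| "quote (U i) = GUniv i"
| "quote (Const c) = GConst c"

lemma erases_quote: "quote t \<leadsto> t"
  by (induct t) (auto intro: erases.intros)

definition definition_check :: "nat \<Rightarrow> 'n \<Rightarrow> bool" where
  "definition_check f d =
    (if names_valid (ty d) then if is_type_check f (ty d) then if names_valid (body d)
     then check f [] (body d) (ty d) else False else False else False)"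

text \<open>The declared type may abbreviate by names; it only has to be convertible to the type
  that \<open>const_type\<close> prescribes.\<close>

definition constant_check :: "nat \<Rightarrow> const \<Rightarrow> 'n \<Rightarrow> bool" where
  "constant_check f c d =
    (if const_checked c then if names_valid (ty d) then if is_type_check f (ty d)
     then conv_check f (quote (close_stm (const_type c 0 0))) (ty d) else False else False else False)"

definition entry_check :: "nat \<Rightarrow> 'n \<Rightarrow> bool" where
  "entry_check f d = (case body d of GConst c \<Rightarrow> constant_check f c d | _ \<Rightarrow> definition_check f d)"

lemma valid_definition:
  assumes "definition_check f d"
  shows "valid d"
proof -
  have d: "names_valid (ty d)" "is_type_check f (ty d)" "names_valid (body d)" "check f [] (body d) (ty d)"
    using assms by (simp_all add: definition_check_def split: if_splits)
  obtain u T where "body d \<leadsto> u" "ty d \<leadsto> T" using names_valid_erases d by blast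
  then show ?thesis
    unfolding valid_def using er_G is_type_check_sound check_sound d by blast
qed

lemma valid_constant:
  assumes b: "body d = GConst c" and k: "constant_check f c d"
  shows "valid d"
proof -
  have T: "const_typed c (close_stm (const_type c 0 0))" "names_valid (ty d)" "is_type_check f (ty d)"
    "conv_check f (quote (close_stm (const_type c 0 0))) (ty d)"
    using k by (simp_all add: constant_check_def const_checked_def split: if_splits)
  obtain S where S: "ty d \<leadsto> S" using names_valid_erases T by blast
  have w: "is_type [] S" using is_type_check_sound S T by blast
  have "hastype [] (Const c) S"
    using ht_Const [OF T(1)] conv_check_sound [OF T(4) erases_quote S] w unfolding is_type_def by (blast intro: ht_conv)
  then show ?thesis
    unfolding valid_def using er_G [OF _ S _ w] er_K b by metis
qed

text \<open>The implication is there for its congruence rule: while the remaining entries are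
  simplified, \<open>valid d\<close> is available as a rewrite rule, so later entries may use
  \<open>d\<close>.\<close>

primrec entries_check :: "nat \<Rightarrow> 'n list \<Rightarrow> bool" where
  "entries_check f [] = True"
| "entries_check f (d # ds) = (if entry_check f d then valid d \<longrightarrow> entries_check f ds else False)"

lemma valid_entries: "entries_check f ds \<Longrightarrow> list_all valid ds"
proof (induct ds)
  case (Cons d ds)
  then have e: "entry_check f d" by (simp split: if_splits)
  have "valid d"
  proof (cases "body d")
    case (GConst c)
    then show ?thesis using e valid_constant by (simp add: entry_check_def)
  qed (use e valid_definition in \<open>simp_all add: entry_check_def\<close>)
  then show ?case using Cons by (simp split: if_splits)
qed simp

lemma erases_Glob: "valid d \<Longrightarrow> Glob d 0 \<leadsto> u \<longleftrightarrow> body d \<leadsto> u"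
proof
  assume "valid d"
  then obtain v where v: "Glob d 0 \<leadsto> v" by (auto simp: valid_def)
  have "body d \<leadsto> u'" if "Glob d 0 \<leadsto> u'" for u' using that by (rule er_GE) simp
  then show "Glob d 0 \<leadsto> u \<Longrightarrow> body d \<leadsto> u" and "body d \<leadsto> u \<Longrightarrow> Glob d 0 \<leadsto> u"
    using v erases_det by blast+
qed

text \<open>With \<open>erases_Glob\<close> these decide by rewriting whether a named term unfolds
  literally to a given raw term.\<close>

lemma erases_simps:
  "GVar n \<leadsto> Var m \<longleftrightarrow> n = m"
  "GLam t \<leadsto> Lam u \<longleftrightarrow> t \<leadsto> u"
  "GApp t t' \<leadsto> App u u' \<longleftrightarrow> t \<leadsto> u \<and> t' \<leadsto> u'"
  "GPi t t' \<leadsto> Pi u u' \<longleftrightarrow> t \<leadsto> u \<and> t' \<leadsto> u'"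
  "GUniv i \<leadsto> U j \<longleftrightarrow> i = j"
  "GConst c \<leadsto> Const c' \<longleftrightarrow> c = c'"
  by (auto intro: erases.intros)

lemma valid_inhabits:
  assumes "valid d" and F: "F \<leadsto> T" "names_valid F" "is_type_check f F" "conv_check f (ty d) F"
  shows "\<exists>t. hastype [] t T"
proof -
  obtain u S where u: "ty d \<leadsto> S" "hastype [] u S"
    using assms(1) unfolding valid_def by (auto elim: er_GE)
  have "is_type [] T" using is_type_check_sound F by blast
  then show ?thesis using u conv_check_sound [OF F(4) u(1) F(1)] unfolding is_type_def by (blast intro: ht_conv)
qed

end

section \<open>Surface syntax with named variables\<close>

type_synonym 'n hterm = "nat \<Rightarrow> 'n gtm"

definition hvar :: "nat \<Rightarrow> 'n hterm" where "hvar k = (\<lambda>m. GVar (m - Suc k))"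

definition hlam :: "('n hterm \<Rightarrow> 'n hterm) \<Rightarrow> 'n hterm" (binder "\<Lambda>" 10) where
  "hlam F = (\<lambda>m. GLam (F (hvar m) (Suc m)))"

definition hpi :: "'n hterm \<Rightarrow> ('n hterm \<Rightarrow> 'n hterm) \<Rightarrow> 'n hterm" where
  "hpi B F = (\<lambda>m. GPi (B m) (F (hvar m) (Suc m)))"

definition happ :: "'n hterm \<Rightarrow> 'n hterm \<Rightarrow> 'n hterm" (infixl "$" 200) where
  "t $ u = (\<lambda>m. GApp (t m) (u m))"

definition Ty :: "'n hterm" where "Ty = (\<lambda>m. GUniv 0)"
definition Ty1 :: "'n hterm" where "Ty1 = (\<lambda>m. GUniv (Suc 0))"

syntax
  "_hpi" :: "pttrn \<Rightarrow> 'n hterm \<Rightarrow> 'n hterm \<Rightarrow> 'n hterm" ("(3\<Pi>_:_./ _)" [0, 66, 65] 65)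
translations
  "\<Pi> x:B. C" \<rightleftharpoons> "CONST hpi B (\<lambda>x. C)"

definition harrow :: "'n hterm \<Rightarrow> 'n hterm \<Rightarrow> 'n hterm" (infixr "->" 65) where
  "B -> C = (\<Pi> x:B. C)"

text \<open>\<open>Thm\<close> makes a proof term opaque: comparison uses only its type, which keeps
  proofs from being unfolded. \<open>Def\<close> is for everything that has to compute.\<close>

datatype 'n definiens = Prim const | Def "'n hterm" | Thm "'n hterm"

primrec definiens_body :: "'n definiens \<Rightarrow> 'n gtm" where
  "definiens_body (Prim c) = GConst c"
| "definiens_body (Def t) = t 0"
| "definiens_body (Thm t) = t 0"

primrec definiens_transparent :: "'n definiens \<Rightarrow> bool" where
  "definiens_transparent (Prim c) = True"
| "definiens_transparent (Def t) = True"
| "definiens_transparent (Thm t) = False"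

section \<open>The development in homotopy type theory\<close>

text \<open>The names are spread over nine types because the number of distinctness theorems is
  quadratic in the number of constructors.\<close>

datatype path_name =
    Idt | Refl | PathInd | SigT | Pr | SigRec | Conc | Transp | Inv | Ap | InvConc | ReflConc

datatype level_name =
    Fst | Snd | IsContr | IsProp | IsSet | Fib | IsEquiv | Equiv | HedbergPath | Hedberg | PropSet |
    SigPath | SigPropPath | Happly | FunextAx | Funext | PiProp | ContrProp | IsContrProp |
    IsEquivProp | IsoEquiv | EquivInj

datatype univ_name =
    IdIsEquiv | IdToEquiv | UnivalenceAx | PropExt | HProp | Holds | HoldsProp | IsPropProp | Iff |
    IffProp | PathIff | IffPath | HpropSet | Trunc | Tr | TruncSet | TruncInd | ConnectedInd

datatype finite_name =
    Fin0 | Ind0 | Fin1 | Star | Ind1 | Fin2 | B0 | B1 | Ind2 | Fin5 | E0 | E1 | E2 | E3 | E4 | Ind5 |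
    Exfalso | UnitProp | EmptyProp | Code2 | Encode2 | CodeProp2 | Decode2 | FinSet2 | Code5 |
    Encode5 | CodeProp5 | Decode5 | FinSet5

datatype alt_name =
    Xor | Less | Parity | EquivFun | PermFive | IsEven | AltFive | Perm | PermInj | PermA | PermAinv |
    PermAEquiv | PermAEven | ElemA | PermB | PermBinv | PermBEquiv | PermBEven | ElemB | PermI |
    PermIEquiv | PermIEven | ElemI | PermS

datatype coset_name =
    Reach1 | Step1 | Reach2 | Step2 | Reach3 | Step3 | Cover1 | Cover2 | Cover3 | Fixing | Generation

datatype dep_name =
    DPath | Dconc | Pow0 | Dpow0 | Pow1 | Dpow1 | Pow2 | Dpow2 | Pow3 | Dpow3 | Pow4 | Dpow4 | Pow5 |
    Dpow5 | Apd | Tw | TwConcRefl | TwConc | TwStep | TwPow0 | TwPow1 | TwPow2 | TwPow3 | TwPow4 |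
    TwPow5 | TwOverRefl | TwOver

datatype cell_name =
    XT | PtX | LoopA | LoopB | RelR | RelS | DataR | DataS | IndX | IndXA | IndXB | IndXProp | RecR |
    RecS | RecX | FibMove | MoveA | MoveB | TruncContr | FibInd | FibContr | Transfer | FibPtContr

datatype loop_name =
    ActConc | ActLeft | ActRight | ActPow0 | ActPow1 | ActPow2 | ActPow3 | ActPow4 | ActPow5 | LoopEq |
    LoopOf | PermLoopOf | RelA5R | RelA5S | PermIId | Generates | MapConnected | MapFromLoops |
    ExistsMap | Is1Type | MulLaw | LoopsIsoA5 | IsClassifyingA5 | ConnectedMap | Final |
    StatementType

datatype name = Paths path_name | Levels level_name | Univalence univ_name | Finite finite_name |
    Alternating alt_name | Cosets coset_name | Dependent dep_name | Cells cell_name |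
    Loops loop_name

class has_name = fixes name_of :: "'a \<Rightarrow> name"

instantiation path_name :: has_name begin
definition "name_of = Paths"
instance ..
end

instantiation level_name :: has_name begin
definition "name_of = Levels"
instance ..
end

instantiation univ_name :: has_name begin
definition "name_of = Univalence"
instance ..
end

instantiation finite_name :: has_name begin
definition "name_of = Finite"
instance ..
end

instantiation alt_name :: has_name begin
definition "name_of = Alternating"
instance ..
end

instantiation coset_name :: has_name begin
definition "name_of = Cosets"
instance ..
end

instantiation dep_name :: has_name begin
definition "name_of = Dependent"
instance ..
end

instantiation cell_name :: has_name begin
definition "name_of = Cells"
instance ..
end

instantiation loop_name :: has_name begin
definition "name_of = Loops"
instance ..
end

definition g :: "'a::has_name \<Rightarrow> name hterm" where "g d = (\<lambda>m. Glob (name_of d) 0)"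
text \<open>The same definition one universe higher: identity types of \<open>Ty\<close> and of
  \<open>HProp\<close> live there.\<close>

definition g1 :: "'a::has_name \<Rightarrow> name hterm" where "g1 d = (\<lambda>m. Glob (name_of d) (Suc 0))"

text \<open>
  The type of the theorem over named constants.  It contains beta redexes, for which \<open>infer\<close> fails, only
  inside the closed terms that \<open>Xor\<close>, \<open>Less\<close> and \<open>Parity\<close> name.
\<close>

definition h_contr :: "name hterm \<Rightarrow> name hterm" where
  "h_contr B = g SigT$B$(\<Lambda> x. \<Pi> y:B. g Idt$B$x$y)"
definition h_prop :: "name hterm \<Rightarrow> name hterm" where
  "h_prop B = (\<Pi> x:B. \<Pi> y:B. g Idt$B$x$y)"
definition h_set :: "name hterm \<Rightarrow> name hterm" where
  "h_set B = (\<Pi> x:B. \<Pi> y:B. h_prop (g Idt$B$x$y))"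
definition h_1type :: "name hterm \<Rightarrow> name hterm" where
  "h_1type B = (\<Pi> x:B. \<Pi> y:B. h_set (g Idt$B$x$y))"
definition h_fib :: "name hterm \<Rightarrow> name hterm \<Rightarrow> name hterm \<Rightarrow> name hterm \<Rightarrow> name hterm" where
  "h_fib B C f y = g SigT$B$(\<Lambda> x. g Idt$C$(f$x)$y)"
definition h_is_equiv :: "name hterm \<Rightarrow> name hterm \<Rightarrow> name hterm \<Rightarrow> name hterm" where
  "h_is_equiv B C f = (\<Pi> y:C. h_contr (h_fib B C f y))"
definition h_equiv :: "name hterm \<Rightarrow> name hterm \<Rightarrow> name hterm" where
  "h_equiv B C = g SigT$(B -> C)$(\<Lambda> f. h_is_equiv B C f)"
definition h_fst :: "name hterm \<Rightarrow> (name hterm \<Rightarrow> name hterm) \<Rightarrow> name hterm \<Rightarrow> name hterm" where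
  "h_fst B C z = g SigRec$B$hlam C$(\<Lambda> z. B)$(\<Lambda> x y. x)$z"
definition h_equiv_fun :: "name hterm \<Rightarrow> name hterm \<Rightarrow> name hterm \<Rightarrow> name hterm" where
  "h_equiv_fun B C e = h_fst (B -> C) (\<lambda>f. h_is_equiv B C f) e"
definition h_Sym5 :: "name hterm" where
  "h_Sym5 = h_equiv (g Fin5) (g Fin5)"
definition h_is_even :: "name hterm \<Rightarrow> name hterm" where
  "h_is_even e = g Idt$g Fin2$(g Parity$h_equiv_fun (g Fin5) (g Fin5) e)$g B0"
definition h_A5 :: "name hterm" where
  "h_A5 = g SigT$h_Sym5$(\<Lambda> e. h_is_even e)"
definition h_perm :: "name hterm \<Rightarrow> name hterm" where
  "h_perm x = h_equiv_fun (g Fin5) (g Fin5) (h_fst h_Sym5 h_is_even x)"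
definition h_conc ::
    "name hterm \<Rightarrow> name hterm \<Rightarrow> name hterm \<Rightarrow> name hterm \<Rightarrow> name hterm \<Rightarrow> name hterm \<Rightarrow> name hterm" where
  "h_conc B x y z p q =
     g PathInd$B$(\<Lambda> y z q. g Idt$B$x$y -> g Idt$B$x$z)$(\<Lambda> y p. p)$y$z$q$p"
definition h_loops_iso :: "name hterm \<Rightarrow> name hterm \<Rightarrow> name hterm" where
  "h_loops_iso B b = (let D = g Idt$B$b$b in
     g SigT$(D -> h_A5)$(\<Lambda> h. g SigT$h_is_equiv D h_A5 h$(\<Lambda> e. \<Pi> p:D. \<Pi> q:D.
       g Idt$(g Fin5 -> g Fin5)$h_perm (h$h_conc B b b b p q)$(\<Lambda> x. h_perm (h$p)$(h_perm (h$q)$x)))))"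
definition h_statement :: "name hterm" where
  "h_statement = (\<Pi> B:Ty. \<Pi> b:B.
     g SigT$h_contr (g Trunc$B)$(\<Lambda> x. g SigT$h_1type B$(\<Lambda> y. h_loops_iso B b)) ->
     g SigT$(g XT -> B)$(\<Lambda> f. \<Pi> y:B. h_contr (g Trunc$h_fib (g XT) B f y)))"

type_synonym entry = "name hterm \<times> name definiens"

subsection \<open>Paths\<close>

primrec path_entry :: "path_name \<Rightarrow> entry" where
  "path_entry Idt = (
    \<Pi> A:Ty. A -> A -> Ty,
    Prim CId)"
| "path_entry Refl = (
    \<Pi> A:Ty. \<Pi> x:A. g Idt$A$x$x,
    Prim CRefl)"
| "path_entry PathInd = (
    \<Pi> A:Ty. \<Pi> C:(\<Pi> x:A. \<Pi> y:A. g Idt$A$x$y -> Ty). (\<Pi> x:A. C$x$x$(g Refl$A$x)) -> \<Pi> x:A. \<Pi>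
    y:A. \<Pi> p:g Idt$A$x$y. C$x$y$p,
    Prim CIdInd)"
| "path_entry SigT = (
    \<Pi> A:Ty. (A -> Ty) -> Ty,
    Prim CSig)"
| "path_entry Pr = (
    \<Pi> A:Ty. \<Pi> B:(A -> Ty). \<Pi> a:A. B$a -> g SigT$A$B,
    Prim CPair)"
| "path_entry SigRec = (
    \<Pi> A:Ty. \<Pi> B:(A -> Ty). \<Pi> C:(g SigT$A$B -> Ty). (\<Pi> a:A. \<Pi> b:B$a. C$(g Pr$A$B$a$b)) -> \<Pi>
    z:g SigT$A$B. C$z,
    Prim CSigInd)"
| "path_entry Conc = (
    \<Pi> A:Ty. \<Pi> x:A. \<Pi> y:A. \<Pi> z:A. g Idt$A$x$y -> g Idt$A$y$z -> g Idt$A$x$z,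
    Def (\<Lambda> A x y z p q. g PathInd$A$(\<Lambda> y z _. g Idt$A$x$y -> g Idt$A$x$z)$(\<Lambda> _ p. p)$y$z$q$p))"
| "path_entry Transp = (
    \<Pi> A:Ty. \<Pi> P:(A -> Ty). \<Pi> x:A. \<Pi> y:A. g Idt$A$x$y -> P$x -> P$y,
    Def (\<Lambda> A P x y p. g PathInd$A$(\<Lambda> x y _. P$x -> P$y)$(\<Lambda> _ u. u)$x$y$p))"
| "path_entry Inv = (
    \<Pi> A:Ty. \<Pi> x:A. \<Pi> y:A. g Idt$A$x$y -> g Idt$A$y$x,
    Def (\<Lambda> A x y p. g PathInd$A$(\<Lambda> x y _. g Idt$A$y$x)$(\<Lambda> x. g Refl$A$x)$x$y$p))"
| "path_entry Ap = (
    \<Pi> A:Ty. \<Pi> B:Ty. \<Pi> x:A. \<Pi> y:A. \<Pi> f:(A -> B). g Idt$A$x$y -> g Idt$B$(f$x)$(f$y),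
    Def (\<Lambda> A B x y f p. g PathInd$A$(\<Lambda> x y _. g Idt$B$(f$x)$(f$y))$(\<Lambda> x. g Refl$B$(f$x))$x$y$p))"
| "path_entry InvConc = (
    \<Pi> A:Ty. \<Pi> x:A. \<Pi> y:A. \<Pi> p:g Idt$A$x$y. g Idt$(g Idt$A$y$y)$(g Conc$A$y$x$y$(g Inv$A$x$y$p)$p)$
    (g Refl$A$y),
    Thm (\<Lambda> A x y p. g PathInd$A$(\<Lambda> x y p. g Idt$(g Idt$A$y$y)$(g Conc$A$y$x$y$(g Inv$A$x$y$p)$p)$
    (g Refl$A$y))$(\<Lambda> x. g Refl$(g Idt$A$x$x)$(g Conc$A$x$x$x$(g Inv$A$x$x$(g Refl$A$x))$(g Refl$A$x)))$x$y$
    p))"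
\<comment> \<open>Concatenation recurses on its second path, so a right unit vanishes by computation
  while a left unit takes an induction.\<close>
| "path_entry ReflConc = (
    \<Pi> A:Ty. \<Pi> x:A. \<Pi> y:A. \<Pi> p:g Idt$A$x$y. g Idt$(g Idt$A$x$y)$(g Conc$A$x$x$y$(g Refl$A$x)$p)$p,
    Thm (\<Lambda> A x y p. g PathInd$A$(\<Lambda> x y p. g Idt$(g Idt$A$x$y)$(g Conc$A$x$x$y$(g Refl$A$x)$p)$p)$
    (\<Lambda> x. g Refl$(g Idt$A$x$x)$(g Conc$A$x$x$x$(g Refl$A$x)$(g Refl$A$x)))$x$y$p))"

subsection \<open>Truncation levels\<close>

text \<open>
  \<open>Hedberg\<close>: a type is a set if some reflexive family of propositions \<open>R x y\<close> implies identity, since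
  every path is the composite of the inverse of the image of reflexivity with its own image under
  the resulting constant map.
\<close>

primrec level_entry :: "level_name \<Rightarrow> entry" where
  "level_entry Fst = (
    \<Pi> A:Ty. \<Pi> B:(A -> Ty). g SigT$A$B -> A,
    Def (\<Lambda> A B z. g SigRec$A$B$(\<Lambda> _. A)$(\<Lambda> x _. x)$z))"
| "level_entry Snd = (
    \<Pi> A:Ty. \<Pi> B:(A -> Ty). \<Pi> z:g SigT$A$B. B$(g Fst$A$B$z),
    Def (\<Lambda> A B z. g SigRec$A$B$(\<Lambda> z. B$(g Fst$A$B$z))$(\<Lambda> _ y. y)$z))"
| "level_entry IsContr = (
    Ty -> Ty,
    Def (\<Lambda> A. g SigT$A$(\<Lambda> x. \<Pi> y:A. g Idt$A$x$y)))"
| "level_entry IsProp = (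
    Ty -> Ty,
    Def (\<Lambda> A. \<Pi> x:A. \<Pi> y:A. g Idt$A$x$y))"
| "level_entry IsSet = (
    Ty -> Ty,
    Def (\<Lambda> A. \<Pi> x:A. \<Pi> y:A. g IsProp$(g Idt$A$x$y)))"
| "level_entry Fib = (
    \<Pi> A:Ty. \<Pi> B:Ty. (A -> B) -> B -> Ty,
    Def (\<Lambda> A B f y. g SigT$A$(\<Lambda> x. g Idt$B$(f$x)$y)))"
| "level_entry IsEquiv = (
    \<Pi> A:Ty. \<Pi> B:Ty. (A -> B) -> Ty,
    Def (\<Lambda> A B f. \<Pi> y:B. g IsContr$(g Fib$A$B$f$y)))"
| "level_entry Equiv = (
    Ty -> Ty -> Ty,
    Def (\<Lambda> A B. g SigT$(A -> B)$(\<Lambda> f. g IsEquiv$A$B$f)))"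
| "level_entry HedbergPath = (
    \<Pi> A:Ty. \<Pi> R:(A -> A -> Ty). \<Pi> r:(\<Pi> x:A. \<Pi> y:A. g Idt$A$x$y -> R$x$y). \<Pi> k:(\<Pi> x:A. \<Pi>
    y:A. R$x$y -> g Idt$A$x$y). \<Pi> x:A. \<Pi> y:A. \<Pi> p:g Idt$A$x$y. g Idt$(g Idt$A$x$y)$(g Conc$A$x$x$y$
    (g Inv$A$x$x$(k$x$x$(r$x$x$(g Refl$A$x))))$(k$x$y$(r$x$y$p)))$p,
    Thm (\<Lambda> A _ r k x y p. g PathInd$A$(\<Lambda> x y p. g Idt$(g Idt$A$x$y)$(g Conc$A$x$x$y$(g Inv$A$x$x$(k$x$x$
    (r$x$x$(g Refl$A$x))))$(k$x$y$(r$x$y$p)))$p)$(\<Lambda> x. g InvConc$A$x$x$(k$x$x$(r$x$x$(g Refl$A$x))))$x$y$p))"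
| "level_entry Hedberg = (
    \<Pi> A:Ty. \<Pi> R:(A -> A -> Ty). (\<Pi> x:A. \<Pi> y:A. g IsProp$(R$x$y)) -> (\<Pi> x:A. \<Pi> y:A. g Idt$A$x$y
    -> R$x$y) -> (\<Pi> x:A. \<Pi> y:A. R$x$y -> g Idt$A$x$y) -> g IsSet$A,
    Thm (\<Lambda> A R h r k x y p q. g Conc$(g Idt$A$x$y)$p$(g Conc$A$x$x$y$(g Inv$A$x$x$(k$x$x$(r$x$x$(g Refl$A$x))))$
    (k$x$y$(r$x$y$p)))$q$(g Inv$(g Idt$A$x$y)$(g Conc$A$x$x$y$(g Inv$A$x$x$(k$x$x$(r$x$x$(g Refl$A$x))))$(k$x$y$(r$
    x$y$p)))$p$(g HedbergPath$A$R$r$k$x$y$p))$(g Conc$(g Idt$A$x$y)$(g Conc$A$x$x$y$(g Inv$A$x$x$(k$x$x$(r$x$x$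
    (g Refl$A$x))))$(k$x$y$(r$x$y$p)))$(g Conc$A$x$x$y$(g Inv$A$x$x$(k$x$x$(r$x$x$(g Refl$A$x))))$(k$x$y$(r$x$y$
    q)))$q$(g Ap$(R$x$y)$(g Idt$A$x$y)$(r$x$y$p)$(r$x$y$q)$(\<Lambda> s. g Conc$A$x$x$y$(g Inv$A$x$x$(k$x$x$(r$x$x$
    (g Refl$A$x))))$(k$x$y$s))$(h$x$y$(r$x$y$p)$(r$x$y$q)))$(g HedbergPath$A$R$r$k$x$y$q))))"
\<comment> \<open>Hedberg's argument with the constant family \<open>A\<close>.\<close>
| "level_entry PropSet = (
    \<Pi> A:Ty. g IsProp$A -> g IsSet$A,
    Thm (\<Lambda> A h. g Hedberg$A$(\<Lambda> _ _. A)$(\<Lambda> _ _. h)$(\<Lambda> x _ _. x)$(\<Lambda> x y _. h$x$y)))"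
| "level_entry SigPath = (
    \<Pi> A:Ty. \<Pi> B:(A -> Ty). (\<Pi> x:A. g IsProp$(B$x)) -> \<Pi> x:A. \<Pi> y:A. g Idt$A$x$y -> \<Pi> u:B$x.
    \<Pi> v:B$y. g Idt$(g SigT$A$B)$(g Pr$A$B$x$u)$(g Pr$A$B$y$v),
    Thm (\<Lambda> A B h x y p. g PathInd$A$(\<Lambda> x y _. \<Pi> u:B$x. \<Pi> v:B$y. g Idt$(g SigT$A$B)$(g Pr$A$B$x$
    u)$(g Pr$A$B$y$v))$(\<Lambda> x u v. g Ap$(B$x)$(g SigT$A$B)$u$v$(\<Lambda> t. g Pr$A$B$x$t)$(h$x$u$v))$x$y$p))"
| "level_entry SigPropPath = (
    \<Pi> A:Ty. \<Pi> B:(A -> Ty). (\<Pi> x:A. g IsProp$(B$x)) -> \<Pi> z:g SigT$A$B. \<Pi> w:g SigT$A$B. g Idt$A$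
    (g Fst$A$B$z)$(g Fst$A$B$w) -> g Idt$(g SigT$A$B)$z$w,
    Thm (\<Lambda> A B h z w. g SigRec$A$B$(\<Lambda> z. g Idt$A$(g Fst$A$B$z)$(g Fst$A$B$w) -> g Idt$(g SigT$A$B)$z$w)$
    (\<Lambda> x u. g SigRec$A$B$(\<Lambda> w. g Idt$A$x$(g Fst$A$B$w) -> g Idt$(g SigT$A$B)$(g Pr$A$B$x$u)$w)$
    (\<Lambda> y v p. g SigPath$A$B$h$x$y$p$u$v)$w)$z))"
| "level_entry Happly = (
    \<Pi> A:Ty. \<Pi> B:(A -> Ty). \<Pi> f:(\<Pi> x:A. B$x). \<Pi> g':(\<Pi> x:A. B$x). g Idt$(\<Pi> x:A. B$x)$f$g' ->
    \<Pi> x:A. g Idt$(B$x)$(f$x)$(g'$x),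
    Def (\<Lambda> A B f g' p. g PathInd$(\<Pi> x:A. B$x)$(\<Lambda> f g' _. \<Pi> x:A. g Idt$(B$x)$(f$x)$(g'$x))$
    (\<Lambda> f x. g Refl$(B$x)$(f$x))$f$g'$p))"
| "level_entry FunextAx = (
    \<Pi> A:Ty. \<Pi> B:(A -> Ty). \<Pi> f:(\<Pi> x:A. B$x). \<Pi> g':(\<Pi> x:A. B$x). g IsEquiv$(g Idt$(\<Pi> x:A. B$
    x)$f$g')$(\<Pi> x:A. g Idt$(B$x)$(f$x)$(g'$x))$(\<Lambda> p. g Happly$A$B$f$g'$p),
    Prim CFunext)"
\<comment> \<open>The axiom states that \<open>Happly\<close> is an equivalence; the path is the
  first component of the centre of the fibre over \<open>h\<close>.\<close>
| "level_entry Funext = (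
    \<Pi> A:Ty. \<Pi> B:(A -> Ty). \<Pi> f:(\<Pi> x:A. B$x). \<Pi> g':(\<Pi> x:A. B$x). (\<Pi> x:A. g Idt$(B$x)$(f$x)$
    (g'$x)) -> g Idt$(\<Pi> x:A. B$x)$f$g',
    Thm (\<Lambda> A B f g' h. g Fst$(g Idt$(\<Pi> x:A. B$x)$f$g')$(\<Lambda> x. g Idt$(\<Pi> x:A. g Idt$(B$x)$(f$x)$
    (g'$x))$(g Happly$A$B$f$g'$x)$h)$(g Fst$(g SigT$(g Idt$(\<Pi> x:A. B$x)$f$g')$(\<Lambda> x. g Idt$(\<Pi> x:A.
    g Idt$(B$x)$(f$x)$(g'$x))$(g Happly$A$B$f$g'$x)$h))$(\<Lambda> x. \<Pi> y:g Fib$(g Idt$(\<Pi> x:A. B$x)$f$g')$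
    (\<Pi> x:A. g Idt$(B$x)$(f$x)$(g'$x))$(\<Lambda> p. g Happly$A$B$f$g'$p)$h. g Idt$(g Fib$(g Idt$(\<Pi> x:A. B$
    x)$f$g')$(\<Pi> x:A. g Idt$(B$x)$(f$x)$(g'$x))$(\<Lambda> p. g Happly$A$B$f$g'$p)$h)$x$y)$(g FunextAx$A$B$f$g'$
    h))))"
| "level_entry PiProp = (
    \<Pi> A:Ty. \<Pi> B:(A -> Ty). (\<Pi> x:A. g IsProp$(B$x)) -> g IsProp$(\<Pi> x:A. B$x),
    Thm (\<Lambda> A B h f g'. g Funext$A$B$f$g'$(\<Lambda> x. h$x$(f$x)$(g'$x))))"
| "level_entry ContrProp = (
    \<Pi> A:Ty. g IsContr$A -> g IsProp$A,
    Thm (\<Lambda> A c x y. g Conc$A$x$(g Fst$A$(\<Lambda> x. \<Pi> y:A. g Idt$A$x$y)$c)$y$(g Inv$A$(g Fst$A$(\<Lambda>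
    x. \<Pi> y:A. g Idt$A$x$y)$c)$x$(g Snd$A$(\<Lambda> x. \<Pi> y:A. g Idt$A$x$y)$c$x))$(g Snd$A$(\<Lambda> x.
    \<Pi> y:A. g Idt$A$x$y)$c$y)))"
\<comment> \<open>One of the two given contractions makes \<open>A\<close> a proposition, hence a
  set, so the contracting homotopies agree.\<close>
| "level_entry IsContrProp = (
    \<Pi> A:Ty. g IsProp$(g IsContr$A),
    Thm (\<Lambda> A c d. g SigPropPath$A$(\<Lambda> x. \<Pi> y:A. g Idt$A$x$y)$(\<Lambda> x. g PiProp$A$(\<Lambda> y.
    g Idt$A$x$y)$(\<Lambda> y. g PropSet$A$(g ContrProp$A$c)$x$y))$c$d$(g Snd$A$(\<Lambda> x. \<Pi> y:A. g Idt$A$x$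
    y)$c$(g Fst$A$(\<Lambda> x. \<Pi> y:A. g Idt$A$x$y)$d))))"
| "level_entry IsEquivProp = (
    \<Pi> A:Ty. \<Pi> B:Ty. \<Pi> f:(A -> B). g IsProp$(g IsEquiv$A$B$f),
    Thm (\<Lambda> A B f. g PiProp$B$(\<Lambda> y. g IsContr$(g Fib$A$B$f$y))$(\<Lambda> y. g IsContrProp$(g Fib$A$B$f$
    y))))"
\<comment> \<open>In a set the path component of a fibre is unique, so a two-sided inverse suffices
  without the triangle coherence of an adjoint equivalence.\<close>
| "level_entry IsoEquiv = (
    \<Pi> A:Ty. \<Pi> B:Ty. \<Pi> f:(A -> B). \<Pi> g':(B -> A). (\<Pi> x:A. g Idt$A$(g'$(f$x))$x) -> (\<Pi> y:B. g Idt$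
    B$(f$(g'$y))$y) -> g IsSet$B -> g IsEquiv$A$B$f,
    Thm (\<Lambda> A B f g' i j h y. g Pr$(g Fib$A$B$f$y)$(\<Lambda> x. \<Pi> y2:g Fib$A$B$f$y. g Idt$(g Fib$A$B$f$y)$x$
    y2)$(g Pr$A$(\<Lambda> x. g Idt$B$(f$x)$y)$(g'$y)$(j$y))$(\<Lambda> w. g SigPropPath$A$(\<Lambda> x. g Idt$B$(f$
    x)$y)$(\<Lambda> x. h$(f$x)$y)$(g Pr$A$(\<Lambda> x. g Idt$B$(f$x)$y)$(g'$y)$(j$y))$w$(g Conc$A$(g Fst$A$
    (\<Lambda> x. g Idt$B$(f$x)$y)$(g Pr$A$(\<Lambda> x. g Idt$B$(f$x)$y)$(g'$y)$(j$y)))$(g'$(f$(g Fst$A$(\<Lambda>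
    x. g Idt$B$(f$x)$y)$w)))$(g Fst$A$(\<Lambda> x. g Idt$B$(f$x)$y)$w)$(g Ap$B$A$y$(f$(g Fst$A$(\<Lambda> x. g Idt$
    B$(f$x)$y)$w))$g'$(g Inv$B$(f$(g Fst$A$(\<Lambda> x. g Idt$B$(f$x)$y)$w))$y$(g Snd$A$(\<Lambda> x. g Idt$B$(f$
    x)$y)$w)))$(i$(g Fst$A$(\<Lambda> x. g Idt$B$(f$x)$y)$w))))))"
\<comment> \<open>Both \<open>x\<close> and \<open>y\<close> are points of the contractible fibre
  over \<open>f$y\<close>.\<close>
| "level_entry EquivInj = (
    \<Pi> A:Ty. \<Pi> B:Ty. \<Pi> f:(A -> B). g IsEquiv$A$B$f -> \<Pi> x:A. \<Pi> y:A. g Idt$B$(f$x)$(f$y) -> g Idt$A$x$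
    y,
    Thm (\<Lambda> A B f e x y p. g Ap$(g SigT$A$(\<Lambda> x. g Idt$B$(f$x)$(f$y)))$A$(g Pr$A$(\<Lambda> x. g Idt$B$(f$
    x)$(f$y))$x$p)$(g Pr$A$(\<Lambda> x. g Idt$B$(f$x)$(f$y))$y$(g Refl$B$(f$y)))$(g Fst$A$(\<Lambda> x. g Idt$B$(f$
    x)$(f$y)))$(g ContrProp$(g SigT$A$(\<Lambda> x. g Idt$B$(f$x)$(f$y)))$(e$(f$y))$(g Pr$A$(\<Lambda> x. g Idt$B$
    (f$x)$(f$y))$x$p)$(g Pr$A$(\<Lambda> x. g Idt$B$(f$x)$(f$y))$y$(g Refl$B$(f$y))))))"

subsection \<open>Propositional extensionality\<close>

text \<open>
  Only set truncations are available, so connectedness yields an equality \<open>|b| = |y|\<close> in a set.  It is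
  used by extending a family of propositions to the truncation, with values in the set \<open>HProp\<close>.
\<close>

primrec univ_entry :: "univ_name \<Rightarrow> entry" where
  "univ_entry IdIsEquiv = (
    \<Pi> A:Ty. g IsEquiv$A$A$(\<Lambda> x. x),
    Def (\<Lambda> A y. g Pr$(g Fib$A$A$(\<Lambda> x. x)$y)$(\<Lambda> x. \<Pi> y2:g Fib$A$A$(\<Lambda> x. x)$y. g Idt$
    (g Fib$A$A$(\<Lambda> x. x)$y)$x$y2)$(g Pr$A$(\<Lambda> x. g Idt$A$x$y)$y$(g Refl$A$y))$(\<Lambda> w. g SigRec$
    A$(\<Lambda> x. g Idt$A$x$y)$(\<Lambda> w. g Idt$(g Fib$A$A$(\<Lambda> x. x)$y)$(g Pr$A$(\<Lambda> x. g Idt$A$x$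
    y)$y$(g Refl$A$y))$w)$(\<Lambda> x q. g PathInd$A$(\<Lambda> x y q. g Idt$(g Fib$A$A$(\<Lambda> x. x)$y)$(g Pr$
    A$(\<Lambda> x. g Idt$A$x$y)$y$(g Refl$A$y))$(g Pr$A$(\<Lambda> x. g Idt$A$x$y)$x$q))$(\<Lambda> x. g Refl$
    (g Fib$A$A$(\<Lambda> x. x)$x)$(g Pr$A$(\<Lambda> x2. g Idt$A$x2$x)$x$(g Refl$A$x)))$x$y$q)$w)))"
| "univ_entry IdToEquiv = (
    \<Pi> A:Ty. \<Pi> B:Ty. g1 Idt$Ty$A$B -> g Equiv$A$B,
    Def (\<Lambda> A B p. g1 PathInd$Ty$(\<Lambda> A B _. g Equiv$A$B)$(\<Lambda> A. g Pr$(A -> A)$(\<Lambda> f.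
    g IsEquiv$A$A$f)$(\<Lambda> x. x)$(g IdIsEquiv$A))$A$B$p))"
| "univ_entry UnivalenceAx = (
    \<Pi> A:Ty. \<Pi> B:Ty. g1 IsEquiv$(g1 Idt$Ty$A$B)$(g Equiv$A$B)$(\<Lambda> p. g IdToEquiv$A$B$p),
    Prim CUnivalence)"
| "univ_entry PropExt = (
    \<Pi> A:Ty. \<Pi> B:Ty. g IsProp$A -> g IsProp$B -> (A -> B) -> (B -> A) -> g1 Idt$Ty$A$B,
    Thm (\<Lambda> A B h k f g'. g1 Fst$(g1 Idt$Ty$A$B)$(\<Lambda> x. g1 Idt$(g Equiv$A$B)$(g IdToEquiv$A$B$x)$(g Pr$(A
    -> B)$(\<Lambda> f. g IsEquiv$A$B$f)$f$(g IsoEquiv$A$B$f$g'$(\<Lambda> x. h$(g'$(f$x))$x)$(\<Lambda> y. k$(f$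
    (g'$y))$y)$(g PropSet$B$k))))$(g1 Fst$(g1 SigT$(g1 Idt$Ty$A$B)$(\<Lambda> x. g1 Idt$(g Equiv$A$B)$(g IdToEquiv$
    A$B$x)$(g Pr$(A -> B)$(\<Lambda> f. g IsEquiv$A$B$f)$f$(g IsoEquiv$A$B$f$g'$(\<Lambda> x. h$(g'$(f$x))$x)$
    (\<Lambda> y. k$(f$(g'$y))$y)$(g PropSet$B$k)))))$(\<Lambda> x. \<Pi> y:g1 Fib$(g1 Idt$Ty$A$B)$(g Equiv$A$B)$
    (\<Lambda> p. g IdToEquiv$A$B$p)$(g Pr$(A -> B)$(\<Lambda> f. g IsEquiv$A$B$f)$f$(g IsoEquiv$A$B$f$g'$
    (\<Lambda> x. h$(g'$(f$x))$x)$(\<Lambda> y. k$(f$(g'$y))$y)$(g PropSet$B$k))). g1 Idt$(g1 Fib$(g1 Idt$Ty$A$B)$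
    (g Equiv$A$B)$(\<Lambda> p. g IdToEquiv$A$B$p)$(g Pr$(A -> B)$(\<Lambda> f. g IsEquiv$A$B$f)$f$(g IsoEquiv$A$B$
    f$g'$(\<Lambda> x. h$(g'$(f$x))$x)$(\<Lambda> y. k$(f$(g'$y))$y)$(g PropSet$B$k))))$x$y)$(g UnivalenceAx$A$B$
    (g Pr$(A -> B)$(\<Lambda> f. g IsEquiv$A$B$f)$f$(g IsoEquiv$A$B$f$g'$(\<Lambda> x. h$(g'$(f$x))$x)$(\<Lambda>
    y. k$(f$(g'$y))$y)$(g PropSet$B$k)))))))"
| "univ_entry HProp = (
    Ty1,
    Def (g1 SigT$Ty$(\<Lambda> A. g IsProp$A)))"
| "univ_entry Holds = (
    g HProp -> Ty,
    Def (\<Lambda> X. g1 Fst$Ty$(\<Lambda> A. g IsProp$A)$X))"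
| "univ_entry HoldsProp = (
    \<Pi> X:g HProp. g IsProp$(g Holds$X),
    Def (\<Lambda> X. g1 Snd$Ty$(\<Lambda> A. g IsProp$A)$X))"
| "univ_entry IsPropProp = (
    \<Pi> A:Ty. g IsProp$(g IsProp$A),
    Thm (\<Lambda> A h. g PiProp$A$(\<Lambda> x. \<Pi> y:A. g Idt$A$x$y)$(\<Lambda> x. g PiProp$A$(\<Lambda> y. g Idt$A$
    x$y)$(\<Lambda> y. g PropSet$A$h$x$y))$h))"
| "univ_entry Iff = (
    g HProp -> g HProp -> Ty,
    Def (\<Lambda> X Y. g SigT$(g Holds$X -> g Holds$Y)$(\<Lambda> _. g Holds$Y -> g Holds$X)))"
| "univ_entry IffProp = (
    \<Pi> X:g HProp. \<Pi> Y:g HProp. g IsProp$(g Iff$X$Y),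
    Thm (\<Lambda> X Y z w. g SigPropPath$(g Holds$X -> g Holds$Y)$(\<Lambda> _. g Holds$Y -> g Holds$X)$(\<Lambda> _.
    g PiProp$(g Holds$Y)$(\<Lambda> _. g Holds$X)$(\<Lambda> _. g HoldsProp$X))$z$w$(g PiProp$(g Holds$X)$
    (\<Lambda> _. g Holds$Y)$(\<Lambda> _. g HoldsProp$Y)$(g Fst$(g Holds$X -> g Holds$Y)$(\<Lambda> _. g Holds$Y
    -> g Holds$X)$z)$(g Fst$(g Holds$X -> g Holds$Y)$(\<Lambda> _. g Holds$Y -> g Holds$X)$w))))"
| "univ_entry PathIff = (
    \<Pi> X:g HProp. \<Pi> Y:g HProp. g1 Idt$g HProp$X$Y -> g Iff$X$Y,
    Thm (\<Lambda> X Y p. g Pr$(g Holds$X -> g Holds$Y)$(\<Lambda> _. g Holds$Y -> g Holds$X)$(g1 Transp$g HProp$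
    (\<Lambda> Z. g Holds$Z)$X$Y$p)$(g1 Transp$g HProp$(\<Lambda> Z. g Holds$Z)$Y$X$(g1 Inv$g HProp$X$Y$p))))"
| "univ_entry IffPath = (
    \<Pi> X:g HProp. \<Pi> Y:g HProp. g Iff$X$Y -> g1 Idt$g HProp$X$Y,
    Thm (\<Lambda> X Y z. g1 SigPropPath$Ty$(\<Lambda> A. g IsProp$A)$(\<Lambda> A. g IsPropProp$A)$X$Y$(g PropExt$
    (g1 Fst$Ty$(\<Lambda> A. g IsProp$A)$X)$(g1 Fst$Ty$(\<Lambda> A. g IsProp$A)$Y)$(g HoldsProp$X)$(g HoldsProp$Y)$
    (g Fst$(g1 Fst$Ty$(\<Lambda> A. g IsProp$A)$X -> g1 Fst$Ty$(\<Lambda> A. g IsProp$A)$Y)$(\<Lambda> _. g Holds$Y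
    -> g Holds$X)$z)$(g Snd$(g Holds$X -> g Holds$Y)$(\<Lambda> _. g Holds$Y -> g Holds$X)$z))))"
\<comment> \<open>Hedberg's argument with logical equivalence as the family of propositions;
  \<open>PropExt\<close> turns it back into a path.\<close>
| "univ_entry HpropSet = (
    g1 IsSet$g HProp,
    Thm (g1 Hedberg$g HProp$(\<Lambda> X Y. g Iff$X$Y)$(\<Lambda> X Y. g IffProp$X$Y)$(\<Lambda> X Y. g PathIff$X$Y)$
    (\<Lambda> X Y. g IffPath$X$Y)))"
| "univ_entry Trunc = (
    Ty -> Ty,
    Prim CTrunc)"
| "univ_entry Tr = (
    \<Pi> A:Ty. A -> g Trunc$A,
    Prim CTr)"
| "univ_entry TruncSet = (
    \<Pi> A:Ty. g IsSet$(g Trunc$A),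
    Prim CTruncSet)"
| "univ_entry TruncInd = (
    \<Pi> A:Ty. \<Pi> P:(g Trunc$A -> Ty). (\<Pi> z:g Trunc$A. g IsSet$(P$z)) -> (\<Pi> a:A. P$(g Tr$A$a)) -> \<Pi>
    z:g Trunc$A. P$z,
    Prim CTruncInd)"
\<comment> \<open>The extended family computes on \<open>Tr\<close>, so transport along the path
  from \<open>Tr$B$b\<close> to \<open>Tr$B$y\<close> goes from \<open>Q$b\<close> to
  \<open>Q$y\<close> up to definitional equality.\<close>
| "univ_entry ConnectedInd = (
    \<Pi> B:Ty. \<Pi> b:B. g IsContr$(g Trunc$B) -> \<Pi> Q:(B -> Ty). (\<Pi> y:B. g IsProp$(Q$y)) -> Q$b -> \<Pi> y:B.
    Q$y,
    Thm (\<Lambda> B b c Q h u y. g1 Transp$(g Trunc$B)$(\<Lambda> Z. g Holds$(g1 TruncInd$B$(\<Lambda> _. g HProp)$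
    (\<Lambda> _. g HpropSet)$(\<Lambda> y. g1 Pr$Ty$(\<Lambda> A. g IsProp$A)$(Q$y)$(h$y))$Z))$(g Tr$B$b)$(g Tr$B$
    y)$(g ContrProp$(g Trunc$B)$c$(g Tr$B$b)$(g Tr$B$y))$u))"

subsection \<open>Finite types\<close>

primrec finite_entry :: "finite_name \<Rightarrow> entry" where
  "finite_entry Fin0 = (
    Ty,
    Prim (CFin 0))"
| "finite_entry Ind0 = (
    \<Pi> C:(g Fin0 -> Ty). \<Pi> x:g Fin0. C$x,
    Prim (CFinInd 0))"
| "finite_entry Fin1 = (
    Ty,
    Prim (CFin 1))"
| "finite_entry Star = (
    g Fin1,
    Prim (CEl 1 0))"
| "finite_entry Ind1 = (
    \<Pi> C:(g Fin1 -> Ty). C$g Star -> \<Pi> x:g Fin1. C$x,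
    Prim (CFinInd 1))"
| "finite_entry Fin2 = (
    Ty,
    Prim (CFin 2))"
| "finite_entry B0 = (
    g Fin2,
    Prim (CEl 2 0))"
| "finite_entry B1 = (
    g Fin2,
    Prim (CEl 2 1))"
| "finite_entry Ind2 = (
    \<Pi> C:(g Fin2 -> Ty). C$g B0 -> C$g B1 -> \<Pi> x:g Fin2. C$x,
    Prim (CFinInd 2))"
| "finite_entry Fin5 = (
    Ty,
    Prim (CFin 5))"
| "finite_entry E0 = (
    g Fin5,
    Prim (CEl 5 0))"
| "finite_entry E1 = (
    g Fin5,
    Prim (CEl 5 1))"
| "finite_entry E2 = (
    g Fin5,
    Prim (CEl 5 2))"
| "finite_entry E3 = (
    g Fin5,
    Prim (CEl 5 3))"
| "finite_entry E4 = (
    g Fin5,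
    Prim (CEl 5 4))"
| "finite_entry Ind5 = (
    \<Pi> C:(g Fin5 -> Ty). C$g E0 -> C$g E1 -> C$g E2 -> C$g E3 -> C$g E4 -> \<Pi> x:g Fin5. C$x,
    Prim (CFinInd 5))"
| "finite_entry Exfalso = (
    \<Pi> A:Ty. g Fin0 -> A,
    Def (\<Lambda> A x. g Ind0$(\<Lambda> _. A)$x))"
| "finite_entry UnitProp = (
    g IsProp$g Fin1,
    Thm (\<Lambda> x y. g Ind1$(\<Lambda> x. g Idt$g Fin1$x$y)$(g Ind1$(\<Lambda> y. g Idt$g Fin1$g Star$y)$(g Refl$
    g Fin1$g Star)$y)$x))"
| "finite_entry EmptyProp = (
    g IsProp$g Fin0,
    Thm (\<Lambda> x y. g Exfalso$(g Idt$g Fin0$x$y)$x))"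
\<comment> \<open>Encode-decode: the code is the unit type on the diagonal and empty elsewhere.
  Elimination into \<open>Ty\<close> happens one universe up, hence \<open>g1\<close>.\<close>
| "finite_entry Code2 = (
    g Fin2 -> g Fin2 -> Ty,
    Def (\<Lambda> x y. g1 Ind2$(\<Lambda> _. Ty)$(g1 Ind2$(\<Lambda> _. Ty)$g Fin1$g Fin0$y)$(g1 Ind2$(\<Lambda> _.
    Ty)$g Fin0$g Fin1$y)$x))"
| "finite_entry Encode2 = (
    \<Pi> x:g Fin2. \<Pi> y:g Fin2. g Idt$g Fin2$x$y -> g Code2$x$y,
    Thm (\<Lambda> x y p. g PathInd$g Fin2$(\<Lambda> x y _. g Code2$x$y)$(\<Lambda> x. g Ind2$(\<Lambda> x. g Code2$x$
    x)$g Star$g Star$x)$x$y$p))"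
| "finite_entry CodeProp2 = (
    \<Pi> x:g Fin2. \<Pi> y:g Fin2. g IsProp$(g Code2$x$y),
    Thm (\<Lambda> x y. g Ind2$(\<Lambda> x. g IsProp$(g Code2$x$y))$(g Ind2$(\<Lambda> y. g IsProp$(g Code2$g B0$y))$
    g UnitProp$g EmptyProp$y)$(g Ind2$(\<Lambda> y. g IsProp$(g Code2$g B1$y))$g EmptyProp$g UnitProp$y)$x))"
| "finite_entry Decode2 = (
    \<Pi> x:g Fin2. \<Pi> y:g Fin2. g Code2$x$y -> g Idt$g Fin2$x$y,
    Thm (\<Lambda> x y. g Ind2$(\<Lambda> x. g Code2$x$y -> g Idt$g Fin2$x$y)$(g Ind2$(\<Lambda> y. g Code2$g B0$y ->
    g Idt$g Fin2$g B0$y)$(\<Lambda> _. g Refl$g Fin2$g B0)$(\<Lambda> c. g Exfalso$(g Idt$g Fin2$g B0$g B1)$c)$y)$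
    (g Ind2$(\<Lambda> y. g Code2$g B1$y -> g Idt$g Fin2$g B1$y)$(\<Lambda> c. g Exfalso$(g Idt$g Fin2$g B1$g B0)$
    c)$(\<Lambda> _. g Refl$g Fin2$g B1)$y)$x))"
| "finite_entry FinSet2 = (
    g IsSet$g Fin2,
    Thm (g Hedberg$g Fin2$g Code2$g CodeProp2$g Encode2$g Decode2))"
| "finite_entry Code5 = (
    g Fin5 -> g Fin5 -> Ty,
    Def (\<Lambda> x y. g1 Ind5$(\<Lambda> _. Ty)$(g1 Ind5$(\<Lambda> _. Ty)$g Fin1$g Fin0$g Fin0$g Fin0$g Fin0$y)$
    (g1 Ind5$(\<Lambda> _. Ty)$g Fin0$g Fin1$g Fin0$g Fin0$g Fin0$y)$(g1 Ind5$(\<Lambda> _. Ty)$g Fin0$g Fin0$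
    g Fin1$g Fin0$g Fin0$y)$(g1 Ind5$(\<Lambda> _. Ty)$g Fin0$g Fin0$g Fin0$g Fin1$g Fin0$y)$(g1 Ind5$(\<Lambda> _.
    Ty)$g Fin0$g Fin0$g Fin0$g Fin0$g Fin1$y)$x))"
| "finite_entry Encode5 = (
    \<Pi> x:g Fin5. \<Pi> y:g Fin5. g Idt$g Fin5$x$y -> g Code5$x$y,
    Thm (\<Lambda> x y p. g PathInd$g Fin5$(\<Lambda> x y _. g Code5$x$y)$(\<Lambda> x. g Ind5$(\<Lambda> x. g Code5$x$
    x)$g Star$g Star$g Star$g Star$g Star$x)$x$y$p))"
| "finite_entry CodeProp5 = (
    \<Pi> x:g Fin5. \<Pi> y:g Fin5. g IsProp$(g Code5$x$y),
    Thm (\<Lambda> x y. g Ind5$(\<Lambda> x. g IsProp$(g Code5$x$y))$(g Ind5$(\<Lambda> y. g IsProp$(g Code5$g E0$y))$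
    g UnitProp$g EmptyProp$g EmptyProp$g EmptyProp$g EmptyProp$y)$(g Ind5$(\<Lambda> y. g IsProp$(g Code5$g E1$y))$
    g EmptyProp$g UnitProp$g EmptyProp$g EmptyProp$g EmptyProp$y)$(g Ind5$(\<Lambda> y. g IsProp$(g Code5$g E2$y))$
    g EmptyProp$g EmptyProp$g UnitProp$g EmptyProp$g EmptyProp$y)$(g Ind5$(\<Lambda> y. g IsProp$(g Code5$g E3$y))$
    g EmptyProp$g EmptyProp$g EmptyProp$g UnitProp$g EmptyProp$y)$(g Ind5$(\<Lambda> y. g IsProp$(g Code5$g E4$y))$
    g EmptyProp$g EmptyProp$g EmptyProp$g EmptyProp$g UnitProp$y)$x))"
| "finite_entry Decode5 = (
    \<Pi> x:g Fin5. \<Pi> y:g Fin5. g Code5$x$y -> g Idt$g Fin5$x$y,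
    Thm (\<Lambda> x y. g Ind5$(\<Lambda> x. g Code5$x$y -> g Idt$g Fin5$x$y)$(g Ind5$(\<Lambda> y. g Code5$g E0$y ->
    g Idt$g Fin5$g E0$y)$(\<Lambda> _. g Refl$g Fin5$g E0)$(\<Lambda> c. g Exfalso$(g Idt$g Fin5$g E0$g E1)$c)$
    (\<Lambda> c. g Exfalso$(g Idt$g Fin5$g E0$g E2)$c)$(\<Lambda> c. g Exfalso$(g Idt$g Fin5$g E0$g E3)$c)$
    (\<Lambda> c. g Exfalso$(g Idt$g Fin5$g E0$g E4)$c)$y)$(g Ind5$(\<Lambda> y. g Code5$g E1$y -> g Idt$g Fin5$
    g E1$y)$(\<Lambda> c. g Exfalso$(g Idt$g Fin5$g E1$g E0)$c)$(\<Lambda> _. g Refl$g Fin5$g E1)$(\<Lambda> c.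
    g Exfalso$(g Idt$g Fin5$g E1$g E2)$c)$(\<Lambda> c. g Exfalso$(g Idt$g Fin5$g E1$g E3)$c)$(\<Lambda> c.
    g Exfalso$(g Idt$g Fin5$g E1$g E4)$c)$y)$(g Ind5$(\<Lambda> y. g Code5$g E2$y -> g Idt$g Fin5$g E2$y)$
    (\<Lambda> c. g Exfalso$(g Idt$g Fin5$g E2$g E0)$c)$(\<Lambda> c. g Exfalso$(g Idt$g Fin5$g E2$g E1)$c)$
    (\<Lambda> _. g Refl$g Fin5$g E2)$(\<Lambda> c. g Exfalso$(g Idt$g Fin5$g E2$g E3)$c)$(\<Lambda> c. g Exfalso$
    (g Idt$g Fin5$g E2$g E4)$c)$y)$(g Ind5$(\<Lambda> y. g Code5$g E3$y -> g Idt$g Fin5$g E3$y)$(\<Lambda> c.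
    g Exfalso$(g Idt$g Fin5$g E3$g E0)$c)$(\<Lambda> c. g Exfalso$(g Idt$g Fin5$g E3$g E1)$c)$(\<Lambda> c.
    g Exfalso$(g Idt$g Fin5$g E3$g E2)$c)$(\<Lambda> _. g Refl$g Fin5$g E3)$(\<Lambda> c. g Exfalso$(g Idt$g Fin5$
    g E3$g E4)$c)$y)$(g Ind5$(\<Lambda> y. g Code5$g E4$y -> g Idt$g Fin5$g E4$y)$(\<Lambda> c. g Exfalso$(g Idt$
    g Fin5$g E4$g E0)$c)$(\<Lambda> c. g Exfalso$(g Idt$g Fin5$g E4$g E1)$c)$(\<Lambda> c. g Exfalso$(g Idt$g Fin5$
    g E4$g E2)$c)$(\<Lambda> c. g Exfalso$(g Idt$g Fin5$g E4$g E3)$c)$(\<Lambda> _. g Refl$g Fin5$g E4)$y)$x))"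
| "finite_entry FinSet5 = (
    g IsSet$g Fin5,
    Thm (g Hedberg$g Fin5$g Code5$g CodeProp5$g Encode5$g Decode5))"

subsection \<open>The alternating group\<close>

text \<open>
  \<open>Xor\<close>, \<open>Less\<close> and \<open>Parity\<close> are literally the terms that occur in the theorem.  \<open>PermS\<close> is the
  transposition of the last two elements.
\<close>

primrec alt_entry :: "alt_name \<Rightarrow> entry" where
  "alt_entry Xor = (
    g Fin2 -> g Fin2 -> g Fin2,
    Def (\<Lambda> x y. g Ind2$(\<Lambda> _. g Fin2)$y$(g Ind2$(\<Lambda> _. g Fin2)$g B1$g B0$y)$x))"
| "alt_entry Less = (
    g Fin5 -> g Fin5 -> g Fin2,
    Def (\<Lambda> x y. g Ind5$(\<Lambda> _. g Fin2)$(g Ind5$(\<Lambda> _. g Fin2)$g B0$g B1$g B1$g B1$g B1$y)$(g Ind5$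
    (\<Lambda> _. g Fin2)$g B0$g B0$g B1$g B1$g B1$y)$(g Ind5$(\<Lambda> _. g Fin2)$g B0$g B0$g B0$g B1$g B1$y)$
    (g Ind5$(\<Lambda> _. g Fin2)$g B0$g B0$g B0$g B0$g B1$y)$(g Ind5$(\<Lambda> _. g Fin2)$g B0$g B0$g B0$g B0$
    g B0$y)$x))"
| "alt_entry Parity = (
    (g Fin5 -> g Fin5) -> g Fin2,
    Def (\<Lambda> g'. g Xor$(g Less$(g'$g E1)$(g'$g E0))$(g Xor$(g Less$(g'$g E2)$(g'$g E0))$(g Xor$(g Less$(g'$g E3)$
    (g'$g E0))$(g Xor$(g Less$(g'$g E4)$(g'$g E0))$(g Xor$(g Less$(g'$g E2)$(g'$g E1))$(g Xor$(g Less$(g'$g E3)$(g'$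
    g E1))$(g Xor$(g Less$(g'$g E4)$(g'$g E1))$(g Xor$(g Less$(g'$g E3)$(g'$g E2))$(g Xor$(g Less$(g'$g E4)$(g'$
    g E2))$(g Xor$(g Less$(g'$g E4)$(g'$g E3))$g B0)))))))))))"
| "alt_entry EquivFun = (
    \<Pi> A:Ty. \<Pi> B:Ty. g Equiv$A$B -> A -> B,
    Def (\<Lambda> A B e. g Fst$(A -> B)$(\<Lambda> f. g IsEquiv$A$B$f)$e))"
| "alt_entry PermFive = (
    Ty,
    Def (g Equiv$g Fin5$g Fin5))"
| "alt_entry IsEven = (
    g PermFive -> Ty,
    Def (\<Lambda> e. g Idt$g Fin2$(g Parity$(g EquivFun$g Fin5$g Fin5$e))$g B0))"
| "alt_entry AltFive = (
    Ty,
    Def (g SigT$g PermFive$(\<Lambda> e. g IsEven$e)))"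
| "alt_entry Perm = (
    g AltFive -> g Fin5 -> g Fin5,
    Def (\<Lambda> g'. g EquivFun$g Fin5$g Fin5$(g Fst$(g Equiv$g Fin5$g Fin5)$(\<Lambda> e. g IsEven$e)$g')))"
\<comment> \<open>Evenness is an identity in the set \<open>Fin2\<close> and being an equivalence is
  a proposition, so both components beyond the function are unique.\<close>
| "alt_entry PermInj = (
    \<Pi> g':g AltFive. \<Pi> h:g AltFive. g Idt$(g Fin5 -> g Fin5)$(g Perm$g')$(g Perm$h) -> g Idt$g AltFive$g'$h,
    Thm (\<Lambda> g' h p. g SigPropPath$g PermFive$(\<Lambda> e. g IsEven$e)$(\<Lambda> e. g FinSet2$(g Parity$
    (g EquivFun$g Fin5$g Fin5$e))$g B0)$g'$h$(g SigPropPath$(g Fin5 -> g Fin5)$(\<Lambda> f. g IsEquiv$g Fin5$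
    g Fin5$f)$(\<Lambda> f. g IsEquivProp$g Fin5$g Fin5$f)$(g Fst$g PermFive$(\<Lambda> e. g IsEven$e)$g')$(g Fst$
    g PermFive$(\<Lambda> e. g IsEven$e)$h)$p)))"
\<comment> \<open>The cycle 0, 2, 1, 3, 4.\<close>
| "alt_entry PermA = (
    g Fin5 -> g Fin5,
    Def (\<Lambda> x. g Ind5$(\<Lambda> _. g Fin5)$g E2$g E3$g E1$g E4$g E0$x))"
| "alt_entry PermAinv = (
    g Fin5 -> g Fin5,
    Def (\<Lambda> x. g Ind5$(\<Lambda> _. g Fin5)$g E4$g E2$g E0$g E1$g E3$x))"
| "alt_entry PermAEquiv = (
    g IsEquiv$g Fin5$g Fin5$g PermA,
    Thm (g IsoEquiv$g Fin5$g Fin5$g PermA$g PermAinv$(\<Lambda> x. g Ind5$(\<Lambda> x. g Idt$g Fin5$(g PermAinv$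
    (g PermA$x))$x)$(g Refl$g Fin5$(g PermAinv$(g PermA$g E0)))$(g Refl$g Fin5$(g PermAinv$(g PermA$g E1)))$(g Refl$
    g Fin5$(g PermAinv$(g PermA$g E2)))$(g Refl$g Fin5$(g PermAinv$(g PermA$g E3)))$(g Refl$g Fin5$(g PermAinv$
    (g PermA$g E4)))$x)$(\<Lambda> x. g Ind5$(\<Lambda> x. g Idt$g Fin5$(g PermA$(g PermAinv$x))$x)$(g Refl$g Fin5$
    (g PermA$(g PermAinv$g E0)))$(g Refl$g Fin5$(g PermA$(g PermAinv$g E1)))$(g Refl$g Fin5$(g PermA$(g PermAinv$
    g E2)))$(g Refl$g Fin5$(g PermA$(g PermAinv$g E3)))$(g Refl$g Fin5$(g PermA$(g PermAinv$g E4)))$x)$g FinSet5))"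
| "alt_entry PermAEven = (
    g Idt$g Fin2$(g Parity$g PermA)$g B0,
    Thm (g Refl$g Fin2$(g Parity$g PermA)))"
| "alt_entry ElemA = (
    g AltFive,
    Def (g Pr$g PermFive$(\<Lambda> e. g IsEven$e)$(g Pr$(g Fin5 -> g Fin5)$(\<Lambda> f. g IsEquiv$g Fin5$g Fin5$f)$
    g PermA$g PermAEquiv)$g PermAEven))"
\<comment> \<open>The cycle 0, 4, 1. Then \<open>PermA\<close> after \<open>PermB\<close> fixes 0
  and swaps 1 with 2 and 3 with 4, an involution.\<close>
| "alt_entry PermB = (
    g Fin5 -> g Fin5,
    Def (\<Lambda> x. g Ind5$(\<Lambda> _. g Fin5)$g E4$g E0$g E2$g E3$g E1$x))"
| "alt_entry PermBinv = (
    g Fin5 -> g Fin5,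
    Def (\<Lambda> x. g Ind5$(\<Lambda> _. g Fin5)$g E1$g E4$g E2$g E3$g E0$x))"
| "alt_entry PermBEquiv = (
    g IsEquiv$g Fin5$g Fin5$g PermB,
    Thm (g IsoEquiv$g Fin5$g Fin5$g PermB$g PermBinv$(\<Lambda> x. g Ind5$(\<Lambda> x. g Idt$g Fin5$(g PermBinv$
    (g PermB$x))$x)$(g Refl$g Fin5$(g PermBinv$(g PermB$g E0)))$(g Refl$g Fin5$(g PermBinv$(g PermB$g E1)))$(g Refl$
    g Fin5$(g PermBinv$(g PermB$g E2)))$(g Refl$g Fin5$(g PermBinv$(g PermB$g E3)))$(g Refl$g Fin5$(g PermBinv$
    (g PermB$g E4)))$x)$(\<Lambda> x. g Ind5$(\<Lambda> x. g Idt$g Fin5$(g PermB$(g PermBinv$x))$x)$(g Refl$g Fin5$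
    (g PermB$(g PermBinv$g E0)))$(g Refl$g Fin5$(g PermB$(g PermBinv$g E1)))$(g Refl$g Fin5$(g PermB$(g PermBinv$
    g E2)))$(g Refl$g Fin5$(g PermB$(g PermBinv$g E3)))$(g Refl$g Fin5$(g PermB$(g PermBinv$g E4)))$x)$g FinSet5))"
| "alt_entry PermBEven = (
    g Idt$g Fin2$(g Parity$g PermB)$g B0,
    Thm (g Refl$g Fin2$(g Parity$g PermB)))"
| "alt_entry ElemB = (
    g AltFive,
    Def (g Pr$g PermFive$(\<Lambda> e. g IsEven$e)$(g Pr$(g Fin5 -> g Fin5)$(\<Lambda> f. g IsEquiv$g Fin5$g Fin5$f)$
    g PermB$g PermBEquiv)$g PermBEven))"
\<comment> \<open>The identity, given by cases like the other permutations. Its loop is where the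
  induction over loops starts.\<close>
| "alt_entry PermI = (
    g Fin5 -> g Fin5,
    Def (\<Lambda> x. g Ind5$(\<Lambda> _. g Fin5)$g E0$g E1$g E2$g E3$g E4$x))"
| "alt_entry PermIEquiv = (
    g IsEquiv$g Fin5$g Fin5$g PermI,
    Thm (g IsoEquiv$g Fin5$g Fin5$g PermI$g PermI$(\<Lambda> x. g Ind5$(\<Lambda> x. g Idt$g Fin5$(g PermI$(g PermI$x))$
    x)$(g Refl$g Fin5$(g PermI$(g PermI$g E0)))$(g Refl$g Fin5$(g PermI$(g PermI$g E1)))$(g Refl$g Fin5$(g PermI$
    (g PermI$g E2)))$(g Refl$g Fin5$(g PermI$(g PermI$g E3)))$(g Refl$g Fin5$(g PermI$(g PermI$g E4)))$x)$
    (\<Lambda> x. g Ind5$(\<Lambda> x. g Idt$g Fin5$(g PermI$(g PermI$x))$x)$(g Refl$g Fin5$(g PermI$(g PermI$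
    g E0)))$(g Refl$g Fin5$(g PermI$(g PermI$g E1)))$(g Refl$g Fin5$(g PermI$(g PermI$g E2)))$(g Refl$g Fin5$
    (g PermI$(g PermI$g E3)))$(g Refl$g Fin5$(g PermI$(g PermI$g E4)))$x)$g FinSet5))"
| "alt_entry PermIEven = (
    g Idt$g Fin2$(g Parity$g PermI)$g B0,
    Thm (g Refl$g Fin2$(g Parity$g PermI)))"
| "alt_entry ElemI = (
    g AltFive,
    Def (g Pr$g PermFive$(\<Lambda> e. g IsEven$e)$(g Pr$(g Fin5 -> g Fin5)$(\<Lambda> f. g IsEquiv$g Fin5$g Fin5$f)$
    g PermI$g PermIEquiv)$g PermIEven))"
| "alt_entry PermS = (
    g Fin5 -> g Fin5,
    Def (\<Lambda> x. g Ind5$(\<Lambda> _. g Fin5)$g E0$g E1$g E2$g E4$g E3$x))"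

subsection \<open>Generation\<close>

text \<open>
  \<open>ReachK\<close> says that every element of \<open>G\<close> sending \<open>0, ..., K - 1\<close> to the given points lies in \<open>S\<close>.  As \<open>S\<close>
  is closed under removing \<open>a\<close> or \<open>b\<close> on the left, \<open>CoverK\<close> moves the image of \<open>K - 1\<close> back to \<open>K - 1\<close> by a
  word in \<open>a\<close> and \<open>b\<close>; these words were found by breadth-first search.
\<close>

primrec coset_entry :: "coset_name \<Rightarrow> entry" where
  "coset_entry Reach1 = (
    \<Pi> G:Ty. (G -> g Fin5 -> g Fin5) -> (G -> Ty) -> g Fin5 -> Ty,
    Def (\<Lambda> G m S v0. \<Pi> q:G. g Idt$g Fin5$(m$q$g E0)$v0 -> S$q))"
\<comment> \<open>If \<open>q\<close> sends 0 to \<open>v0\<close>, then \<open>f$q\<close> sends it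
  to \<open>s$v0\<close>; so reachability is pulled back along \<open>s\<close>.\<close>
| "coset_entry Step1 = (
    \<Pi> G:Ty. \<Pi> m:(G -> g Fin5 -> g Fin5). \<Pi> S:(G -> Ty). \<Pi> s:(g Fin5 -> g Fin5). \<Pi> f:(G -> G).
    (\<Pi> q:G. \<Pi> x:g Fin5. g Idt$g Fin5$(m$(f$q)$x)$(s$(m$q$x))) -> (\<Pi> q:G. S$(f$q) -> S$q) -> \<Pi>
    v0:g Fin5. g Reach1$G$m$S$(s$v0) -> g Reach1$G$m$S$v0,
    Thm (\<Lambda> _ m _ s f l c v0 t q p0. c$q$(t$(f$q)$(g Conc$g Fin5$(m$(f$q)$g E0)$(s$(m$q$g E0))$(s$v0)$(l$q$g E0)$
    (g Ap$g Fin5$g Fin5$(m$q$g E0)$v0$s$p0)))))"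
| "coset_entry Reach2 = (
    \<Pi> G:Ty. (G -> g Fin5 -> g Fin5) -> (G -> Ty) -> g Fin5 -> g Fin5 -> Ty,
    Def (\<Lambda> G m S v0 v1. \<Pi> q:G. g Idt$g Fin5$(m$q$g E0)$v0 -> g Idt$g Fin5$(m$q$g E1)$v1 -> S$q))"
| "coset_entry Step2 = (
    \<Pi> G:Ty. \<Pi> m:(G -> g Fin5 -> g Fin5). \<Pi> S:(G -> Ty). \<Pi> s:(g Fin5 -> g Fin5). \<Pi> f:(G -> G).
    (\<Pi> q:G. \<Pi> x:g Fin5. g Idt$g Fin5$(m$(f$q)$x)$(s$(m$q$x))) -> (\<Pi> q:G. S$(f$q) -> S$q) -> \<Pi>
    v0:g Fin5. \<Pi> v1:g Fin5. g Reach2$G$m$S$(s$v0)$(s$v1) -> g Reach2$G$m$S$v0$v1,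
    Thm (\<Lambda> _ m _ s f l c v0 v1 t q p0 p1. c$q$(t$(f$q)$(g Conc$g Fin5$(m$(f$q)$g E0)$(s$(m$q$g E0))$(s$v0)$(l$q$
    g E0)$(g Ap$g Fin5$g Fin5$(m$q$g E0)$v0$s$p0))$(g Conc$g Fin5$(m$(f$q)$g E1)$(s$(m$q$g E1))$(s$v1)$(l$q$g E1)$
    (g Ap$g Fin5$g Fin5$(m$q$g E1)$v1$s$p1)))))"
| "coset_entry Reach3 = (
    \<Pi> G:Ty. (G -> g Fin5 -> g Fin5) -> (G -> Ty) -> g Fin5 -> g Fin5 -> g Fin5 -> Ty,
    Def (\<Lambda> G m S v0 v1 v2. \<Pi> q:G. g Idt$g Fin5$(m$q$g E0)$v0 -> g Idt$g Fin5$(m$q$g E1)$v1 -> g Idt$g Fin5$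
    (m$q$g E2)$v2 -> S$q))"
| "coset_entry Step3 = (
    \<Pi> G:Ty. \<Pi> m:(G -> g Fin5 -> g Fin5). \<Pi> S:(G -> Ty). \<Pi> s:(g Fin5 -> g Fin5). \<Pi> f:(G -> G).
    (\<Pi> q:G. \<Pi> x:g Fin5. g Idt$g Fin5$(m$(f$q)$x)$(s$(m$q$x))) -> (\<Pi> q:G. S$(f$q) -> S$q) -> \<Pi>
    v0:g Fin5. \<Pi> v1:g Fin5. \<Pi> v2:g Fin5. g Reach3$G$m$S$(s$v0)$(s$v1)$(s$v2) -> g Reach3$G$m$S$v0$v1$v2,
    Thm (\<Lambda> _ m _ s f l c v0 v1 v2 t q p0 p1 p2. c$q$(t$(f$q)$(g Conc$g Fin5$(m$(f$q)$g E0)$(s$(m$q$g E0))$(s$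
    v0)$(l$q$g E0)$(g Ap$g Fin5$g Fin5$(m$q$g E0)$v0$s$p0))$(g Conc$g Fin5$(m$(f$q)$g E1)$(s$(m$q$g E1))$(s$v1)$(l$
    q$g E1)$(g Ap$g Fin5$g Fin5$(m$q$g E1)$v1$s$p1))$(g Conc$g Fin5$(m$(f$q)$g E2)$(s$(m$q$g E2))$(s$v2)$(l$q$g E2)$
    (g Ap$g Fin5$g Fin5$(m$q$g E2)$v2$s$p2)))))"
| "coset_entry Cover1 = (
    \<Pi> G:Ty. \<Pi> m:(G -> g Fin5 -> g Fin5). \<Pi> S:(G -> Ty). \<Pi> f:(G -> G). (\<Pi> q:G. \<Pi> x:g Fin5. g Idt$
    g Fin5$(m$(f$q)$x)$(g PermA$(m$q$x))) -> (\<Pi> q:G. S$(f$q) -> S$q) -> \<Pi> g':(G -> G). (\<Pi> q:G. \<Pi>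
    x:g Fin5. g Idt$g Fin5$(m$(g'$q)$x)$(g PermB$(m$q$x))) -> (\<Pi> q:G. S$(g'$q) -> S$q) -> g Reach1$G$m$S$g E0
    -> \<Pi> q:G. S$q,
    Thm (\<Lambda> G m S f l c g' n d t q. g Ind5$(\<Lambda> v. g Idt$g Fin5$(m$q$g E0)$v -> S$q)$(t$q)$(g Step1$G$m$S$
    g PermB$g'$n$d$g E1$t$q)$(g Step1$G$m$S$g PermA$f$l$c$g E2$(g Step1$G$m$S$g PermB$g'$n$d$(g PermA$g E2)$t)$q)$
    (g Step1$G$m$S$g PermA$f$l$c$g E3$(g Step1$G$m$S$g PermA$f$l$c$(g PermA$g E3)$t)$q)$(g Step1$G$m$S$g PermA$f$l$
    c$g E4$t$q)$(m$q$g E0)$(g Refl$g Fin5$(m$q$g E0))))"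
\<comment> \<open>A word must also bring 0 back to 0. For the image 4, \<open>PermA\<close> twice,
  \<open>PermB\<close> twice, \<open>PermA\<close> once takes 0 through 2, 1, 0, 4 to 0 and 4
  through 0, 2, 2, 2 to 1. The image 0 is excluded by injectivity.\<close>
| "coset_entry Cover2 = (
    \<Pi> G:Ty. \<Pi> m:(G -> g Fin5 -> g Fin5). \<Pi> S:(G -> Ty). \<Pi> f:(G -> G). (\<Pi> q:G. \<Pi> x:g Fin5. g Idt$
    g Fin5$(m$(f$q)$x)$(g PermA$(m$q$x))) -> (\<Pi> q:G. S$(f$q) -> S$q) -> \<Pi> g':(G -> G). (\<Pi> q:G. \<Pi>
    x:g Fin5. g Idt$g Fin5$(m$(g'$q)$x)$(g PermB$(m$q$x))) -> (\<Pi> q:G. S$(g'$q) -> S$q) -> (\<Pi> q:G. \<Pi>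
    x:g Fin5. \<Pi> y:g Fin5. g Idt$g Fin5$(m$q$x)$(m$q$y) -> g Idt$g Fin5$x$y) -> g Reach2$G$m$S$g E0$g E1 ->
    g Reach1$G$m$S$g E0,
    Thm (\<Lambda> G m S f l c g' n d inj t q p0. g Ind5$(\<Lambda> v. g Idt$g Fin5$(m$q$g E1)$v -> S$q)$(\<Lambda> r.
    g Exfalso$(S$q)$(g Encode5$g E1$g E0$(inj$q$g E1$g E0$(g Conc$g Fin5$(m$q$g E1)$g E0$(m$q$g E0)$r$(g Inv$g Fin5$
    (m$q$g E0)$g E0$p0)))))$(t$q$p0)$(g Step2$G$m$S$g PermB$g'$n$d$g E0$g E2$(g Step2$G$m$S$g PermA$f$l$c$(g PermB$
    g E0)$(g PermB$g E2)$t)$q$p0)$(g Step2$G$m$S$g PermB$g'$n$d$g E0$g E3$(g Step2$G$m$S$g PermB$g'$n$d$(g PermB$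
    g E0)$(g PermB$g E3)$(g Step2$G$m$S$g PermA$f$l$c$(g PermB$(g PermB$g E0))$(g PermB$(g PermB$g E3))$(g Step2$G$
    m$S$g PermA$f$l$c$(g PermA$(g PermB$(g PermB$g E0)))$(g PermA$(g PermB$(g PermB$g E3)))$(g Step2$G$m$S$g PermB$
    g'$n$d$(g PermA$(g PermA$(g PermB$(g PermB$g E0))))$(g PermA$(g PermA$(g PermB$(g PermB$g E3))))$(g Step2$G$m$S$
    g PermB$g'$n$d$(g PermB$(g PermA$(g PermA$(g PermB$(g PermB$g E0)))))$(g PermB$(g PermA$(g PermA$(g PermB$
    (g PermB$g E3)))))$t)))))$q$p0)$(g Step2$G$m$S$g PermA$f$l$c$g E0$g E4$(g Step2$G$m$S$g PermA$f$l$c$(g PermA$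
    g E0)$(g PermA$g E4)$(g Step2$G$m$S$g PermB$g'$n$d$(g PermA$(g PermA$g E0))$(g PermA$(g PermA$g E4))$(g Step2$G$
    m$S$g PermB$g'$n$d$(g PermB$(g PermA$(g PermA$g E0)))$(g PermB$(g PermA$(g PermA$g E4)))$(g Step2$G$m$S$g PermA$
    f$l$c$(g PermB$(g PermB$(g PermA$(g PermA$g E0))))$(g PermB$(g PermB$(g PermA$(g PermA$g E4))))$t))))$q$p0)$(m$
    q$g E1)$(g Refl$g Fin5$(m$q$g E1))))"
\<comment> \<open>Now 0 and 1 must both return. For the image 4, \<open>PermA\<close> twice and then
  \<open>PermB\<close> takes 0 through 2, 1 to 0, takes 1 through 3, 4 to 1, and takes 4 through 0,
  2 to 2.\<close>
| "coset_entry Cover3 = (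
    \<Pi> G:Ty. \<Pi> m:(G -> g Fin5 -> g Fin5). \<Pi> S:(G -> Ty). \<Pi> f:(G -> G). (\<Pi> q:G. \<Pi> x:g Fin5. g Idt$
    g Fin5$(m$(f$q)$x)$(g PermA$(m$q$x))) -> (\<Pi> q:G. S$(f$q) -> S$q) -> \<Pi> g':(G -> G). (\<Pi> q:G. \<Pi>
    x:g Fin5. g Idt$g Fin5$(m$(g'$q)$x)$(g PermB$(m$q$x))) -> (\<Pi> q:G. S$(g'$q) -> S$q) -> (\<Pi> q:G. \<Pi>
    x:g Fin5. \<Pi> y:g Fin5. g Idt$g Fin5$(m$q$x)$(m$q$y) -> g Idt$g Fin5$x$y) -> g Reach3$G$m$S$g E0$g E1$g E2 ->
    g Reach2$G$m$S$g E0$g E1,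
    Thm (\<Lambda> G m S f l c g' n d inj t q p0 p1. g Ind5$(\<Lambda> v. g Idt$g Fin5$(m$q$g E2)$v -> S$q)$(\<Lambda>
    r. g Exfalso$(S$q)$(g Encode5$g E2$g E0$(inj$q$g E2$g E0$(g Conc$g Fin5$(m$q$g E2)$g E0$(m$q$g E0)$r$(g Inv$
    g Fin5$(m$q$g E0)$g E0$p0)))))$(\<Lambda> r. g Exfalso$(S$q)$(g Encode5$g E2$g E1$(inj$q$g E2$g E1$(g Conc$
    g Fin5$(m$q$g E2)$g E1$(m$q$g E1)$r$(g Inv$g Fin5$(m$q$g E1)$g E1$p1)))))$(t$q$p0$p1)$(g Step3$G$m$S$g PermB$g'$
    n$d$g E0$g E1$g E3$(g Step3$G$m$S$g PermB$g'$n$d$(g PermB$g E0)$(g PermB$g E1)$(g PermB$g E3)$(g Step3$G$m$S$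
    g PermA$f$l$c$(g PermB$(g PermB$g E0))$(g PermB$(g PermB$g E1))$(g PermB$(g PermB$g E3))$(g Step3$G$m$S$g PermA$
    f$l$c$(g PermA$(g PermB$(g PermB$g E0)))$(g PermA$(g PermB$(g PermB$g E1)))$(g PermA$(g PermB$(g PermB$g E3)))$
    (g Step3$G$m$S$g PermA$f$l$c$(g PermA$(g PermA$(g PermB$(g PermB$g E0))))$(g PermA$(g PermA$(g PermB$(g PermB$
    g E1))))$(g PermA$(g PermA$(g PermB$(g PermB$g E3))))$t))))$q$p0$p1)$(g Step3$G$m$S$g PermA$f$l$c$g E0$g E1$
    g E4$(g Step3$G$m$S$g PermA$f$l$c$(g PermA$g E0)$(g PermA$g E1)$(g PermA$g E4)$(g Step3$G$m$S$g PermB$g'$n$d$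
    (g PermA$(g PermA$g E0))$(g PermA$(g PermA$g E1))$(g PermA$(g PermA$g E4))$t))$q$p0$p1)$(m$q$g E2)$(g Refl$
    g Fin5$(m$q$g E2))))"
\<comment> \<open>An injective map fixing 0, 1, 2 is the identity or \<open>PermS\<close>. The
  parity of \<open>PermS\<close> computes to \<open>B1\<close>, against evenness; function
  extensionality is used because parity takes a function, not its values.\<close>
| "coset_entry Fixing = (
    \<Pi> G:Ty. \<Pi> m:(G -> g Fin5 -> g Fin5). \<Pi> S:(G -> Ty). (\<Pi> q:G. \<Pi> x:g Fin5. \<Pi> y:g Fin5. g Idt$
    g Fin5$(m$q$x)$(m$q$y) -> g Idt$g Fin5$x$y) -> (\<Pi> q:G. g Idt$g Fin2$(g Parity$(m$q))$g B0) -> (\<Pi> q:G.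
    (\<Pi> x:g Fin5. g Idt$g Fin5$(m$q$x)$x) -> S$q) -> g Reach3$G$m$S$g E0$g E1$g E2,
    Thm (\<Lambda> _ m S inj even base q p0 p1 p2. g Ind5$(\<Lambda> v. g Idt$g Fin5$(m$q$g E3)$v -> S$q)$(\<Lambda> r.
    g Exfalso$(S$q)$(g Encode5$g E3$g E0$(inj$q$g E3$g E0$(g Conc$g Fin5$(m$q$g E3)$g E0$(m$q$g E0)$r$(g Inv$g Fin5$
    (m$q$g E0)$g E0$p0)))))$(\<Lambda> r. g Exfalso$(S$q)$(g Encode5$g E3$g E1$(inj$q$g E3$g E1$(g Conc$g Fin5$(m$q$
    g E3)$g E1$(m$q$g E1)$r$(g Inv$g Fin5$(m$q$g E1)$g E1$p1)))))$(\<Lambda> r. g Exfalso$(S$q)$(g Encode5$g E3$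
    g E2$(inj$q$g E3$g E2$(g Conc$g Fin5$(m$q$g E3)$g E2$(m$q$g E2)$r$(g Inv$g Fin5$(m$q$g E2)$g E2$p2)))))$
    (\<Lambda> p3. g Ind5$(\<Lambda> v. g Idt$g Fin5$(m$q$g E4)$v -> S$q)$(\<Lambda> r. g Exfalso$(S$q)$(g Encode5$
    g E4$g E0$(inj$q$g E4$g E0$(g Conc$g Fin5$(m$q$g E4)$g E0$(m$q$g E0)$r$(g Inv$g Fin5$(m$q$g E0)$g E0$p0)))))$
    (\<Lambda> r. g Exfalso$(S$q)$(g Encode5$g E4$g E1$(inj$q$g E4$g E1$(g Conc$g Fin5$(m$q$g E4)$g E1$(m$q$g E1)$r$
    (g Inv$g Fin5$(m$q$g E1)$g E1$p1)))))$(\<Lambda> r. g Exfalso$(S$q)$(g Encode5$g E4$g E2$(inj$q$g E4$g E2$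
    (g Conc$g Fin5$(m$q$g E4)$g E2$(m$q$g E2)$r$(g Inv$g Fin5$(m$q$g E2)$g E2$p2)))))$(\<Lambda> r. g Exfalso$(S$q)$
    (g Encode5$g E4$g E3$(inj$q$g E4$g E3$(g Conc$g Fin5$(m$q$g E4)$g E3$(m$q$g E3)$r$(g Inv$g Fin5$(m$q$g E3)$g E3$
    p3)))))$(\<Lambda> r. base$q$(\<Lambda> x. g Ind5$(\<Lambda> x. g Idt$g Fin5$(m$q$x)$x)$p0$p1$p2$p3$r$x))$(m$q$
    g E4)$(g Refl$g Fin5$(m$q$g E4)))$(\<Lambda> p3. g Ind5$(\<Lambda> v. g Idt$g Fin5$(m$q$g E4)$v -> S$q)$
    (\<Lambda> r. g Exfalso$(S$q)$(g Encode5$g E4$g E0$(inj$q$g E4$g E0$(g Conc$g Fin5$(m$q$g E4)$g E0$(m$q$g E0)$r$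
    (g Inv$g Fin5$(m$q$g E0)$g E0$p0)))))$(\<Lambda> r. g Exfalso$(S$q)$(g Encode5$g E4$g E1$(inj$q$g E4$g E1$
    (g Conc$g Fin5$(m$q$g E4)$g E1$(m$q$g E1)$r$(g Inv$g Fin5$(m$q$g E1)$g E1$p1)))))$(\<Lambda> r. g Exfalso$(S$q)$
    (g Encode5$g E4$g E2$(inj$q$g E4$g E2$(g Conc$g Fin5$(m$q$g E4)$g E2$(m$q$g E2)$r$(g Inv$g Fin5$(m$q$g E2)$g E2$
    p2)))))$(\<Lambda> r. g Exfalso$(S$q)$(g Encode2$g B0$g B1$(g Conc$g Fin2$g B0$(g Parity$(m$q))$g B1$(g Inv$
    g Fin2$(g Parity$(m$q))$g B0$(even$q))$(g Ap$(g Fin5 -> g Fin5)$g Fin2$(m$q)$g PermS$g Parity$(g Funext$g Fin5$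
    (\<Lambda> _. g Fin5)$(m$q)$g PermS$(\<Lambda> x. g Ind5$(\<Lambda> x. g Idt$g Fin5$(m$q$x)$(g PermS$x))$p0$p1$
    p2$p3$r$x))))))$(\<Lambda> r. g Exfalso$(S$q)$(g Encode5$g E4$g E3$(inj$q$g E4$g E3$(g Conc$g Fin5$(m$q$g E4)$
    g E4$(m$q$g E3)$r$(g Inv$g Fin5$(m$q$g E3)$g E4$p3)))))$(m$q$g E4)$(g Refl$g Fin5$(m$q$g E4)))$(m$q$g E3)$
    (g Refl$g Fin5$(m$q$g E3))))"
| "coset_entry Generation = (
    \<Pi> G:Ty. \<Pi> m:(G -> g Fin5 -> g Fin5). \<Pi> S:(G -> Ty). \<Pi> f:(G -> G). (\<Pi> q:G. \<Pi> x:g Fin5. g Idt$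
    g Fin5$(m$(f$q)$x)$(g PermA$(m$q$x))) -> (\<Pi> q:G. S$(f$q) -> S$q) -> \<Pi> g':(G -> G). (\<Pi> q:G. \<Pi>
    x:g Fin5. g Idt$g Fin5$(m$(g'$q)$x)$(g PermB$(m$q$x))) -> (\<Pi> q:G. S$(g'$q) -> S$q) -> (\<Pi> q:G. \<Pi>
    x:g Fin5. \<Pi> y:g Fin5. g Idt$g Fin5$(m$q$x)$(m$q$y) -> g Idt$g Fin5$x$y) -> (\<Pi> q:G. g Idt$g Fin2$
    (g Parity$(m$q))$g B0) -> (\<Pi> q:G. (\<Pi> x:g Fin5. g Idt$g Fin5$(m$q$x)$x) -> S$q) -> \<Pi> q:G. S$q,
    Thm (\<Lambda> G m S f l c g' n d inj even base. g Cover1$G$m$S$f$l$c$g'$n$d$(g Cover2$G$m$S$f$l$c$g'$n$d$inj$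
    (g Cover3$G$m$S$f$l$c$g'$n$d$inj$(g Fixing$G$m$S$inj$even$base)))))"

subsection \<open>Dependent paths\<close>

text \<open>
  \<open>Tw\<close> turns a path in \<open>B\<close> into a dependent path in the constant family \<open>B\<close>; it commutes with
  concatenation and powers, and paths between paths lift along it (\<open>TwOver\<close>).
\<close>

primrec dep_entry :: "dep_name \<Rightarrow> entry" where
  "dep_entry DPath = (
    \<Pi> A:Ty. \<Pi> P:(A -> Ty). \<Pi> x:A. \<Pi> y:A. g Idt$A$x$y -> P$x -> P$y -> Ty,
    Def (\<Lambda> A P x y p u v. g Idt$(P$y)$(g Transp$A$P$x$y$p$u)$v))"
| "dep_entry Dconc = (
    \<Pi> A:Ty. \<Pi> P:(A -> Ty). \<Pi> x:A. \<Pi> y:A. \<Pi> z:A. \<Pi> p:g Idt$A$x$y. \<Pi> q:g Idt$A$y$z. \<Pi> u:P$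
    x. \<Pi> v:P$y. \<Pi> w:P$z. g DPath$A$P$x$y$p$u$v -> g DPath$A$P$y$z$q$v$w -> g DPath$A$P$x$z$(g Conc$A$x$y$z$
    p$q)$u$w,
    Def (\<Lambda> A P x y z p q u v w d e. g PathInd$A$(\<Lambda> y z q. \<Pi> p:g Idt$A$x$y. \<Pi> v:P$y. \<Pi> w:P$
    z. g DPath$A$P$x$y$p$u$v -> g DPath$A$P$y$z$q$v$w -> g DPath$A$P$x$z$(g Conc$A$x$y$z$p$q)$u$w)$(\<Lambda> y p v
    w d e. g Conc$(P$y)$(g Transp$A$P$x$y$(g Conc$A$x$y$y$p$(g Refl$A$y))$u)$v$w$d$e)$y$z$q$p$v$w$d$e))"
\<comment> \<open>\<open>loop_pow\<close> recurses in the meta-logic, so each power up to the fifth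
  gets a name of its own.\<close>
| "dep_entry Pow0 = (
    \<Pi> A:Ty. \<Pi> x:A. g Idt$A$x$x -> g Idt$A$x$x,
    Def (\<Lambda> A x _. g Refl$A$x))"
| "dep_entry Dpow0 = (
    \<Pi> A:Ty. \<Pi> P:(A -> Ty). \<Pi> x:A. \<Pi> p:g Idt$A$x$x. \<Pi> u:P$x. g DPath$A$P$x$x$p$u$u -> g DPath$A$P$x$
    x$(g Pow0$A$x$p)$u$u,
    Def (\<Lambda> A P x p u _. g Refl$(P$x)$(g Transp$A$P$x$x$(g Pow0$A$x$p)$u)))"
| "dep_entry Pow1 = (
    \<Pi> A:Ty. \<Pi> x:A. g Idt$A$x$x -> g Idt$A$x$x,
    Def (\<Lambda> A x p. g Conc$A$x$x$x$(g Pow0$A$x$p)$p))"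
| "dep_entry Dpow1 = (
    \<Pi> A:Ty. \<Pi> P:(A -> Ty). \<Pi> x:A. \<Pi> p:g Idt$A$x$x. \<Pi> u:P$x. g DPath$A$P$x$x$p$u$u -> g DPath$A$P$x$
    x$(g Pow1$A$x$p)$u$u,
    Def (\<Lambda> A P x p u d. g Dconc$A$P$x$x$x$(g Pow0$A$x$p)$p$u$u$u$(g Dpow0$A$P$x$p$u$d)$d))"
| "dep_entry Pow2 = (
    \<Pi> A:Ty. \<Pi> x:A. g Idt$A$x$x -> g Idt$A$x$x,
    Def (\<Lambda> A x p. g Conc$A$x$x$x$(g Pow1$A$x$p)$p))"
| "dep_entry Dpow2 = (
    \<Pi> A:Ty. \<Pi> P:(A -> Ty). \<Pi> x:A. \<Pi> p:g Idt$A$x$x. \<Pi> u:P$x. g DPath$A$P$x$x$p$u$u -> g DPath$A$P$x$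
    x$(g Pow2$A$x$p)$u$u,
    Def (\<Lambda> A P x p u d. g Dconc$A$P$x$x$x$(g Pow1$A$x$p)$p$u$u$u$(g Dpow1$A$P$x$p$u$d)$d))"
| "dep_entry Pow3 = (
    \<Pi> A:Ty. \<Pi> x:A. g Idt$A$x$x -> g Idt$A$x$x,
    Def (\<Lambda> A x p. g Conc$A$x$x$x$(g Pow2$A$x$p)$p))"
| "dep_entry Dpow3 = (
    \<Pi> A:Ty. \<Pi> P:(A -> Ty). \<Pi> x:A. \<Pi> p:g Idt$A$x$x. \<Pi> u:P$x. g DPath$A$P$x$x$p$u$u -> g DPath$A$P$x$
    x$(g Pow3$A$x$p)$u$u,
    Def (\<Lambda> A P x p u d. g Dconc$A$P$x$x$x$(g Pow2$A$x$p)$p$u$u$u$(g Dpow2$A$P$x$p$u$d)$d))"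
| "dep_entry Pow4 = (
    \<Pi> A:Ty. \<Pi> x:A. g Idt$A$x$x -> g Idt$A$x$x,
    Def (\<Lambda> A x p. g Conc$A$x$x$x$(g Pow3$A$x$p)$p))"
| "dep_entry Dpow4 = (
    \<Pi> A:Ty. \<Pi> P:(A -> Ty). \<Pi> x:A. \<Pi> p:g Idt$A$x$x. \<Pi> u:P$x. g DPath$A$P$x$x$p$u$u -> g DPath$A$P$x$
    x$(g Pow4$A$x$p)$u$u,
    Def (\<Lambda> A P x p u d. g Dconc$A$P$x$x$x$(g Pow3$A$x$p)$p$u$u$u$(g Dpow3$A$P$x$p$u$d)$d))"
| "dep_entry Pow5 = (
    \<Pi> A:Ty. \<Pi> x:A. g Idt$A$x$x -> g Idt$A$x$x,
    Def (\<Lambda> A x p. g Conc$A$x$x$x$(g Pow4$A$x$p)$p))"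
| "dep_entry Dpow5 = (
    \<Pi> A:Ty. \<Pi> P:(A -> Ty). \<Pi> x:A. \<Pi> p:g Idt$A$x$x. \<Pi> u:P$x. g DPath$A$P$x$x$p$u$u -> g DPath$A$P$x$
    x$(g Pow5$A$x$p)$u$u,
    Def (\<Lambda> A P x p u d. g Dconc$A$P$x$x$x$(g Pow4$A$x$p)$p$u$u$u$(g Dpow4$A$P$x$p$u$d)$d))"
| "dep_entry Apd = (
    \<Pi> A:Ty. \<Pi> P:(A -> Ty). \<Pi> f:(\<Pi> x:A. P$x). \<Pi> x:A. \<Pi> y:A. \<Pi> p:g Idt$A$x$y. g DPath$A$P$x$y$
    p$(f$x)$(f$y),
    Def (\<Lambda> A P f x y p. g PathInd$A$(\<Lambda> x y p. g DPath$A$P$x$y$p$(f$x)$(f$y))$(\<Lambda> x. g Refl$(P$x)$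
    (g Transp$A$P$x$x$(g Refl$A$x)$(f$x)))$x$y$p))"
| "dep_entry Tw = (
    \<Pi> A:Ty. \<Pi> B:Ty. \<Pi> x:A. \<Pi> y:A. \<Pi> p:g Idt$A$x$y. \<Pi> u:B. \<Pi> v:B. g Idt$B$u$v -> g DPath$A$
    (\<Lambda> _. B)$x$y$p$u$v,
    Def (\<Lambda> A B x y p u v l. g PathInd$A$(\<Lambda> x y p. g Idt$B$u$v -> g DPath$A$(\<Lambda> _. B)$x$y$p$u$v)$
    (\<Lambda> _ l. l)$x$y$p$l))"
\<comment> \<open>The case of \<open>TwConc\<close> in which the second base path is reflexivity; it
  remains to induct on the path in \<open>B\<close>.\<close>
| "dep_entry TwConcRefl = (
    \<Pi> A:Ty. \<Pi> B:Ty. \<Pi> x:A. \<Pi> y:A. \<Pi> p:g Idt$A$x$y. \<Pi> u:B. \<Pi> v:B. \<Pi> w:B. \<Pi> m:g Idt$B$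
    v$w. \<Pi> l:g Idt$B$u$v. g Idt$(g DPath$A$(\<Lambda> _. B)$x$y$p$u$w)$(g Conc$B$(g Transp$A$(\<Lambda> _. B)$x$
    y$p$u)$v$w$(g Tw$A$B$x$y$p$u$v$l)$m)$(g Tw$A$B$x$y$p$u$w$(g Conc$B$u$v$w$l$m)),
    Thm (\<Lambda> A B x y p u v w m. g PathInd$B$(\<Lambda> v w m. \<Pi> l:g Idt$B$u$v. g Idt$(g DPath$A$(\<Lambda> _.
    B)$x$y$p$u$w)$(g Conc$B$(g Transp$A$(\<Lambda> _. B)$x$y$p$u)$v$w$(g Tw$A$B$x$y$p$u$v$l)$m)$(g Tw$A$B$x$y$p$u$w$
    (g Conc$B$u$v$w$l$m)))$(\<Lambda> v l. g Refl$(g DPath$A$(\<Lambda> _. B)$x$y$p$u$v)$(g Conc$B$(g Transp$A$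
    (\<Lambda> _. B)$x$y$p$u)$v$v$(g Tw$A$B$x$y$p$u$v$l)$(g Refl$B$v)))$v$w$m))"
| "dep_entry TwConc = (
    \<Pi> A:Ty. \<Pi> B:Ty. \<Pi> x:A. \<Pi> y:A. \<Pi> z:A. \<Pi> p:g Idt$A$x$y. \<Pi> q:g Idt$A$y$z. \<Pi> u:B. \<Pi>
    v:B. \<Pi> w:B. \<Pi> l:g Idt$B$u$v. \<Pi> m:g Idt$B$v$w. g Idt$(g DPath$A$(\<Lambda> _. B)$x$z$(g Conc$A$x$y$z$
    p$q)$u$w)$(g Dconc$A$(\<Lambda> _. B)$x$y$z$p$q$u$v$w$(g Tw$A$B$x$y$p$u$v$l)$(g Tw$A$B$y$z$q$v$w$m))$(g Tw$A$B$
    x$z$(g Conc$A$x$y$z$p$q)$u$w$(g Conc$B$u$v$w$l$m)),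
    Thm (\<Lambda> A B x y z p q u v w l m. g PathInd$A$(\<Lambda> y z q. \<Pi> p:g Idt$A$x$y. g Idt$(g DPath$A$
    (\<Lambda> _. B)$x$z$(g Conc$A$x$y$z$p$q)$u$w)$(g Dconc$A$(\<Lambda> _. B)$x$y$z$p$q$u$v$w$(g Tw$A$B$x$y$p$u$v$
    l)$(g Tw$A$B$y$z$q$v$w$m))$(g Tw$A$B$x$z$(g Conc$A$x$y$z$p$q)$u$w$(g Conc$B$u$v$w$l$m)))$(\<Lambda> y p.
    g TwConcRefl$A$B$x$y$(g Conc$A$x$y$y$p$(g Refl$A$y))$u$v$w$(g Tw$A$B$y$y$(g Refl$A$y)$v$w$m)$l)$y$z$q$p))"
| "dep_entry TwStep = (
    \<Pi> A:Ty. \<Pi> B:Ty. \<Pi> x:A. \<Pi> q:g Idt$A$x$x. \<Pi> p:g Idt$A$x$x. \<Pi> u:B. \<Pi> d:g DPath$A$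
    (\<Lambda> _. B)$x$x$q$u$u. \<Pi> k:g Idt$B$u$u. g Idt$(g DPath$A$(\<Lambda> _. B)$x$x$q$u$u)$d$(g Tw$A$B$x$x$q$
    u$u$k) -> \<Pi> e:g DPath$A$(\<Lambda> _. B)$x$x$p$u$u. \<Pi> l:g Idt$B$u$u. g Idt$(g DPath$A$(\<Lambda> _. B)$
    x$x$p$u$u)$e$(g Tw$A$B$x$x$p$u$u$l) -> g Idt$(g DPath$A$(\<Lambda> _. B)$x$x$(g Conc$A$x$x$x$q$p)$u$u)$(g Dconc$
    A$(\<Lambda> _. B)$x$x$x$q$p$u$u$u$d$e)$(g Tw$A$B$x$x$(g Conc$A$x$x$x$q$p)$u$u$(g Conc$B$u$u$u$k$l)),
    Thm (\<Lambda> A B x q p u d k h e l i. g Conc$(g DPath$A$(\<Lambda> _. B)$x$x$(g Conc$A$x$x$x$q$p)$u$u)$(g Dconc$A$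
    (\<Lambda> _. B)$x$x$x$q$p$u$u$u$d$e)$(g Dconc$A$(\<Lambda> _. B)$x$x$x$q$p$u$u$u$(g Tw$A$B$x$x$q$u$u$k)$e)$
    (g Tw$A$B$x$x$(g Conc$A$x$x$x$q$p)$u$u$(g Conc$B$u$u$u$k$l))$(g Ap$(g DPath$A$(\<Lambda> _. B)$x$x$q$u$u)$
    (g DPath$A$(\<Lambda> _. B)$x$x$(g Conc$A$x$x$x$q$p)$u$u)$d$(g Tw$A$B$x$x$q$u$u$k)$(\<Lambda> d. g Dconc$A$
    (\<Lambda> _. B)$x$x$x$q$p$u$u$u$d$e)$h)$(g Conc$(g DPath$A$(\<Lambda> _. B)$x$x$(g Conc$A$x$x$x$q$p)$u$u)$
    (g Dconc$A$(\<Lambda> _. B)$x$x$x$q$p$u$u$u$(g Tw$A$B$x$x$q$u$u$k)$e)$(g Dconc$A$(\<Lambda> _. B)$x$x$x$q$p$u$u$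
    u$(g Tw$A$B$x$x$q$u$u$k)$(g Tw$A$B$x$x$p$u$u$l))$(g Tw$A$B$x$x$(g Conc$A$x$x$x$q$p)$u$u$(g Conc$B$u$u$u$k$l))$
    (g Ap$(g DPath$A$(\<Lambda> _. B)$x$x$p$u$u)$(g DPath$A$(\<Lambda> _. B)$x$x$(g Conc$A$x$x$x$q$p)$u$u)$e$(g Tw$
    A$B$x$x$p$u$u$l)$(\<Lambda> e. g Dconc$A$(\<Lambda> _. B)$x$x$x$q$p$u$u$u$(g Tw$A$B$x$x$q$u$u$k)$e)$i)$
    (g TwConc$A$B$x$x$x$q$p$u$u$u$k$l))))"
| "dep_entry TwPow0 = (
    \<Pi> A:Ty. \<Pi> B:Ty. \<Pi> x:A. \<Pi> p:g Idt$A$x$x. \<Pi> u:B. \<Pi> d:g DPath$A$(\<Lambda> _. B)$x$x$p$u$u.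
    \<Pi> l:g Idt$B$u$u. g Idt$(g DPath$A$(\<Lambda> _. B)$x$x$p$u$u)$d$(g Tw$A$B$x$x$p$u$u$l) -> g Idt$(g DPath$A$
    (\<Lambda> _. B)$x$x$(g Pow0$A$x$p)$u$u)$(g Dpow0$A$(\<Lambda> _. B)$x$p$u$d)$(g Tw$A$B$x$x$(g Pow0$A$x$p)$u$u$
    (g Pow0$B$u$l)),
    Thm (\<Lambda> A B x p u d _ _. g Refl$(g DPath$A$(\<Lambda> _. B)$x$x$(g Pow0$A$x$p)$u$u)$(g Dpow0$A$(\<Lambda> _.
    B)$x$p$u$d)))"
| "dep_entry TwPow1 = (
    \<Pi> A:Ty. \<Pi> B:Ty. \<Pi> x:A. \<Pi> p:g Idt$A$x$x. \<Pi> u:B. \<Pi> d:g DPath$A$(\<Lambda> _. B)$x$x$p$u$u.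
    \<Pi> l:g Idt$B$u$u. g Idt$(g DPath$A$(\<Lambda> _. B)$x$x$p$u$u)$d$(g Tw$A$B$x$x$p$u$u$l) -> g Idt$(g DPath$A$
    (\<Lambda> _. B)$x$x$(g Pow1$A$x$p)$u$u)$(g Dpow1$A$(\<Lambda> _. B)$x$p$u$d)$(g Tw$A$B$x$x$(g Pow1$A$x$p)$u$u$
    (g Pow1$B$u$l)),
    Thm (\<Lambda> A B x p u d l h. g TwStep$A$B$x$(g Pow0$A$x$p)$p$u$(g Dpow0$A$(\<Lambda> _. B)$x$p$u$d)$(g Pow0$B$u$
    l)$(g TwPow0$A$B$x$p$u$d$l$h)$d$l$h))"
| "dep_entry TwPow2 = (
    \<Pi> A:Ty. \<Pi> B:Ty. \<Pi> x:A. \<Pi> p:g Idt$A$x$x. \<Pi> u:B. \<Pi> d:g DPath$A$(\<Lambda> _. B)$x$x$p$u$u.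
    \<Pi> l:g Idt$B$u$u. g Idt$(g DPath$A$(\<Lambda> _. B)$x$x$p$u$u)$d$(g Tw$A$B$x$x$p$u$u$l) -> g Idt$(g DPath$A$
    (\<Lambda> _. B)$x$x$(g Pow2$A$x$p)$u$u)$(g Dpow2$A$(\<Lambda> _. B)$x$p$u$d)$(g Tw$A$B$x$x$(g Pow2$A$x$p)$u$u$
    (g Pow2$B$u$l)),
    Thm (\<Lambda> A B x p u d l h. g TwStep$A$B$x$(g Pow1$A$x$p)$p$u$(g Dpow1$A$(\<Lambda> _. B)$x$p$u$d)$(g Pow1$B$u$
    l)$(g TwPow1$A$B$x$p$u$d$l$h)$d$l$h))"
| "dep_entry TwPow3 = (
    \<Pi> A:Ty. \<Pi> B:Ty. \<Pi> x:A. \<Pi> p:g Idt$A$x$x. \<Pi> u:B. \<Pi> d:g DPath$A$(\<Lambda> _. B)$x$x$p$u$u.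
    \<Pi> l:g Idt$B$u$u. g Idt$(g DPath$A$(\<Lambda> _. B)$x$x$p$u$u)$d$(g Tw$A$B$x$x$p$u$u$l) -> g Idt$(g DPath$A$
    (\<Lambda> _. B)$x$x$(g Pow3$A$x$p)$u$u)$(g Dpow3$A$(\<Lambda> _. B)$x$p$u$d)$(g Tw$A$B$x$x$(g Pow3$A$x$p)$u$u$
    (g Pow3$B$u$l)),
    Thm (\<Lambda> A B x p u d l h. g TwStep$A$B$x$(g Pow2$A$x$p)$p$u$(g Dpow2$A$(\<Lambda> _. B)$x$p$u$d)$(g Pow2$B$u$
    l)$(g TwPow2$A$B$x$p$u$d$l$h)$d$l$h))"
| "dep_entry TwPow4 = (
    \<Pi> A:Ty. \<Pi> B:Ty. \<Pi> x:A. \<Pi> p:g Idt$A$x$x. \<Pi> u:B. \<Pi> d:g DPath$A$(\<Lambda> _. B)$x$x$p$u$u.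
    \<Pi> l:g Idt$B$u$u. g Idt$(g DPath$A$(\<Lambda> _. B)$x$x$p$u$u)$d$(g Tw$A$B$x$x$p$u$u$l) -> g Idt$(g DPath$A$
    (\<Lambda> _. B)$x$x$(g Pow4$A$x$p)$u$u)$(g Dpow4$A$(\<Lambda> _. B)$x$p$u$d)$(g Tw$A$B$x$x$(g Pow4$A$x$p)$u$u$
    (g Pow4$B$u$l)),
    Thm (\<Lambda> A B x p u d l h. g TwStep$A$B$x$(g Pow3$A$x$p)$p$u$(g Dpow3$A$(\<Lambda> _. B)$x$p$u$d)$(g Pow3$B$u$
    l)$(g TwPow3$A$B$x$p$u$d$l$h)$d$l$h))"
| "dep_entry TwPow5 = (
    \<Pi> A:Ty. \<Pi> B:Ty. \<Pi> x:A. \<Pi> p:g Idt$A$x$x. \<Pi> u:B. \<Pi> d:g DPath$A$(\<Lambda> _. B)$x$x$p$u$u.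
    \<Pi> l:g Idt$B$u$u. g Idt$(g DPath$A$(\<Lambda> _. B)$x$x$p$u$u)$d$(g Tw$A$B$x$x$p$u$u$l) -> g Idt$(g DPath$A$
    (\<Lambda> _. B)$x$x$(g Pow5$A$x$p)$u$u)$(g Dpow5$A$(\<Lambda> _. B)$x$p$u$d)$(g Tw$A$B$x$x$(g Pow5$A$x$p)$u$u$
    (g Pow5$B$u$l)),
    Thm (\<Lambda> A B x p u d l h. g TwStep$A$B$x$(g Pow4$A$x$p)$p$u$(g Dpow4$A$(\<Lambda> _. B)$x$p$u$d)$(g Pow4$B$u$
    l)$(g TwPow4$A$B$x$p$u$d$l$h)$d$l$h))"
| "dep_entry TwOverRefl = (
    \<Pi> A:Ty. \<Pi> B:Ty. \<Pi> x:A. \<Pi> q:g Idt$A$x$x. \<Pi> r:g Idt$A$x$x. \<Pi> t:g Idt$(g Idt$A$x$x)$q$r. \<Pi>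
    u:B. \<Pi> l:g Idt$B$u$u. g Idt$(g DPath$A$(\<Lambda> _. B)$x$x$r$u$u)$(g Transp$(g Idt$A$x$x)$(\<Lambda> q.
    g DPath$A$(\<Lambda> _. B)$x$x$q$u$u)$q$r$t$(g Tw$A$B$x$x$q$u$u$l))$(g Tw$A$B$x$x$r$u$u$l),
    Thm (\<Lambda> A B x q r t u l. g PathInd$(g Idt$A$x$x)$(\<Lambda> q r t. g Idt$(g DPath$A$(\<Lambda> _. B)$x$x$r$u$
    u)$(g Transp$(g Idt$A$x$x)$(\<Lambda> q. g DPath$A$(\<Lambda> _. B)$x$x$q$u$u)$q$r$t$(g Tw$A$B$x$x$q$u$u$l))$
    (g Tw$A$B$x$x$r$u$u$l))$(\<Lambda> q. g Refl$(g DPath$A$(\<Lambda> _. B)$x$x$q$u$u)$(g Transp$(g Idt$A$x$x)$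
    (\<Lambda> q. g DPath$A$(\<Lambda> _. B)$x$x$q$u$u)$q$q$(g Refl$(g Idt$A$x$x)$q)$(g Tw$A$B$x$x$q$u$u$l)))$q$r$t))"
| "dep_entry TwOver = (
    \<Pi> A:Ty. \<Pi> B:Ty. \<Pi> x:A. \<Pi> q:g Idt$A$x$x. \<Pi> r:g Idt$A$x$x. \<Pi> t:g Idt$(g Idt$A$x$x)$q$r. \<Pi>
    u:B. \<Pi> d:g DPath$A$(\<Lambda> _. B)$x$x$q$u$u. \<Pi> k:g Idt$B$u$u. g Idt$(g DPath$A$(\<Lambda> _. B)$x$x$q$
    u$u)$d$(g Tw$A$B$x$x$q$u$u$k) -> \<Pi> e:g DPath$A$(\<Lambda> _. B)$x$x$r$u$u. \<Pi> l:g Idt$B$u$u. g Idt$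
    (g DPath$A$(\<Lambda> _. B)$x$x$r$u$u)$e$(g Tw$A$B$x$x$r$u$u$l) -> g Idt$(g Idt$B$u$u)$k$l -> g Idt$(g DPath$A$
    (\<Lambda> _. B)$x$x$r$u$u)$(g Transp$(g Idt$A$x$x)$(\<Lambda> q. g DPath$A$(\<Lambda> _. B)$x$x$q$u$u)$q$r$t$
    d)$e,
    Thm (\<Lambda> A B x q r t u d k h e l i m. g Conc$(g DPath$A$(\<Lambda> _. B)$x$x$r$u$u)$(g Transp$(g Idt$A$x$x)$
    (\<Lambda> q. g DPath$A$(\<Lambda> _. B)$x$x$q$u$u)$q$r$t$d)$(g Transp$(g Idt$A$x$x)$(\<Lambda> q. g DPath$A$
    (\<Lambda> _. B)$x$x$q$u$u)$q$r$t$(g Tw$A$B$x$x$q$u$u$k))$e$(g Ap$(g DPath$A$(\<Lambda> _. B)$x$x$q$u$u)$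
    (g DPath$A$(\<Lambda> _. B)$x$x$r$u$u)$d$(g Tw$A$B$x$x$q$u$u$k)$(\<Lambda> d. g Transp$(g Idt$A$x$x)$(\<Lambda>
    q. g DPath$A$(\<Lambda> _. B)$x$x$q$u$u)$q$r$t$d)$h)$(g Conc$(g DPath$A$(\<Lambda> _. B)$x$x$r$u$u)$(g Transp$
    (g Idt$A$x$x)$(\<Lambda> q. g DPath$A$(\<Lambda> _. B)$x$x$q$u$u)$q$r$t$(g Tw$A$B$x$x$q$u$u$k))$(g Tw$A$B$x$x$r$
    u$u$k)$e$(g TwOverRefl$A$B$x$q$r$t$u$k)$(g Conc$(g DPath$A$(\<Lambda> _. B)$x$x$r$u$u)$(g Tw$A$B$x$x$r$u$u$k)$
    (g Tw$A$B$x$x$r$u$u$l)$e$(g Ap$(g Idt$B$u$u)$(g DPath$A$(\<Lambda> _. B)$x$x$r$u$u)$k$l$(\<Lambda> l. g Tw$A$B$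
    x$x$r$u$u$l)$m)$(g Inv$(g DPath$A$(\<Lambda> _. B)$x$x$r$u$u)$e$(g Tw$A$B$x$x$r$u$u$l)$i)))))"

subsection \<open>The type X\<close>

primrec cell_entry :: "cell_name \<Rightarrow> entry" where
  "cell_entry XT = (
    Ty,
    Prim CX)"
| "cell_entry PtX = (
    g XT,
    Prim CPt)"
| "cell_entry LoopA = (
    g Idt$g XT$g PtX$g PtX,
    Prim CA)"
| "cell_entry LoopB = (
    g Idt$g XT$g PtX$g PtX,
    Prim CB)"
| "cell_entry RelR = (
    g Idt$(g Idt$g XT$g PtX$g PtX)$(g Pow5$g XT$g PtX$g LoopA)$(g Pow3$g XT$g PtX$g LoopB),
    Prim CR)"
| "cell_entry RelS = (
    g Idt$(g Idt$g XT$g PtX$g PtX)$(g Pow3$g XT$g PtX$g LoopB)$(g Pow2$g XT$g PtX$(g Conc$g XT$g PtX$g PtX$g PtX$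
    g LoopA$g LoopB)),
    Prim CS)"
| "cell_entry DataR = (
    \<Pi> P:(g XT -> Ty). \<Pi> p:P$g PtX. g DPath$g XT$P$g PtX$g PtX$g LoopA$p$p -> g DPath$g XT$P$g PtX$g PtX$g LoopB$
    p$p -> Ty,
    Def (\<Lambda> P p c d. g Idt$(g DPath$g XT$P$g PtX$g PtX$(g Pow3$g XT$g PtX$g LoopB)$p$p)$(g Transp$(g Idt$g XT$
    g PtX$g PtX)$(\<Lambda> q. g DPath$g XT$P$g PtX$g PtX$q$p$p)$(g Pow5$g XT$g PtX$g LoopA)$(g Pow3$g XT$g PtX$
    g LoopB)$g RelR$(g Dpow5$g XT$P$g PtX$g LoopA$p$c))$(g Dpow3$g XT$P$g PtX$g LoopB$p$d)))"
| "cell_entry DataS = (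
    \<Pi> P:(g XT -> Ty). \<Pi> p:P$g PtX. g DPath$g XT$P$g PtX$g PtX$g LoopA$p$p -> g DPath$g XT$P$g PtX$g PtX$g LoopB$
    p$p -> Ty,
    Def (\<Lambda> P p c d. g Idt$(g DPath$g XT$P$g PtX$g PtX$(g Pow2$g XT$g PtX$(g Conc$g XT$g PtX$g PtX$g PtX$g LoopA$
    g LoopB))$p$p)$(g Transp$(g Idt$g XT$g PtX$g PtX)$(\<Lambda> q. g DPath$g XT$P$g PtX$g PtX$q$p$p)$(g Pow3$g XT$
    g PtX$g LoopB)$(g Pow2$g XT$g PtX$(g Conc$g XT$g PtX$g PtX$g PtX$g LoopA$g LoopB))$g RelS$(g Dpow3$g XT$P$g PtX$
    g LoopB$p$d))$(g Dpow2$g XT$P$g PtX$(g Conc$g XT$g PtX$g PtX$g PtX$g LoopA$g LoopB)$p$(g Dconc$g XT$P$g PtX$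
    g PtX$g PtX$g LoopA$g LoopB$p$p$p$c$d))))"
| "cell_entry IndX = (
    \<Pi> P:(g XT -> Ty). \<Pi> p:P$g PtX. \<Pi> c:g DPath$g XT$P$g PtX$g PtX$g LoopA$p$p. \<Pi> d:g DPath$g XT$P$g PtX$
    g PtX$g LoopB$p$p. g DataR$P$p$c$d -> g DataS$P$p$c$d -> \<Pi> x:g XT. P$x,
    Prim CXInd)"
| "cell_entry IndXA = (
    \<Pi> P:(g XT -> Ty). \<Pi> p:P$g PtX. \<Pi> c:g DPath$g XT$P$g PtX$g PtX$g LoopA$p$p. \<Pi> d:g DPath$g XT$P$g PtX$
    g PtX$g LoopB$p$p. \<Pi> r:g DataR$P$p$c$d. \<Pi> s:g DataS$P$p$c$d. g Idt$(g DPath$g XT$P$g PtX$g PtX$g LoopA$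
    p$p)$(g Apd$g XT$P$(g IndX$P$p$c$d$r$s)$g PtX$g PtX$g LoopA)$c,
    Prim CXIndA)"
| "cell_entry IndXB = (
    \<Pi> P:(g XT -> Ty). \<Pi> p:P$g PtX. \<Pi> c:g DPath$g XT$P$g PtX$g PtX$g LoopA$p$p. \<Pi> d:g DPath$g XT$P$g PtX$
    g PtX$g LoopB$p$p. \<Pi> r:g DataR$P$p$c$d. \<Pi> s:g DataS$P$p$c$d. g Idt$(g DPath$g XT$P$g PtX$g PtX$g LoopB$
    p$p)$(g Apd$g XT$P$(g IndX$P$p$c$d$r$s)$g PtX$g PtX$g LoopB)$d,
    Prim CXIndB)"
\<comment> \<open>The data over the loops exist because \<open>P\<close> is a family of
  propositions, those over the relations because propositions are sets.\<close>
| "cell_entry IndXProp = (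
    \<Pi> P:(g XT -> Ty). (\<Pi> x:g XT. g IsProp$(P$x)) -> P$g PtX -> \<Pi> x:g XT. P$x,
    Thm (\<Lambda> P h u. g IndX$P$u$(h$g PtX$(g Transp$g XT$P$g PtX$g PtX$g LoopA$u)$u)$(h$g PtX$(g Transp$g XT$P$
    g PtX$g PtX$g LoopB$u)$u)$(g PropSet$(P$g PtX)$(h$g PtX)$(g Transp$g XT$P$g PtX$g PtX$(g Pow3$g XT$g PtX$
    g LoopB)$u)$u$(g Transp$(g Idt$g XT$g PtX$g PtX)$(\<Lambda> q. g DPath$g XT$P$g PtX$g PtX$q$u$u)$(g Pow5$g XT$
    g PtX$g LoopA)$(g Pow3$g XT$g PtX$g LoopB)$g RelR$(g Dpow5$g XT$P$g PtX$g LoopA$u$(h$g PtX$(g Transp$g XT$P$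
    g PtX$g PtX$g LoopA$u)$u)))$(g Dpow3$g XT$P$g PtX$g LoopB$u$(h$g PtX$(g Transp$g XT$P$g PtX$g PtX$g LoopB$u)$
    u)))$(g PropSet$(P$g PtX)$(h$g PtX)$(g Transp$g XT$P$g PtX$g PtX$(g Pow2$g XT$g PtX$(g Conc$g XT$g PtX$g PtX$
    g PtX$g LoopA$g LoopB))$u)$u$(g Transp$(g Idt$g XT$g PtX$g PtX)$(\<Lambda> q. g DPath$g XT$P$g PtX$g PtX$q$u$u)$
    (g Pow3$g XT$g PtX$g LoopB)$(g Pow2$g XT$g PtX$(g Conc$g XT$g PtX$g PtX$g PtX$g LoopA$g LoopB))$g RelS$(g Dpow3$
    g XT$P$g PtX$g LoopB$u$(h$g PtX$(g Transp$g XT$P$g PtX$g PtX$g LoopB$u)$u)))$(g Dpow2$g XT$P$g PtX$(g Conc$g XT$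
    g PtX$g PtX$g PtX$g LoopA$g LoopB)$u$(g Dconc$g XT$P$g PtX$g PtX$g PtX$g LoopA$g LoopB$u$u$u$(h$g PtX$(g Transp$
    g XT$P$g PtX$g PtX$g LoopA$u)$u)$(h$g PtX$(g Transp$g XT$P$g PtX$g PtX$g LoopB$u)$u))))))"
\<comment> \<open>Both sides of the relation are powers of twisted loops; by \<open>TwPow5\<close>
  and \<open>TwPow3\<close> they are twists of powers in \<open>B\<close>, where \<open>h\<close>
  equates them.\<close>
| "cell_entry RecR = (
    \<Pi> B:Ty. \<Pi> b:B. \<Pi> k:g Idt$B$b$b. \<Pi> l:g Idt$B$b$b. g Idt$(g Idt$B$b$b)$(g Pow5$B$b$k)$(g Pow3$B$b$l)
    -> g DataR$(\<Lambda> _. B)$b$(g Tw$g XT$B$g PtX$g PtX$g LoopA$b$b$k)$(g Tw$g XT$B$g PtX$g PtX$g LoopB$b$b$l),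
    Thm (\<Lambda> B b k l h. g TwOver$g XT$B$g PtX$(g Pow5$g XT$g PtX$g LoopA)$(g Pow3$g XT$g PtX$g LoopB)$g RelR$b$
    (g Dpow5$g XT$(\<Lambda> _. B)$g PtX$g LoopA$b$(g Tw$g XT$B$g PtX$g PtX$g LoopA$b$b$k))$(g Pow5$B$b$k)$
    (g TwPow5$g XT$B$g PtX$g LoopA$b$(g Tw$g XT$B$g PtX$g PtX$g LoopA$b$b$k)$k$(g Refl$(g DPath$g XT$(\<Lambda> _.
    B)$g PtX$g PtX$g LoopA$b$b)$(g Tw$g XT$B$g PtX$g PtX$g LoopA$b$b$k)))$(g Dpow3$g XT$(\<Lambda> _. B)$g PtX$
    g LoopB$b$(g Tw$g XT$B$g PtX$g PtX$g LoopB$b$b$l))$(g Pow3$B$b$l)$(g TwPow3$g XT$B$g PtX$g LoopB$b$(g Tw$g XT$B$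
    g PtX$g PtX$g LoopB$b$b$l)$l$(g Refl$(g DPath$g XT$(\<Lambda> _. B)$g PtX$g PtX$g LoopB$b$b)$(g Tw$g XT$B$g PtX$
    g PtX$g LoopB$b$b$l)))$h))"
| "cell_entry RecS = (
    \<Pi> B:Ty. \<Pi> b:B. \<Pi> k:g Idt$B$b$b. \<Pi> l:g Idt$B$b$b. g Idt$(g Idt$B$b$b)$(g Pow3$B$b$l)$(g Pow2$B$b$
    (g Conc$B$b$b$b$k$l)) -> g DataS$(\<Lambda> _. B)$b$(g Tw$g XT$B$g PtX$g PtX$g LoopA$b$b$k)$(g Tw$g XT$B$g PtX$
    g PtX$g LoopB$b$b$l),
    Thm (\<Lambda> B b k l h. g TwOver$g XT$B$g PtX$(g Pow3$g XT$g PtX$g LoopB)$(g Pow2$g XT$g PtX$(g Conc$g XT$g PtX$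
    g PtX$g PtX$g LoopA$g LoopB))$g RelS$b$(g Dpow3$g XT$(\<Lambda> _. B)$g PtX$g LoopB$b$(g Tw$g XT$B$g PtX$g PtX$
    g LoopB$b$b$l))$(g Pow3$B$b$l)$(g TwPow3$g XT$B$g PtX$g LoopB$b$(g Tw$g XT$B$g PtX$g PtX$g LoopB$b$b$l)$l$
    (g Refl$(g DPath$g XT$(\<Lambda> _. B)$g PtX$g PtX$g LoopB$b$b)$(g Tw$g XT$B$g PtX$g PtX$g LoopB$b$b$l)))$
    (g Dpow2$g XT$(\<Lambda> _. B)$g PtX$(g Conc$g XT$g PtX$g PtX$g PtX$g LoopA$g LoopB)$b$(g Dconc$g XT$(\<Lambda>
    _. B)$g PtX$g PtX$g PtX$g LoopA$g LoopB$b$b$b$(g Tw$g XT$B$g PtX$g PtX$g LoopA$b$b$k)$(g Tw$g XT$B$g PtX$g PtX$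
    g LoopB$b$b$l)))$(g Pow2$B$b$(g Conc$B$b$b$b$k$l))$(g TwPow2$g XT$B$g PtX$(g Conc$g XT$g PtX$g PtX$g PtX$
    g LoopA$g LoopB)$b$(g Dconc$g XT$(\<Lambda> _. B)$g PtX$g PtX$g PtX$g LoopA$g LoopB$b$b$b$(g Tw$g XT$B$g PtX$
    g PtX$g LoopA$b$b$k)$(g Tw$g XT$B$g PtX$g PtX$g LoopB$b$b$l))$(g Conc$B$b$b$b$k$l)$(g TwConc$g XT$B$g PtX$g PtX$
    g PtX$g LoopA$g LoopB$b$b$b$k$l))$h))"
\<comment> \<open>Transparent, so that its value at the point constructor is \<open>b\<close> by
  computation; the fibre lemmas below are typed with this.\<close>
| "cell_entry RecX = (
    \<Pi> B:Ty. \<Pi> b:B. \<Pi> k:g Idt$B$b$b. \<Pi> l:g Idt$B$b$b. g Idt$(g Idt$B$b$b)$(g Pow5$B$b$k)$(g Pow3$B$b$l)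
    -> g Idt$(g Idt$B$b$b)$(g Pow3$B$b$l)$(g Pow2$B$b$(g Conc$B$b$b$b$k$l)) -> g XT -> B,
    Def (\<Lambda> B b k l h i. g IndX$(\<Lambda> _. B)$b$(g Tw$g XT$B$g PtX$g PtX$g LoopA$b$b$k)$(g Tw$g XT$B$g PtX$
    g PtX$g LoopB$b$b$l)$(g RecR$B$b$k$l$h)$(g RecS$B$b$k$l$i)))"
\<comment> \<open>By induction on \<open>p\<close> the hypothesis becomes a path from reflexivity to
  \<open>l\<close>, since both \<open>Apd\<close> and \<open>Tw\<close> compute there; then
  \<open>l\<close> followed by \<open>v\<close> is \<open>v\<close>.\<close>
| "cell_entry FibMove = (
    \<Pi> A:Ty. \<Pi> B:Ty. \<Pi> f:(A -> B). \<Pi> c:B. \<Pi> x:A. \<Pi> y:A. \<Pi> p:g Idt$A$x$y. \<Pi> l:g Idt$B$(f$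
    x)$(f$y). g Idt$(g DPath$A$(\<Lambda> _. B)$x$y$p$(f$x)$(f$y))$(g Apd$A$(\<Lambda> _. B)$f$x$y$p)$(g Tw$A$B$x$y$
    p$(f$x)$(f$y)$l) -> \<Pi> v:g Idt$B$(f$y)$c. g Idt$(g Fib$A$B$f$c)$(g Pr$A$(\<Lambda> x. g Idt$B$(f$x)$c)$x$
    (g Conc$B$(f$x)$(f$y)$c$l$v))$(g Pr$A$(\<Lambda> x. g Idt$B$(f$x)$c)$y$v),
    Thm (\<Lambda> A B f c x y p. g PathInd$A$(\<Lambda> x y p. \<Pi> l:g Idt$B$(f$x)$(f$y). g Idt$(g DPath$A$
    (\<Lambda> _. B)$x$y$p$(f$x)$(f$y))$(g Apd$A$(\<Lambda> _. B)$f$x$y$p)$(g Tw$A$B$x$y$p$(f$x)$(f$y)$l) -> \<Pi>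
    v:g Idt$B$(f$y)$c. g Idt$(g Fib$A$B$f$c)$(g Pr$A$(\<Lambda> x. g Idt$B$(f$x)$c)$x$(g Conc$B$(f$x)$(f$y)$c$l$v))$
    (g Pr$A$(\<Lambda> x. g Idt$B$(f$x)$c)$y$v))$(\<Lambda> x l h v. g Conc$(g Fib$A$B$f$c)$(g Pr$A$(\<Lambda> x.
    g Idt$B$(f$x)$c)$x$(g Conc$B$(f$x)$(f$x)$c$l$v))$(g Pr$A$(\<Lambda> x. g Idt$B$(f$x)$c)$x$(g Conc$B$(f$x)$(f$x)$
    c$(g Refl$B$(f$x))$v))$(g Pr$A$(\<Lambda> x. g Idt$B$(f$x)$c)$x$v)$(g Ap$(g Idt$B$(f$x)$(f$x))$(g Fib$A$B$f$c)$
    l$(g Refl$B$(f$x))$(\<Lambda> l. g Pr$A$(\<Lambda> x. g Idt$B$(f$x)$c)$x$(g Conc$B$(f$x)$(f$x)$c$l$v))$(g Inv$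
    (g Idt$B$(f$x)$(f$x))$(g Refl$B$(f$x))$l$h))$(g Ap$(g Idt$B$(f$x)$c)$(g Fib$A$B$f$c)$(g Conc$B$(f$x)$(f$x)$c$
    (g Refl$B$(f$x))$v)$v$(\<Lambda> v. g Pr$A$(\<Lambda> x. g Idt$B$(f$x)$c)$x$v)$(g ReflConc$B$(f$x)$c$v)))$x$y$p))"
\<comment> \<open>The computation rule for \<open>a\<close> supplies the hypothesis of
  \<open>FibMove\<close>: the action of the recursor on \<open>a\<close> is the twist of
  \<open>k\<close>.\<close>
| "cell_entry MoveA = (
    \<Pi> B:Ty. \<Pi> b:B. \<Pi> k:g Idt$B$b$b. \<Pi> l:g Idt$B$b$b. \<Pi> h:g Idt$(g Idt$B$b$b)$(g Pow5$B$b$k)$(g Pow3$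
    B$b$l). \<Pi> i:g Idt$(g Idt$B$b$b)$(g Pow3$B$b$l)$(g Pow2$B$b$(g Conc$B$b$b$b$k$l)). \<Pi> v:g Idt$B$b$b.
    g Idt$(g Fib$g XT$B$(g RecX$B$b$k$l$h$i)$b)$(g Pr$g XT$(\<Lambda> x. g Idt$B$(g RecX$B$b$k$l$h$i$x)$b)$g PtX$
    (g Conc$B$(g RecX$B$b$k$l$h$i$g PtX)$b$b$k$v))$(g Pr$g XT$(\<Lambda> x. g Idt$B$(g RecX$B$b$k$l$h$i$x)$b)$g PtX$
    v),
    Thm (\<Lambda> B b k l h i v. g FibMove$g XT$B$(g RecX$B$b$k$l$h$i)$b$g PtX$g PtX$g LoopA$k$(g IndXA$(\<Lambda> _.
    B)$(g RecX$B$b$k$l$h$i$g PtX)$(g Tw$g XT$B$g PtX$g PtX$g LoopA$b$b$k)$(g Tw$g XT$B$g PtX$g PtX$g LoopB$b$b$l)$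
    (g RecR$B$b$k$l$h)$(g RecS$B$b$k$l$i))$v))"
| "cell_entry MoveB = (
    \<Pi> B:Ty. \<Pi> b:B. \<Pi> k:g Idt$B$b$b. \<Pi> l:g Idt$B$b$b. \<Pi> h:g Idt$(g Idt$B$b$b)$(g Pow5$B$b$k)$(g Pow3$
    B$b$l). \<Pi> i:g Idt$(g Idt$B$b$b)$(g Pow3$B$b$l)$(g Pow2$B$b$(g Conc$B$b$b$b$k$l)). \<Pi> v:g Idt$B$b$b.
    g Idt$(g Fib$g XT$B$(g RecX$B$b$k$l$h$i)$b)$(g Pr$g XT$(\<Lambda> x. g Idt$B$(g RecX$B$b$k$l$h$i$x)$b)$g PtX$
    (g Conc$B$(g RecX$B$b$k$l$h$i$g PtX)$b$b$l$v))$(g Pr$g XT$(\<Lambda> x. g Idt$B$(g RecX$B$b$k$l$h$i$x)$b)$g PtX$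
    v),
    Thm (\<Lambda> B b k l h i v. g FibMove$g XT$B$(g RecX$B$b$k$l$h$i)$b$g PtX$g PtX$g LoopB$l$(g IndXB$(\<Lambda> _.
    B)$(g RecX$B$b$k$l$h$i$g PtX)$(g Tw$g XT$B$g PtX$g PtX$g LoopA$b$b$k)$(g Tw$g XT$B$g PtX$g PtX$g LoopB$b$b$l)$
    (g RecR$B$b$k$l$h)$(g RecS$B$b$k$l$i))$v))"
| "cell_entry TruncContr = (
    \<Pi> F:Ty. \<Pi> c:F. (\<Pi> w:F. g Idt$(g Trunc$F)$(g Tr$F$c)$(g Tr$F$w)) -> g IsContr$(g Trunc$F),
    Thm (\<Lambda> F c k. g Pr$(g Trunc$F)$(\<Lambda> x. \<Pi> y:g Trunc$F. g Idt$(g Trunc$F)$x$y)$(g Tr$F$c)$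
    (\<Lambda> z. g TruncInd$F$(\<Lambda> z. g Idt$(g Trunc$F)$(g Tr$F$c)$z)$(\<Lambda> z. g PropSet$(g Idt$
    (g Trunc$F)$(g Tr$F$c)$z)$(g TruncSet$F$(g Tr$F$c)$z))$k$z)))"
| "cell_entry FibInd = (
    \<Pi> B:Ty. \<Pi> f:(g XT -> B). \<Pi> b:B. \<Pi> P:(g Fib$g XT$B$f$b -> Ty). (\<Pi> w:g Fib$g XT$B$f$b. g IsProp$
    (P$w)) -> (\<Pi> v:g Idt$B$(f$g PtX)$b. P$(g Pr$g XT$(\<Lambda> x. g Idt$B$(f$x)$b)$g PtX$v)) -> \<Pi> w:g Fib$
    g XT$B$f$b. P$w,
    Thm (\<Lambda> B f b P h k w. g SigRec$g XT$(\<Lambda> x. g Idt$B$(f$x)$b)$P$(\<Lambda> x v. g IndXProp$(\<Lambda>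
    x. \<Pi> v:g Idt$B$(f$x)$b. P$(g Pr$g XT$(\<Lambda> x. g Idt$B$(f$x)$b)$x$v))$(\<Lambda> x. g PiProp$(g Idt$B$
    (f$x)$b)$(\<Lambda> v. P$(g Pr$g XT$(\<Lambda> x. g Idt$B$(f$x)$b)$x$v))$(\<Lambda> v. h$(g Pr$g XT$(\<Lambda>
    x. g Idt$B$(f$x)$b)$x$v)))$k$x$v)$w))"
| "cell_entry FibContr = (
    \<Pi> B:Ty. \<Pi> f:(g XT -> B). \<Pi> b:B. \<Pi> o':g Idt$B$(f$g PtX)$b. (\<Pi> v:g Idt$B$(f$g PtX)$b. g Idt$
    (g Trunc$(g Fib$g XT$B$f$b))$(g Tr$(g Fib$g XT$B$f$b)$(g Pr$g XT$(\<Lambda> x. g Idt$B$(f$x)$b)$g PtX$o'))$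
    (g Tr$(g Fib$g XT$B$f$b)$(g Pr$g XT$(\<Lambda> x. g Idt$B$(f$x)$b)$g PtX$v))) -> g IsContr$(g Trunc$(g Fib$g XT$
    B$f$b)),
    Thm (\<Lambda> B f b o' k. g TruncContr$(g Fib$g XT$B$f$b)$(g Pr$g XT$(\<Lambda> x. g Idt$B$(f$x)$b)$g PtX$o')$
    (g FibInd$B$f$b$(\<Lambda> w. g Idt$(g Trunc$(g Fib$g XT$B$f$b))$(g Tr$(g Fib$g XT$B$f$b)$(g Pr$g XT$(\<Lambda>
    x. g Idt$B$(f$x)$b)$g PtX$o'))$(g Tr$(g Fib$g XT$B$f$b)$w))$(\<Lambda> w. g TruncSet$(g Fib$g XT$B$f$b)$(g Tr$
    (g Fib$g XT$B$f$b)$(g Pr$g XT$(\<Lambda> x. g Idt$B$(f$x)$b)$g PtX$o'))$(g Tr$(g Fib$g XT$B$f$b)$w))$k)))"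
| "cell_entry Transfer = (
    \<Pi> F:Ty. \<Pi> c:F. \<Pi> x:F. \<Pi> y:F. g Idt$F$x$y -> g Idt$(g Trunc$F)$(g Tr$F$c)$(g Tr$F$x) -> g Idt$
    (g Trunc$F)$(g Tr$F$c)$(g Tr$F$y),
    Thm (\<Lambda> F c x y p e. g Conc$(g Trunc$F)$(g Tr$F$c)$(g Tr$F$x)$(g Tr$F$y)$e$(g Ap$F$(g Trunc$F)$x$y$
    (\<Lambda> w. g Tr$F$w)$p)))"
\<comment> \<open>Generation enters as an induction principle over families \<open>S\<close> of
  loops. It is applied to the identity, in the truncated fibre, of the point given by
  \<open>o'\<close> with the one given by \<open>v\<close>.\<close>
| "cell_entry FibPtContr = (
    \<Pi> B:Ty. \<Pi> b:B. \<Pi> k:g Idt$B$b$b. \<Pi> l:g Idt$B$b$b. \<Pi> h:g Idt$(g Idt$B$b$b)$(g Pow5$B$b$k)$(g Pow3$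
    B$b$l). \<Pi> i:g Idt$(g Idt$B$b$b)$(g Pow3$B$b$l)$(g Pow2$B$b$(g Conc$B$b$b$b$k$l)). \<Pi> o':g Idt$B$b$b.
    (\<Pi> S:(g Idt$B$b$b -> Ty). (\<Pi> v:g Idt$B$b$b. S$(g Conc$B$b$b$b$k$v) -> S$v) -> (\<Pi> v:g Idt$B$b$b. S$
    (g Conc$B$b$b$b$l$v) -> S$v) -> S$o' -> \<Pi> v:g Idt$B$b$b. S$v) -> g IsContr$(g Trunc$(g Fib$g XT$B$(g RecX$B$
    b$k$l$h$i)$b)),
    Thm (\<Lambda> B b k l h i o' g'. g FibContr$B$(g RecX$B$b$k$l$h$i)$b$o'$(g'$(\<Lambda> v. g Idt$(g Trunc$(g Fib$
    g XT$B$(g RecX$B$b$k$l$h$i)$b))$(g Tr$(g Fib$g XT$B$(g RecX$B$b$k$l$h$i)$b)$(g Pr$g XT$(\<Lambda> x. g Idt$B$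
    (g RecX$B$b$k$l$h$i$x)$b)$g PtX$o'))$(g Tr$(g Fib$g XT$B$(g RecX$B$b$k$l$h$i)$b)$(g Pr$g XT$(\<Lambda> x. g Idt$
    B$(g RecX$B$b$k$l$h$i$x)$b)$g PtX$v)))$(\<Lambda> v. g Transfer$(g Fib$g XT$B$(g RecX$B$b$k$l$h$i)$b)$(g Pr$
    g XT$(\<Lambda> x. g Idt$B$(g RecX$B$b$k$l$h$i$x)$b)$g PtX$o')$(g Pr$g XT$(\<Lambda> x. g Idt$B$(g RecX$B$b$k$l$
    h$i$x)$b)$g PtX$(g Conc$B$b$b$b$k$v))$(g Pr$g XT$(\<Lambda> x. g Idt$B$(g RecX$B$b$k$l$h$i$x)$b)$g PtX$v)$
    (g MoveA$B$b$k$l$h$i$v))$(\<Lambda> v. g Transfer$(g Fib$g XT$B$(g RecX$B$b$k$l$h$i)$b)$(g Pr$g XT$(\<Lambda>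
    x. g Idt$B$(g RecX$B$b$k$l$h$i$x)$b)$g PtX$o')$(g Pr$g XT$(\<Lambda> x. g Idt$B$(g RecX$B$b$k$l$h$i$x)$b)$g PtX$
    (g Conc$B$b$b$b$l$v))$(g Pr$g XT$(\<Lambda> x. g Idt$B$(g RecX$B$b$k$l$h$i$x)$b)$g PtX$v)$(g MoveB$B$b$k$l$h$i$
    v))$(g Refl$(g Trunc$(g Fib$g XT$B$(g RecX$B$b$k$l$h$i)$b))$(g Tr$(g Fib$g XT$B$(g RecX$B$b$k$l$h$i)$b)$(g Pr$
    g XT$(\<Lambda> x. g Idt$B$(g RecX$B$b$k$l$h$i$x)$b)$g PtX$o'))))))"

subsection \<open>Loops of a classifying type\<close>

primrec loop_entry :: "loop_name \<Rightarrow> entry" where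
  "loop_entry ActConc = (
    \<Pi> B:Ty. \<Pi> b:B. \<Pi> h:(g Idt$B$b$b -> g AltFive). (\<Pi> p:g Idt$B$b$b. \<Pi> q:g Idt$B$b$b. g Idt$(g Fin5
    -> g Fin5)$(g Perm$(h$(g Conc$B$b$b$b$p$q)))$(\<Lambda> x. g Perm$(h$p)$(g Perm$(h$q)$x))) -> \<Pi> p:g Idt$B$b$
    b. \<Pi> q:g Idt$B$b$b. \<Pi> x:g Fin5. g Idt$g Fin5$(g Perm$(h$(g Conc$B$b$b$b$p$q))$x)$(g Perm$(h$p)$(g Perm$
    (h$q)$x)),
    Thm (\<Lambda> B b h mul p q x. g Happly$g Fin5$(\<Lambda> _. g Fin5)$(g Perm$(h$(g Conc$B$b$b$b$p$q)))$(\<Lambda>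
    x. g Perm$(h$p)$(g Perm$(h$q)$x))$(mul$p$q)$x))"
| "loop_entry ActLeft = (
    \<Pi> B:Ty. \<Pi> b:B. \<Pi> h:(g Idt$B$b$b -> g AltFive). (\<Pi> p:g Idt$B$b$b. \<Pi> q:g Idt$B$b$b. g Idt$(g Fin5
    -> g Fin5)$(g Perm$(h$(g Conc$B$b$b$b$p$q)))$(\<Lambda> x. g Perm$(h$p)$(g Perm$(h$q)$x))) -> \<Pi> l:g Idt$B$b$
    b. \<Pi> s:(g Fin5 -> g Fin5). (\<Pi> x:g Fin5. g Idt$g Fin5$(g Perm$(h$l)$x)$(s$x)) -> \<Pi> q:g Idt$B$b$b.
    \<Pi> x:g Fin5. g Idt$g Fin5$(g Perm$(h$(g Conc$B$b$b$b$l$q))$x)$(s$(g Perm$(h$q)$x)),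
    Thm (\<Lambda> B b h mul l s k q x. g Conc$g Fin5$(g Perm$(h$(g Conc$B$b$b$b$l$q))$x)$(g Perm$(h$l)$(g Perm$(h$q)$
    x))$(s$(g Perm$(h$q)$x))$(g ActConc$B$b$h$mul$l$q$x)$(k$(g Perm$(h$q)$x))))"
| "loop_entry ActRight = (
    \<Pi> B:Ty. \<Pi> b:B. \<Pi> h:(g Idt$B$b$b -> g AltFive). (\<Pi> p:g Idt$B$b$b. \<Pi> q:g Idt$B$b$b. g Idt$(g Fin5
    -> g Fin5)$(g Perm$(h$(g Conc$B$b$b$b$p$q)))$(\<Lambda> x. g Perm$(h$p)$(g Perm$(h$q)$x))) -> \<Pi> l:g Idt$B$b$
    b. \<Pi> s:(g Fin5 -> g Fin5). (\<Pi> x:g Fin5. g Idt$g Fin5$(g Perm$(h$l)$x)$(s$x)) -> \<Pi> r:g Idt$B$b$b.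
    \<Pi> x:g Fin5. g Idt$g Fin5$(g Perm$(h$(g Conc$B$b$b$b$r$l))$x)$(g Perm$(h$r)$(s$x)),
    Thm (\<Lambda> B b h mul l s k r x. g Conc$g Fin5$(g Perm$(h$(g Conc$B$b$b$b$r$l))$x)$(g Perm$(h$r)$(g Perm$(h$l)$
    x))$(g Perm$(h$r)$(s$x))$(g ActConc$B$b$h$mul$r$l$x)$(g Ap$g Fin5$g Fin5$(g Perm$(h$l)$x)$(s$x)$(\<Lambda> y.
    g Perm$(h$r)$y)$(k$x))))"
\<comment> \<open>The permutation of the trivial loop stays in the formula and is carried through
  all powers; in each relation it occurs identically on both sides.\<close>
| "loop_entry ActPow0 = (
    \<Pi> B:Ty. \<Pi> b:B. \<Pi> h:(g Idt$B$b$b -> g AltFive). (\<Pi> p:g Idt$B$b$b. \<Pi> q:g Idt$B$b$b. g Idt$(g Fin5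
    -> g Fin5)$(g Perm$(h$(g Conc$B$b$b$b$p$q)))$(\<Lambda> x. g Perm$(h$p)$(g Perm$(h$q)$x))) -> \<Pi> l:g Idt$B$b$
    b. \<Pi> s:(g Fin5 -> g Fin5). (\<Pi> x:g Fin5. g Idt$g Fin5$(g Perm$(h$l)$x)$(s$x)) -> \<Pi> x:g Fin5. g Idt$
    g Fin5$(g Perm$(h$(g Pow0$B$b$l))$x)$(g Perm$(h$(g Refl$B$b))$x),
    Thm (\<Lambda> B b h _ l _ _ x. g Refl$g Fin5$(g Perm$(h$(g Pow0$B$b$l))$x)))"
| "loop_entry ActPow1 = (
    \<Pi> B:Ty. \<Pi> b:B. \<Pi> h:(g Idt$B$b$b -> g AltFive). (\<Pi> p:g Idt$B$b$b. \<Pi> q:g Idt$B$b$b. g Idt$(g Fin5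
    -> g Fin5)$(g Perm$(h$(g Conc$B$b$b$b$p$q)))$(\<Lambda> x. g Perm$(h$p)$(g Perm$(h$q)$x))) -> \<Pi> l:g Idt$B$b$
    b. \<Pi> s:(g Fin5 -> g Fin5). (\<Pi> x:g Fin5. g Idt$g Fin5$(g Perm$(h$l)$x)$(s$x)) -> \<Pi> x:g Fin5. g Idt$
    g Fin5$(g Perm$(h$(g Pow1$B$b$l))$x)$(g Perm$(h$(g Refl$B$b))$(s$x)),
    Thm (\<Lambda> B b h mul l s k x. g Conc$g Fin5$(g Perm$(h$(g Pow1$B$b$l))$x)$(g Perm$(h$(g Pow0$B$b$l))$(s$x))$
    (g Perm$(h$(g Refl$B$b))$(s$x))$(g ActRight$B$b$h$mul$l$s$k$(g Pow0$B$b$l)$x)$(g ActPow0$B$b$h$mul$l$s$k$(s$x))))"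
| "loop_entry ActPow2 = (
    \<Pi> B:Ty. \<Pi> b:B. \<Pi> h:(g Idt$B$b$b -> g AltFive). (\<Pi> p:g Idt$B$b$b. \<Pi> q:g Idt$B$b$b. g Idt$(g Fin5
    -> g Fin5)$(g Perm$(h$(g Conc$B$b$b$b$p$q)))$(\<Lambda> x. g Perm$(h$p)$(g Perm$(h$q)$x))) -> \<Pi> l:g Idt$B$b$
    b. \<Pi> s:(g Fin5 -> g Fin5). (\<Pi> x:g Fin5. g Idt$g Fin5$(g Perm$(h$l)$x)$(s$x)) -> \<Pi> x:g Fin5. g Idt$
    g Fin5$(g Perm$(h$(g Pow2$B$b$l))$x)$(g Perm$(h$(g Refl$B$b))$(s$(s$x))),
    Thm (\<Lambda> B b h mul l s k x. g Conc$g Fin5$(g Perm$(h$(g Pow2$B$b$l))$x)$(g Perm$(h$(g Pow1$B$b$l))$(s$x))$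
    (g Perm$(h$(g Refl$B$b))$(s$(s$x)))$(g ActRight$B$b$h$mul$l$s$k$(g Pow1$B$b$l)$x)$(g ActPow1$B$b$h$mul$l$s$k$(s$
    x))))"
| "loop_entry ActPow3 = (
    \<Pi> B:Ty. \<Pi> b:B. \<Pi> h:(g Idt$B$b$b -> g AltFive). (\<Pi> p:g Idt$B$b$b. \<Pi> q:g Idt$B$b$b. g Idt$(g Fin5
    -> g Fin5)$(g Perm$(h$(g Conc$B$b$b$b$p$q)))$(\<Lambda> x. g Perm$(h$p)$(g Perm$(h$q)$x))) -> \<Pi> l:g Idt$B$b$
    b. \<Pi> s:(g Fin5 -> g Fin5). (\<Pi> x:g Fin5. g Idt$g Fin5$(g Perm$(h$l)$x)$(s$x)) -> \<Pi> x:g Fin5. g Idt$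
    g Fin5$(g Perm$(h$(g Pow3$B$b$l))$x)$(g Perm$(h$(g Refl$B$b))$(s$(s$(s$x)))),
    Thm (\<Lambda> B b h mul l s k x. g Conc$g Fin5$(g Perm$(h$(g Pow3$B$b$l))$x)$(g Perm$(h$(g Pow2$B$b$l))$(s$x))$
    (g Perm$(h$(g Refl$B$b))$(s$(s$(s$x))))$(g ActRight$B$b$h$mul$l$s$k$(g Pow2$B$b$l)$x)$(g ActPow2$B$b$h$mul$l$s$
    k$(s$x))))"
| "loop_entry ActPow4 = (
    \<Pi> B:Ty. \<Pi> b:B. \<Pi> h:(g Idt$B$b$b -> g AltFive). (\<Pi> p:g Idt$B$b$b. \<Pi> q:g Idt$B$b$b. g Idt$(g Fin5
    -> g Fin5)$(g Perm$(h$(g Conc$B$b$b$b$p$q)))$(\<Lambda> x. g Perm$(h$p)$(g Perm$(h$q)$x))) -> \<Pi> l:g Idt$B$b$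
    b. \<Pi> s:(g Fin5 -> g Fin5). (\<Pi> x:g Fin5. g Idt$g Fin5$(g Perm$(h$l)$x)$(s$x)) -> \<Pi> x:g Fin5. g Idt$
    g Fin5$(g Perm$(h$(g Pow4$B$b$l))$x)$(g Perm$(h$(g Refl$B$b))$(s$(s$(s$(s$x))))),
    Thm (\<Lambda> B b h mul l s k x. g Conc$g Fin5$(g Perm$(h$(g Pow4$B$b$l))$x)$(g Perm$(h$(g Pow3$B$b$l))$(s$x))$
    (g Perm$(h$(g Refl$B$b))$(s$(s$(s$(s$x)))))$(g ActRight$B$b$h$mul$l$s$k$(g Pow3$B$b$l)$x)$(g ActPow3$B$b$h$mul$
    l$s$k$(s$x))))"
| "loop_entry ActPow5 = (
    \<Pi> B:Ty. \<Pi> b:B. \<Pi> h:(g Idt$B$b$b -> g AltFive). (\<Pi> p:g Idt$B$b$b. \<Pi> q:g Idt$B$b$b. g Idt$(g Fin5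
    -> g Fin5)$(g Perm$(h$(g Conc$B$b$b$b$p$q)))$(\<Lambda> x. g Perm$(h$p)$(g Perm$(h$q)$x))) -> \<Pi> l:g Idt$B$b$
    b. \<Pi> s:(g Fin5 -> g Fin5). (\<Pi> x:g Fin5. g Idt$g Fin5$(g Perm$(h$l)$x)$(s$x)) -> \<Pi> x:g Fin5. g Idt$
    g Fin5$(g Perm$(h$(g Pow5$B$b$l))$x)$(g Perm$(h$(g Refl$B$b))$(s$(s$(s$(s$(s$x)))))),
    Thm (\<Lambda> B b h mul l s k x. g Conc$g Fin5$(g Perm$(h$(g Pow5$B$b$l))$x)$(g Perm$(h$(g Pow4$B$b$l))$(s$x))$
    (g Perm$(h$(g Refl$B$b))$(s$(s$(s$(s$(s$x))))))$(g ActRight$B$b$h$mul$l$s$k$(g Pow4$B$b$l)$x)$(g ActPow4$B$b$h$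
    mul$l$s$k$(s$x))))"
\<comment> \<open>The equivalence \<open>h\<close> is injective, and so is the passage from an
  element of the group to its function.\<close>
| "loop_entry LoopEq = (
    \<Pi> B:Ty. \<Pi> b:B. \<Pi> h:(g Idt$B$b$b -> g AltFive). g IsEquiv$(g Idt$B$b$b)$g AltFive$h -> \<Pi> p:g Idt$B$b$
    b. \<Pi> q:g Idt$B$b$b. (\<Pi> x:g Fin5. g Idt$g Fin5$(g Perm$(h$p)$x)$(g Perm$(h$q)$x)) -> g Idt$(g Idt$B$b$b)$
    p$q,
    Thm (\<Lambda> B b h e p q k. g EquivInj$(g Idt$B$b$b)$g AltFive$h$e$p$q$(g PermInj$(h$p)$(h$q)$(g Funext$g Fin5$
    (\<Lambda> _. g Fin5)$(g Perm$(h$p))$(g Perm$(h$q))$k))))"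
| "loop_entry LoopOf = (
    \<Pi> B:Ty. \<Pi> b:B. \<Pi> h:(g Idt$B$b$b -> g AltFive). g IsEquiv$(g Idt$B$b$b)$g AltFive$h -> g AltFive ->
    g Idt$B$b$b,
    Def (\<Lambda> B b h e g'. g Fst$(g Idt$B$b$b)$(\<Lambda> x. g Idt$g AltFive$(h$x)$g')$(g Fst$(g SigT$(g Idt$B$b$b)$
    (\<Lambda> x. g Idt$g AltFive$(h$x)$g'))$(\<Lambda> x. \<Pi> y:g Fib$(g Idt$B$b$b)$g AltFive$h$g'. g Idt$(g Fib$
    (g Idt$B$b$b)$g AltFive$h$g')$x$y)$(e$g'))))"
| "loop_entry PermLoopOf = (
    \<Pi> B:Ty. \<Pi> b:B. \<Pi> h:(g Idt$B$b$b -> g AltFive). \<Pi> e:g IsEquiv$(g Idt$B$b$b)$g AltFive$h. \<Pi>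
    g':g AltFive. \<Pi> x:g Fin5. g Idt$g Fin5$(g Perm$(h$(g LoopOf$B$b$h$e$g'))$x)$(g Perm$g'$x),
    Thm (\<Lambda> B b h e g' x. g Ap$g AltFive$g Fin5$(h$(g LoopOf$B$b$h$e$g'))$g'$(\<Lambda> g'. g Perm$g'$x)$(g Snd$
    (g Idt$B$b$b)$(\<Lambda> x. g Idt$g AltFive$(h$x)$g')$(g Fst$(g SigT$(g Idt$B$b$b)$(\<Lambda> x. g Idt$
    g AltFive$(h$x)$g'))$(\<Lambda> x. \<Pi> y:g Fib$(g Idt$B$b$b)$g AltFive$h$g'. g Idt$(g Fib$(g Idt$B$b$b)$
    g AltFive$h$g')$x$y)$(e$g')))))"
\<comment> \<open>At each of the five points, five applications of \<open>PermA\<close> and three of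
  \<open>PermB\<close> compute to the point itself, so reflexivity closes all cases.\<close>
| "loop_entry RelA5R = (
    \<Pi> B:Ty. \<Pi> b:B. \<Pi> h:(g Idt$B$b$b -> g AltFive). (\<Pi> p:g Idt$B$b$b. \<Pi> q:g Idt$B$b$b. g Idt$(g Fin5
    -> g Fin5)$(g Perm$(h$(g Conc$B$b$b$b$p$q)))$(\<Lambda> x. g Perm$(h$p)$(g Perm$(h$q)$x))) -> g IsEquiv$(g Idt$
    B$b$b)$g AltFive$h -> \<Pi> k:g Idt$B$b$b. (\<Pi> x:g Fin5. g Idt$g Fin5$(g Perm$(h$k)$x)$(g PermA$x)) -> \<Pi>
    l:g Idt$B$b$b. (\<Pi> x:g Fin5. g Idt$g Fin5$(g Perm$(h$l)$x)$(g PermB$x)) -> g Idt$(g Idt$B$b$b)$(g Pow5$B$b$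
    k)$(g Pow3$B$b$l),
    Thm (\<Lambda> B b h mul e k kk l ll. g LoopEq$B$b$h$e$(g Pow5$B$b$k)$(g Pow3$B$b$l)$(\<Lambda> x. g Conc$g Fin5$
    (g Perm$(h$(g Pow5$B$b$k))$x)$(g Perm$(h$(g Refl$B$b))$(g PermA$(g PermA$(g PermA$(g PermA$(g PermA$x))))))$
    (g Perm$(h$(g Pow3$B$b$l))$x)$(g ActPow5$B$b$h$mul$k$g PermA$kk$x)$(g Conc$g Fin5$(g Perm$(h$(g Refl$B$b))$
    (g PermA$(g PermA$(g PermA$(g PermA$(g PermA$x))))))$(g Perm$(h$(g Refl$B$b))$(g PermB$(g PermB$(g PermB$x))))$
    (g Perm$(h$(g Pow3$B$b$l))$x)$(g Ind5$(\<Lambda> x. g Idt$g Fin5$(g Perm$(h$(g Refl$B$b))$(g PermA$(g PermA$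
    (g PermA$(g PermA$(g PermA$x))))))$(g Perm$(h$(g Refl$B$b))$(g PermB$(g PermB$(g PermB$x)))))$(g Refl$g Fin5$
    (g Perm$(h$(g Refl$B$b))$(g PermA$(g PermA$(g PermA$(g PermA$(g PermA$g E0)))))))$(g Refl$g Fin5$(g Perm$(h$
    (g Refl$B$b))$(g PermA$(g PermA$(g PermA$(g PermA$(g PermA$g E1)))))))$(g Refl$g Fin5$(g Perm$(h$(g Refl$B$b))$
    (g PermA$(g PermA$(g PermA$(g PermA$(g PermA$g E2)))))))$(g Refl$g Fin5$(g Perm$(h$(g Refl$B$b))$(g PermA$
    (g PermA$(g PermA$(g PermA$(g PermA$g E3)))))))$(g Refl$g Fin5$(g Perm$(h$(g Refl$B$b))$(g PermA$(g PermA$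
    (g PermA$(g PermA$(g PermA$g E4)))))))$x)$(g Inv$g Fin5$(g Perm$(h$(g Pow3$B$b$l))$x)$(g Perm$(h$(g Refl$B$b))$
    (g PermB$(g PermB$(g PermB$x))))$(g ActPow3$B$b$h$mul$l$g PermB$ll$x))))))"
\<comment> \<open>\<open>ActPow2\<close> is applied to the concatenated loop, whose permutation is
  \<open>PermA\<close> after \<open>PermB\<close> by multiplicativity.\<close>
| "loop_entry RelA5S = (
    \<Pi> B:Ty. \<Pi> b:B. \<Pi> h:(g Idt$B$b$b -> g AltFive). (\<Pi> p:g Idt$B$b$b. \<Pi> q:g Idt$B$b$b. g Idt$(g Fin5
    -> g Fin5)$(g Perm$(h$(g Conc$B$b$b$b$p$q)))$(\<Lambda> x. g Perm$(h$p)$(g Perm$(h$q)$x))) -> g IsEquiv$(g Idt$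
    B$b$b)$g AltFive$h -> \<Pi> k:g Idt$B$b$b. (\<Pi> x:g Fin5. g Idt$g Fin5$(g Perm$(h$k)$x)$(g PermA$x)) -> \<Pi>
    l:g Idt$B$b$b. (\<Pi> x:g Fin5. g Idt$g Fin5$(g Perm$(h$l)$x)$(g PermB$x)) -> g Idt$(g Idt$B$b$b)$(g Pow3$B$b$
    l)$(g Pow2$B$b$(g Conc$B$b$b$b$k$l)),
    Thm (\<Lambda> B b h mul e k kk l ll. g LoopEq$B$b$h$e$(g Pow3$B$b$l)$(g Pow2$B$b$(g Conc$B$b$b$b$k$l))$(\<Lambda>
    x. g Conc$g Fin5$(g Perm$(h$(g Pow3$B$b$l))$x)$(g Perm$(h$(g Refl$B$b))$(g PermB$(g PermB$(g PermB$x))))$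
    (g Perm$(h$(g Pow2$B$b$(g Conc$B$b$b$b$k$l)))$x)$(g ActPow3$B$b$h$mul$l$g PermB$ll$x)$(g Conc$g Fin5$(g Perm$(h$
    (g Refl$B$b))$(g PermB$(g PermB$(g PermB$x))))$(g Perm$(h$(g Refl$B$b))$(g PermA$(g PermB$(g PermA$(g PermB$
    x)))))$(g Perm$(h$(g Pow2$B$b$(g Conc$B$b$b$b$k$l)))$x)$(g Ind5$(\<Lambda> x. g Idt$g Fin5$(g Perm$(h$(g Refl$B$
    b))$(g PermB$(g PermB$(g PermB$x))))$(g Perm$(h$(g Refl$B$b))$(g PermA$(g PermB$(g PermA$(g PermB$x))))))$
    (g Refl$g Fin5$(g Perm$(h$(g Refl$B$b))$(g PermB$(g PermB$(g PermB$g E0)))))$(g Refl$g Fin5$(g Perm$(h$(g Refl$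
    B$b))$(g PermB$(g PermB$(g PermB$g E1)))))$(g Refl$g Fin5$(g Perm$(h$(g Refl$B$b))$(g PermB$(g PermB$(g PermB$
    g E2)))))$(g Refl$g Fin5$(g Perm$(h$(g Refl$B$b))$(g PermB$(g PermB$(g PermB$g E3)))))$(g Refl$g Fin5$(g Perm$
    (h$(g Refl$B$b))$(g PermB$(g PermB$(g PermB$g E4)))))$x)$(g Inv$g Fin5$(g Perm$(h$(g Pow2$B$b$(g Conc$B$b$b$b$k$
    l)))$x)$(g Perm$(h$(g Refl$B$b))$(g PermA$(g PermB$(g PermA$(g PermB$x)))))$(g ActPow2$B$b$h$mul$(g Conc$B$b$b$
    b$k$l)$(\<Lambda> x. g PermA$(g PermB$x))$(\<Lambda> x. g Conc$g Fin5$(g Perm$(h$(g Conc$B$b$b$b$k$l))$x)$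
    (g PermA$(g Perm$(h$l)$x))$(g PermA$(g PermB$x))$(g ActLeft$B$b$h$mul$k$g PermA$kk$l$x)$(g Ap$g Fin5$g Fin5$
    (g Perm$(h$l)$x)$(g PermB$x)$g PermA$(ll$x)))$x))))))"
| "loop_entry PermIId = (
    \<Pi> x:g Fin5. g Idt$g Fin5$(g PermI$x)$x,
    Thm (\<Lambda> x. g Ind5$(\<Lambda> x. g Idt$g Fin5$(g PermI$x)$x)$(g Refl$g Fin5$(g PermI$g E0))$(g Refl$g Fin5$
    (g PermI$g E1))$(g Refl$g Fin5$(g PermI$g E2))$(g Refl$g Fin5$(g PermI$g E3))$(g Refl$g Fin5$(g PermI$g E4))$x))"
\<comment> \<open>In the base case \<open>q\<close> acts as the identity, like \<open>o'\<close>; so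
  they are equal by \<open>LoopEq\<close>, and \<open>S\<close> is transported from one to the
  other.\<close>
| "loop_entry Generates = (
    \<Pi> B:Ty. \<Pi> b:B. \<Pi> h:(g Idt$B$b$b -> g AltFive). (\<Pi> p:g Idt$B$b$b. \<Pi> q:g Idt$B$b$b. g Idt$(g Fin5
    -> g Fin5)$(g Perm$(h$(g Conc$B$b$b$b$p$q)))$(\<Lambda> x. g Perm$(h$p)$(g Perm$(h$q)$x))) -> g IsEquiv$(g Idt$
    B$b$b)$g AltFive$h -> \<Pi> k:g Idt$B$b$b. (\<Pi> x:g Fin5. g Idt$g Fin5$(g Perm$(h$k)$x)$(g PermA$x)) -> \<Pi>
    l:g Idt$B$b$b. (\<Pi> x:g Fin5. g Idt$g Fin5$(g Perm$(h$l)$x)$(g PermB$x)) -> \<Pi> o':g Idt$B$b$b. (\<Pi>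
    x:g Fin5. g Idt$g Fin5$(g Perm$(h$o')$x)$x) -> \<Pi> S:(g Idt$B$b$b -> Ty). (\<Pi> v:g Idt$B$b$b. S$(g Conc$B$b$
    b$b$k$v) -> S$v) -> (\<Pi> v:g Idt$B$b$b. S$(g Conc$B$b$b$b$l$v) -> S$v) -> S$o' -> \<Pi> v:g Idt$B$b$b. S$v,
    Thm (\<Lambda> B b h mul e k kk l ll o' oo S c d so. g Generation$(g Idt$B$b$b)$(\<Lambda> q. g Perm$(h$q))$S$
    (\<Lambda> q. g Conc$B$b$b$b$k$q)$(g ActLeft$B$b$h$mul$k$g PermA$kk)$c$(\<Lambda> q. g Conc$B$b$b$b$l$q)$
    (g ActLeft$B$b$h$mul$l$g PermB$ll)$d$(\<Lambda> q. g EquivInj$g Fin5$g Fin5$(g Perm$(h$q))$(g Snd$(g Fin5 ->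
    g Fin5)$(\<Lambda> f. g IsEquiv$g Fin5$g Fin5$f)$(g Fst$(g SigT$(g Fin5 -> g Fin5)$(\<Lambda> f. g IsEquiv$
    g Fin5$g Fin5$f))$(\<Lambda> e. g IsEven$e)$(h$q))))$(\<Lambda> q. g Snd$g PermFive$(\<Lambda> e. g IsEven$e)$
    (h$q))$(\<Lambda> q r. g Transp$(g Idt$B$b$b)$S$o'$q$(g LoopEq$B$b$h$e$o'$q$(\<Lambda> x. g Conc$g Fin5$(g Perm$
    (h$o')$x)$x$(g Perm$(h$q)$x)$(oo$x)$(g Inv$g Fin5$(g Perm$(h$q)$x)$x$(r$x))))$so)))"
\<comment> \<open>Contractibility of the truncated fibre is a proposition, so connectedness of
  \<open>B\<close> spreads it from the base point.\<close>
| "loop_entry MapConnected = (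
    \<Pi> B:Ty. \<Pi> b:B. g IsContr$(g Trunc$B) -> \<Pi> f:(g XT -> B). g IsContr$(g Trunc$(g Fib$g XT$B$f$b)) ->
    g SigT$(g XT -> B)$(\<Lambda> f. \<Pi> y:B. g IsContr$(g Trunc$(g Fib$g XT$B$f$y))),
    Thm (\<Lambda> B b c f d. g Pr$(g XT -> B)$(\<Lambda> f. \<Pi> y:B. g IsContr$(g Trunc$(g Fib$g XT$B$f$y)))$f$
    (g ConnectedInd$B$b$c$(\<Lambda> y. g IsContr$(g Trunc$(g Fib$g XT$B$f$y)))$(\<Lambda> y. g IsContrProp$
    (g Trunc$(g Fib$g XT$B$f$y)))$d)))"
| "loop_entry MapFromLoops = (
    \<Pi> B:Ty. \<Pi> b:B. \<Pi> h:(g Idt$B$b$b -> g AltFive). (\<Pi> p:g Idt$B$b$b. \<Pi> q:g Idt$B$b$b. g Idt$(g Fin5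
    -> g Fin5)$(g Perm$(h$(g Conc$B$b$b$b$p$q)))$(\<Lambda> x. g Perm$(h$p)$(g Perm$(h$q)$x))) -> g IsEquiv$(g Idt$
    B$b$b)$g AltFive$h -> \<Pi> k:g Idt$B$b$b. (\<Pi> x:g Fin5. g Idt$g Fin5$(g Perm$(h$k)$x)$(g PermA$x)) -> \<Pi>
    l:g Idt$B$b$b. (\<Pi> x:g Fin5. g Idt$g Fin5$(g Perm$(h$l)$x)$(g PermB$x)) -> \<Pi> o':g Idt$B$b$b. (\<Pi>
    x:g Fin5. g Idt$g Fin5$(g Perm$(h$o')$x)$x) -> g IsContr$(g Trunc$B) -> g SigT$(g XT -> B)$(\<Lambda> f. \<Pi>
    y:B. g IsContr$(g Trunc$(g Fib$g XT$B$f$y))),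
    Thm (\<Lambda> B b h mul e k kk l ll o' oo c. g MapConnected$B$b$c$(g RecX$B$b$k$l$(g RelA5R$B$b$h$mul$e$k$kk$l$ll)$
    (g RelA5S$B$b$h$mul$e$k$kk$l$ll))$(g FibPtContr$B$b$k$l$(g RelA5R$B$b$h$mul$e$k$kk$l$ll)$(g RelA5S$B$b$h$mul$e$
    k$kk$l$ll)$o'$(g Generates$B$b$h$mul$e$k$kk$l$ll$o'$oo))))"
| "loop_entry ExistsMap = (
    \<Pi> B:Ty. \<Pi> b:B. \<Pi> h:(g Idt$B$b$b -> g AltFive). (\<Pi> p:g Idt$B$b$b. \<Pi> q:g Idt$B$b$b. g Idt$(g Fin5
    -> g Fin5)$(g Perm$(h$(g Conc$B$b$b$b$p$q)))$(\<Lambda> x. g Perm$(h$p)$(g Perm$(h$q)$x))) -> g IsEquiv$(g Idt$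
    B$b$b)$g AltFive$h -> g IsContr$(g Trunc$B) -> g SigT$(g XT -> B)$(\<Lambda> f. \<Pi> y:B. g IsContr$(g Trunc$
    (g Fib$g XT$B$f$y))),
    Thm (\<Lambda> B b h mul e. g MapFromLoops$B$b$h$mul$e$(g LoopOf$B$b$h$e$g ElemA)$(g PermLoopOf$B$b$h$e$g ElemA)$
    (g LoopOf$B$b$h$e$g ElemB)$(g PermLoopOf$B$b$h$e$g ElemB)$(g LoopOf$B$b$h$e$g ElemI)$(\<Lambda> x. g Conc$
    g Fin5$(g Perm$(h$(g LoopOf$B$b$h$e$g ElemI))$x)$(g Perm$g ElemI$x)$x$(g PermLoopOf$B$b$h$e$g ElemI$x)$
    (g PermIId$x))))"
| "loop_entry Is1Type = (
    Ty -> Ty,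
    Def (\<Lambda> A. \<Pi> x:A. \<Pi> y:A. g IsSet$(g Idt$A$x$y)))"
| "loop_entry MulLaw = (
    \<Pi> B:Ty. \<Pi> b:B. (g Idt$B$b$b -> g AltFive) -> Ty,
    Def (\<Lambda> B b h. \<Pi> p:g Idt$B$b$b. \<Pi> q:g Idt$B$b$b. g Idt$(g Fin5 -> g Fin5)$(g Perm$(h$(g Conc$B$b$b$b$
    p$q)))$(\<Lambda> x. g Perm$(h$p)$(g Perm$(h$q)$x))))"
| "loop_entry LoopsIsoA5 = (
    \<Pi> B:Ty. B -> Ty,
    Def (\<Lambda> B b. g SigT$(g Idt$B$b$b -> g AltFive)$(\<Lambda> h. g SigT$(g IsEquiv$(g Idt$B$b$b)$g AltFive$h)$
    (\<Lambda> _. g MulLaw$B$b$h))))"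
| "loop_entry IsClassifyingA5 = (
    \<Pi> B:Ty. B -> Ty,
    Def (\<Lambda> B b. g SigT$(g IsContr$(g Trunc$B))$(\<Lambda> _. g SigT$(g Is1Type$B)$(\<Lambda> _. g LoopsIsoA5$B$
    b))))"
| "loop_entry ConnectedMap = (
    Ty -> Ty,
    Def (\<Lambda> B. g SigT$(g XT -> B)$(\<Lambda> f. \<Pi> y:B. g IsContr$(g Trunc$(g Fib$g XT$B$f$y)))))"
| "loop_entry Final = (
    \<Pi> B:Ty. \<Pi> b:B. g IsClassifyingA5$B$b -> g ConnectedMap$B,
    Thm (\<Lambda> B b. g SigRec$(g IsContr$(g Trunc$B))$(\<Lambda> _. g SigT$(g Is1Type$B)$(\<Lambda> _. g LoopsIsoA5$
    B$b))$(\<Lambda> _. g ConnectedMap$B)$(\<Lambda> c. g SigRec$(g Is1Type$B)$(\<Lambda> _. g LoopsIsoA5$B$b)$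
    (\<Lambda> _. g ConnectedMap$B)$(\<Lambda> _. g SigRec$(g Idt$B$b$b -> g AltFive)$(\<Lambda> h. g SigT$
    (g IsEquiv$(g Idt$B$b$b)$g AltFive$h)$(\<Lambda> _. g MulLaw$B$b$h))$(\<Lambda> _. g ConnectedMap$B)$(\<Lambda>
    h. g SigRec$(g IsEquiv$(g Idt$B$b$b)$g AltFive$h)$(\<Lambda> _. g MulLaw$B$b$h)$(\<Lambda> _. g ConnectedMap$B)$
    (\<Lambda> e mul. g ExistsMap$B$b$h$mul$e$c))))))"
\<comment> \<open>Names the statement itself, as a type one universe up because it quantifies over
  \<open>Ty\<close>, so that its unfolding can be compared with the raw theorem.\<close>
| "loop_entry StatementType = (
    Ty1,
    Def h_statement)"

primrec entry_of :: "name \<Rightarrow> entry" where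
  "entry_of (Paths d) = path_entry d"
| "entry_of (Levels d) = level_entry d"
| "entry_of (Univalence d) = univ_entry d"
| "entry_of (Finite d) = finite_entry d"
| "entry_of (Alternating d) = alt_entry d"
| "entry_of (Cosets d) = coset_entry d"
| "entry_of (Dependent d) = dep_entry d"
| "entry_of (Cells d) = cell_entry d"
| "entry_of (Loops d) = loop_entry d"

section \<open>Evaluating the checker by simplification\<close>

definition type_of :: "name \<Rightarrow> name gtm" where "type_of d = fst (entry_of d) 0"
definition body_of :: "name \<Rightarrow> name gtm" where "body_of d = definiens_body (snd (entry_of d))"
definition transparent :: "name \<Rightarrow> bool" where "transparent d = definiens_transparent (snd (entry_of d))"

lemma entry_ofD:
  assumes "entry_of d = (T, D)"
  shows "type_of d = T 0" "body_of d = definiens_body D" "transparent d = definiens_transparent D"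
  using assms by (simp_all add: type_of_def body_of_def transparent_def)

lemmas surface_simps = h_statement_def h_contr_def h_prop_def h_set_def h_1type_def h_fib_def h_is_equiv_def
  h_equiv_def h_fst_def h_equiv_fun_def h_Sym5_def h_is_even_def h_A5_def h_perm_def h_conc_def
  h_loops_iso_def Let_def hvar_def hlam_def hpi_def harrow_def happ_def
  Ty_def Ty1_def g_def g1_def name_of_path_name_def name_of_level_name_def name_of_univ_name_def
  name_of_finite_name_def name_of_alt_name_def name_of_coset_name_def
  name_of_dep_name_def name_of_cell_name_def name_of_loop_name_def
  definiens_body.simps definiens_transparent.simps eval_nat_numeral BitM.simps One_nat_def
  diff_Suc_Suc diff_zero zero_diff

lemmas entries = path_entry.simps [folded entry_of.simps(1)]
  level_entry.simps [folded entry_of.simps(2)]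
  univ_entry.simps [folded entry_of.simps(3)]
  finite_entry.simps [folded entry_of.simps(4)]
  alt_entry.simps [folded entry_of.simps(5)]
  coset_entry.simps [folded entry_of.simps(6)]
  dep_entry.simps [folded entry_of.simps(7)]
  cell_entry.simps [folded entry_of.simps(8)]
  loop_entry.simps [folded entry_of.simps(9)]

text \<open>The surface syntax is expanded here once, so that the checker runs on plain de Bruijn
  terms.\<close>

lemmas type_of_simps = entries [THEN entry_ofD(1), simplified surface_simps]
lemmas body_of_simps = entries [THEN entry_ofD(2), simplified surface_simps]
lemmas transparent_simps = entries [THEN entry_ofD(3), simplified surface_simps]

interpretation dev: signature type_of body_of transparent .

text \<open>Weak rules keep branches that are not taken unevaluated. The full
  \<open>imp_cong\<close> is the exception: it hands the validity of an entry on to the entries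
  after it.\<close>

lemmas weak_congs = imp_cong if_weak_cong option.case_cong_weak gtm.case_cong_weak prod.case_cong_weak
  list.case_cong_weak const.case_cong_weak

text \<open>Bounds the nesting depth of calls, not their number, as each call passes the same
  remainder to all its subcalls.\<close>

definition fuel :: nat where "fuel = 200"
lemmas fuel_eq = fuel_def [simplified eval_nat_numeral BitM.simps One_nat_def]

lemmas raw_simps = const_type.simps close_stm_def bound_var_def lam_def pi_ty_def app_def universe_def cst_def
  arrow_def sigma_ty_def times_def pair_def pr1_def idt_def rfl_def path_ind_def
  is_contr_def is_prop_def is_set_def is_1type_def fib_def is_equiv_def equiv_def equiv_fun_def
  id_is_equiv_def id_to_equiv_def happly_def trunc_def conc_def loop_pow.simps transp_def dpath_def
  dconc_def dloop_pow.simps dpath2_def apd_def X_def ptX_def loopsX_def aX_def bX_def abX_def powX_def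
  dloopX_def dpowX_def dabX_def dataR_def dataS_def apdX_def ind_data_def
  Let_def foldr.simps id_apply o_apply upt.simps append.simps foldl_Cons foldl_Nil list.map
  eval_nat_numeral BitM.simps One_nat_def diff_Suc_Suc diff_zero zero_diff

lemmas const_checked_simps = raw_simps bounded.simps shift.simps const_ok.simps nat.inject nat.distinct
  zero_less_Suc Suc_less_eq not_less_zero le0 Suc_le_mono le_zero_eq if_True if_False simp_thms add_0 add_Suc

lemma const_checked:
  "const_checked CId" "const_checked CRefl" "const_checked CIdInd" "const_checked CSig" "const_checked CPair"
  "const_checked CSigInd" "const_checked CFunext" "const_checked CUnivalence" "const_checked CTrunc"
  "const_checked CTr" "const_checked CTruncSet" "const_checked CTruncInd" "const_checked (CFinInd 0)"
  "const_checked (CEl 1 0)" "const_checked (CFinInd 1)" "const_checked (CEl 2 0)" "const_checked (CEl 2 1)"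
  "const_checked (CFinInd 2)" "const_checked (CEl 5 0)" "const_checked (CEl 5 1)" "const_checked (CEl 5 2)"
  "const_checked (CEl 5 3)" "const_checked (CEl 5 4)" "const_checked (CFinInd 5)" "const_checked CPt"
  "const_checked CA" "const_checked CB" "const_checked CR" "const_checked CS" "const_checked CXInd"
  "const_checked CXIndA" "const_checked CXIndB"
  by (rule const_checkedI; simp only: const_checked_simps)+

lemma const_checked_U:
  "const_checked (CFin 0)" "const_checked (CFin 1)" "const_checked (CFin 2)" "const_checked (CFin 5)"
  "const_checked CX"
  by (rule const_checkedI_U; simp only: const_checked_simps)+

lemmas const_checked_eqs = const_checked [unfolded eval_nat_numeral BitM.simps One_nat_def]
  const_checked_U [unfolded eval_nat_numeral BitM.simps One_nat_def]

lemmas kernel_simps =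
  raise.simps glift.simps strike.simps lift_by.simps gsubst.simps gshift.simps shift_by.simps
  lookup.simps unwind.simps beta.simps split_at.simps
  dev.iota_sig.simps dev.iota_id.simps dev.iota_trunc.simps dev.iota_X.simps dev.iota_fin.simps dev.iota.simps
  dev.whnf.simps dev.conv_check.simps dev.struct_check.simps dev.eta_check.simps
  dev.universe_of.simps dev.subtype_check.simps dev.infer.simps dev.check.simps dev.expose.simps
  dev.is_type_check_def dev.names_valid.simps dev.definition_check_def dev.constant_check_def dev.entry_check_def
  dev.entries_check.simps const_checked_eqs list.map dev.quote.simps
  type_of_simps body_of_simps transparent_simps fuel_eq
  gtm.case option.case prod.case list.case const.case nat.inject nat.distinct const.inject const.distinct
  name.inject name.distinct path_name.distinct level_name.distinct univ_name.distinct finite_name.distinct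
  alt_name.distinct coset_name.distinct dep_name.distinct cell_name.distinct
  loop_name.distinct
  if_True if_False simp_thms add_0 add_Suc le0 Suc_le_mono not_less_eq_eq Suc_n_not_le_n le_zero_eq

text \<open>The order of each list matters: an entry may mention only names shown valid before it,
  in its own list or in an earlier one.\<close>

lemma path_valid: "list_all dev.valid (map Paths
  [Idt, Refl, PathInd, SigT, Pr, SigRec, Conc, Transp, Inv, Ap, InvConc, ReflConc])"
  by (rule dev.valid_entries [where f = fuel], simp only: raw_simps kernel_simps
    
    cong: weak_congs)
lemmas path_facts = path_valid [unfolded list.map list.pred_inject simp_thms]

lemma level_valid: "list_all dev.valid (map Levels
  [Fst, Snd, IsContr, IsProp, IsSet, Fib, IsEquiv, Equiv, HedbergPath, Hedberg, PropSet, SigPath,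
   SigPropPath, Happly, FunextAx, Funext, PiProp, ContrProp, IsContrProp, IsEquivProp, IsoEquiv,
   EquivInj])"
  by (rule dev.valid_entries [where f = fuel], simp only: raw_simps kernel_simps
    path_facts
    cong: weak_congs)
lemmas level_facts = level_valid [unfolded list.map list.pred_inject simp_thms]

lemma univ_valid: "list_all dev.valid (map Univalence
  [IdIsEquiv, IdToEquiv, UnivalenceAx, PropExt, HProp, Holds, HoldsProp, IsPropProp, Iff, IffProp,
   PathIff, IffPath, HpropSet, Trunc, Tr, TruncSet, TruncInd, ConnectedInd])"
  by (rule dev.valid_entries [where f = fuel], simp only: raw_simps kernel_simps
    path_facts level_facts
    cong: weak_congs)
lemmas univ_facts = univ_valid [unfolded list.map list.pred_inject simp_thms]

lemma finite_valid: "list_all dev.valid (map Finite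
  [Fin0, Ind0, Fin1, Star, Ind1, Fin2, B0, B1, Ind2, Fin5, E0, E1, E2, E3, E4, Ind5, Exfalso,
   UnitProp, EmptyProp, Code2, Encode2, CodeProp2, Decode2, FinSet2, Code5, Encode5, CodeProp5,
   Decode5, FinSet5])"
  by (rule dev.valid_entries [where f = fuel], simp only: raw_simps kernel_simps
    path_facts level_facts univ_facts
    cong: weak_congs)
lemmas finite_facts = finite_valid [unfolded list.map list.pred_inject simp_thms]

lemma alt_valid: "list_all dev.valid (map Alternating
  [Xor, Less, Parity, EquivFun, PermFive, IsEven, AltFive, Perm, PermInj, PermA, PermAinv, PermAEquiv,
   PermAEven, ElemA, PermB, PermBinv, PermBEquiv, PermBEven, ElemB, PermI, PermIEquiv, PermIEven,
   ElemI, PermS])"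
  by (rule dev.valid_entries [where f = fuel], simp only: kernel_simps
    path_facts level_facts univ_facts finite_facts
    cong: weak_congs)
lemmas alt_facts = alt_valid [unfolded list.map list.pred_inject simp_thms]

lemma coset_valid: "list_all dev.valid (map Cosets
  [Reach1, Step1, Reach2, Step2, Reach3, Step3, Cover1, Cover2, Cover3, Fixing, Generation])"
  by (rule dev.valid_entries [where f = fuel], simp only: kernel_simps
    path_facts level_facts univ_facts finite_facts alt_facts
    cong: weak_congs)
lemmas coset_facts = coset_valid [unfolded list.map list.pred_inject simp_thms]

lemma dep_valid: "list_all dev.valid (map Dependent
  [DPath, Dconc, Pow0, Dpow0, Pow1, Dpow1, Pow2, Dpow2, Pow3, Dpow3, Pow4, Dpow4, Pow5, Dpow5, Apd,
   Tw, TwConcRefl, TwConc, TwStep, TwPow0, TwPow1, TwPow2, TwPow3, TwPow4, TwPow5, TwOverRefl,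
   TwOver])"
  by (rule dev.valid_entries [where f = fuel], simp only: kernel_simps
    path_facts level_facts univ_facts finite_facts alt_facts coset_facts
    cong: weak_congs)
lemmas dep_facts = dep_valid [unfolded list.map list.pred_inject simp_thms]

lemma cell_valid: "list_all dev.valid (map Cells
  [XT, PtX, LoopA, LoopB, RelR, RelS, DataR, DataS, IndX, IndXA, IndXB, IndXProp, RecR, RecS, RecX,
   FibMove, MoveA, MoveB, TruncContr, FibInd, FibContr, Transfer, FibPtContr])"
  by (rule dev.valid_entries [where f = fuel], simp only: raw_simps kernel_simps
    path_facts level_facts univ_facts finite_facts alt_facts coset_facts dep_facts
    cong: weak_congs)
lemmas cell_facts = cell_valid [unfolded list.map list.pred_inject simp_thms]

lemma loop_valid: "list_all dev.valid (map Loops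
  [ActConc, ActLeft, ActRight, ActPow0, ActPow1, ActPow2, ActPow3, ActPow4, ActPow5, LoopEq, LoopOf,
   PermLoopOf, RelA5R, RelA5S, PermIId, Generates, MapConnected, MapFromLoops, ExistsMap, Is1Type,
   MulLaw, LoopsIsoA5, IsClassifyingA5, ConnectedMap, Final, StatementType])"
  by (rule dev.valid_entries [where f = fuel], simp only: kernel_simps
    path_facts level_facts univ_facts finite_facts alt_facts coset_facts dep_facts cell_facts
    cong: weak_congs)
lemmas loop_facts = loop_valid [unfolded list.map list.pred_inject simp_thms]

lemmas valid_facts = path_facts level_facts univ_facts finite_facts alt_facts coset_facts dep_facts cell_facts
  loop_facts

section \<open>From the named statement to the theorem\<close>

lemmas statement_simps = is_classifying_A5_def is_0connected_map_def is_0connected_def loops_iso_A5_def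
  A5_def perm_def is_even_def Sym5_def fin_def el_def fin_rec_def inversion_parity_def xor2_def less5_def
  prod.case concat.simps

definition goal_type :: "nat \<Rightarrow> tm" where
  "goal_type i = close_stm
    (\<^bold>\<Pi>BA5:universe i. \<^bold>\<Pi>pt:BA5. is_classifying_A5 BA5 pt \<^bold>\<rightarrow>
       (\<^bold>\<Sigma>f:X \<^bold>\<rightarrow> BA5. is_0connected_map X BA5 f))"

text \<open>Stronger than convertibility: with its names expanded, the checked statement is
  literally the raw type of the theorem.\<close>

lemma goal_type_erases: "dev.erases (body_of (Loops StatementType)) (goal_type 0)"
  by (simp only: goal_type_def statement_simps dev.erases_simps dev.erases_Glob body_of_simps raw_simps valid_facts
      nat.inject nat.distinct if_True if_False simp_thms le0 Suc_le_mono le_zero_eq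
      zero_less_Suc Suc_less_eq not_less_zero)

text \<open>The only universe in the term is the one that the outermost quantifier ranges
  over.\<close>

lemma shift_goal_type: "shift i (goal_type 0) = goal_type i"
  by (simp only: goal_type_def statement_simps raw_simps shift.simps add_0
      nat.inject nat.distinct if_True if_False simp_thms le0 Suc_le_mono le_zero_eq
      zero_less_Suc Suc_less_eq not_less_zero)

theorem proposition7p4:
  fixes i :: nat
  shows "\<exists>t. [] \<turnstile> t \<Colon> close_stm
    (\<^bold>\<Pi>BA5:universe i. \<^bold>\<Pi>pt:BA5. is_classifying_A5 BA5 pt \<^bold>\<rightarrow>
       (\<^bold>\<Sigma>f:X \<^bold>\<rightarrow> BA5. is_0connected_map X BA5 f))"
proof -
  have v: "dev.valid (Loops Final)" by (simp only: valid_facts)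
  have n: "dev.names_valid (body_of (Loops StatementType))"
    by (simp only: kernel_simps valid_facts cong: weak_congs)
  have w: "dev.is_type_check fuel (body_of (Loops StatementType))"
    by (simp only: kernel_simps cong: weak_congs)
  \<comment> \<open>The type of \<open>Final\<close> is phrased with named notions, the statement
    with their expansions; conversion unfolds the names.\<close>
  have c: "dev.conv_check fuel (type_of (Loops Final)) (body_of (Loops StatementType))"
    by (simp only: kernel_simps cong: weak_congs)
  obtain t where "hastype [] t (goal_type 0)"
    using dev.valid_inhabits [OF v goal_type_erases n w c] by blast
  \<comment> \<open>The proof at level 0 is moved to level \<open>i\<close> by raising all universes
    in it.\<close>
  then have "hastype [] (shift i t) (goal_type i)"
    using hastype_shift [of "[]" t "goal_type 0" i] by (simp add: shift_goal_type)
  then have "[] \<turnstile> shift i t \<Colon> goal_type i" using wf_Nil by (rule hastype_typing)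
  then show ?thesis unfolding goal_type_def by blast
qed

end
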